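(* Let $p$ be a prime number and let $E$ be an elliptic curve over $\mathbb{Q}$ that has suitable twists with respect to $p$, i.e. for every $d \in \mathbb{Q}_p^\ast$ there exists $c \in \mathbb{Q}^\ast$ with $d/c \in \mathbb{Q}_p^{\ast 2}$ and $E^c(\mathbb{Q})$ dense in $E^c(\mathbb{Q}_p)$. Let $X = \mathrm{Km}(E \times E)$. Then $X(\mathbb{Q})$ is dense in $X(\mathbb{Q}_p)$.
   Context: If $E$ is an elliptic curve over a field $k$ (of characteristic not $2$) given by a Weierstrass equation $y^2 = f(x)$ and $c \in k^\ast$, then $E^c$ denotes the quadratic twist of $E$ by $c$, i.e. the elliptic curve $c y^2 = f(x)$. For an abelian variety $A$ over a field of characteristic different from $2$, $\mathrm{Km}(A)$ denotes the Kummer variety of $A$: the blow-up of the quotient $A/\langle -1\rangle$ in the image of the $2$-torsion subgroup $A[2]$. Density is with respect to the $p$-adic topology. *)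

theory Defs
  imports
    "HOL-Analysis.Analysis"
    "HOL-Algebra.Algebraic_Closure_Type"
begin

section \<open>The field of \<open>p\<close>-adic numbers\<close>

definition padic_abs :: "nat \<Rightarrow> rat \<Rightarrow> real" where
  "padic_abs p q =
     (if q = 0 then 0
      else real p powi (int (multiplicity (int p) (snd (quotient_of q)))
                      - int (multiplicity (int p) (fst (quotient_of q)))))"

text \<open>
  The type \<open>'k\<close>, with its metric, is the completion of the rationals at \<open>p\<close>. Its absolute value is
  \<open>x \<mapsto> dist x 0\<close>, and completeness is the class \<open>complete_space\<close>. Such a field is
  unique up to a unique isometric isomorphism.
\<close>

definition padic_completion :: "nat \<Rightarrow> 'k :: {field_char_0, complete_space} itself \<Rightarrow> bool" where
  "padic_completion p _ \<longleftrightarrow>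
     (\<forall>x y :: 'k. dist x y = dist (x - y) 0) \<and>
     (\<forall>x y :: 'k. dist (x * y) 0 = dist x 0 * dist y 0) \<and>
     (\<forall>q. dist (of_rat q) (0 :: 'k) = padic_abs p q) \<and>
     closure (range of_rat) = (UNIV :: 'k set)"


section \<open>Integral varieties over the rationals and their points\<close>

definition rat_subalgebra :: "'f :: field_char_0 set \<Rightarrow> bool" where
  "rat_subalgebra R \<longleftrightarrow>
     range of_rat \<subseteq> R \<and> (\<forall>u\<in>R. \<forall>v\<in>R. u + v \<in> R \<and> u * v \<in> R)"

definition rat_subfield :: "'f :: field_char_0 set \<Rightarrow> bool" where
  "rat_subfield F \<longleftrightarrow> rat_subalgebra F \<and> (\<forall>u\<in>F. inverse u \<in> F)"

text \<open>Only the values of \<open>h\<close> on \<open>R\<close> matter. Such a map fixes the rationals.\<close>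

definition rat_alg_hom :: "'f :: field_char_0 set \<Rightarrow> ('f \<Rightarrow> 'k :: field_char_0) \<Rightarrow> bool" where
  "rat_alg_hom R h \<longleftrightarrow>
     h 1 = 1 \<and> (\<forall>u\<in>R. \<forall>v\<in>R. h (u + v) = h u + h v \<and> h (u * v) = h u * h v)"

text \<open>
  A separated integral variety \<open>V\<close> over the rationals is given by an affine open cover, each
  affine open \<open>Spec R\<close> being recorded by its coordinate ring \<open>R\<close> as a subring of (a field
  containing) the function field of \<open>V\<close>.

  A \<open>K\<close>-valued point of \<open>V\<close> is a point \<open>x\<close> of \<open>V\<close> with a homomorphism from its
  residue field to \<open>K\<close>, that is, a local homomorphism from the local ring at \<open>x\<close> to \<open>K\<close>.
  It is represented by the graph of this homomorphism: \<open>(z, v) \<in> P\<close> means that the rational function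
  \<open>z\<close> is regular at \<open>P\<close> and takes the value \<open>v\<close> there. If \<open>x\<close> lies in \<open>Spec R\<close>,
  then \<open>P\<close> is a homomorphism \<open>h\<close> from \<open>R\<close> to \<open>K\<close>, extended to the localisation
  of \<open>R\<close> at the kernel of \<open>h\<close>. As \<open>V\<close> is separated, local rings determine
  points, so graphs coming from different members of the cover coincide exactly when the points do.
\<close>

definition point_of_hom :: "'f :: field_char_0 set \<Rightarrow> ('f \<Rightarrow> 'k :: field_char_0) \<Rightarrow> ('f \<times> 'k) set" where
  "point_of_hom R h = {(u / s, h u / h s) | u s. u \<in> R \<and> s \<in> R \<and> h s \<noteq> 0}"

definition points :: "'f :: field_char_0 set set \<Rightarrow> ('f \<times> 'k :: field_char_0) set set" where
  "points V = {point_of_hom R h | R h. R \<in> V \<and> rat_alg_hom R h}"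

text \<open>
  On a member of the cover \<open>Spec R\<close> the following is the topology of pointwise
  convergence on the homomorphisms from \<open>R\<close> to \<open>K\<close>, i.e. the subspace topology from
  affine space over \<open>K\<close>.
\<close>

definition points_topology ::
    "'f :: field_char_0 set set \<Rightarrow> ('f \<times> 'k :: {field_char_0, topological_space}) set topology" where
  "points_topology V =
     topology_generated_by {{P \<in> points V. \<exists>v\<in>U. (z, v) \<in> P} | z U. open U}"

definition extend_scalars :: "('f \<times> rat) set \<Rightarrow> ('f \<times> 'k :: field_char_0) set" where
  "extend_scalars P = map_prod id of_rat ` P"

definition rational_points_dense ::
    "'f :: field_char_0 set set \<Rightarrow> 'k :: {field_char_0, topological_space} itself \<Rightarrow> bool" where
  "rational_points_dense V _ \<longleftrightarrow>
     Abstract_Topology.closure_of (points_topology V :: ('f \<times> 'k) set topology)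
       (extend_scalars ` points V) = points V"


section \<open>Products, quotients by an involution, blow-ups and Kummer varieties\<close>

text \<open>
  For the product, the function fields of the factors have to be linearly disjoint over the
  rationals, so that the ring generated by \<open>R\<close> and \<open>S\<close> is their tensor product.
\<close>

definition product_variety :: "'f :: field_char_0 set set \<Rightarrow> 'f set set \<Rightarrow> 'f set set" where
  "product_variety V W = {rat_subalgebra hull (R \<union> S) | R S. R \<in> V \<and> S \<in> W}"

definition invariants :: "('f \<Rightarrow> 'f) \<Rightarrow> 'f set \<Rightarrow> 'f set" where
  "invariants \<sigma> R = {z \<in> R. \<sigma> z = z}"

text \<open>
  The affine charts of \<open>Proj (\<Oplus>\<^sub>n I\<^sup>n)\<close>, the blow-up of \<open>Spec B\<close> in the ideal \<open>I\<close>.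
\<close>

definition blowup_charts :: "'f :: field_char_0 set \<Rightarrow> 'f set \<Rightarrow> 'f set set" where
  "blowup_charts B I = {rat_subalgebra hull (B \<union> {g / a | g. g \<in> I}) | a. a \<in> I \<and> a \<noteq> 0}"

text \<open>
  Here \<open>Spec R\<close> is an affine open subset of an abelian variety \<open>A\<close>, stable under
  \<open>-1\<close>, and \<open>\<sigma>\<close> is the action of \<open>-1\<close> on functions. The points in \<open>A[2]\<close>
  are the geometric points \<open>P\<close> with \<open>P = -P\<close>. We obtain the ideal, in the coordinate ring of
  \<open>Spec R / \<langle>-1\<rangle>\<close>, of the image of \<open>A[2]\<close> (a reduced closed subscheme).
\<close>

definition two_torsion_image_ideal :: "('f :: field_char_0 \<Rightarrow> 'f) \<Rightarrow> 'f set \<Rightarrow> 'f set" where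
  "two_torsion_image_ideal \<sigma> R =
     {b \<in> invariants \<sigma> R.
        \<forall>h :: 'f \<Rightarrow> complex. rat_alg_hom R h \<and> (\<forall>z\<in>R. h (\<sigma> z) = h z) \<longrightarrow> h b = 0}"

text \<open>
  The blow-up of \<open>A / \<langle>-1\<rangle>\<close> in the image of \<open>A[2]\<close>, for an abelian variety
  \<open>A\<close> given by a cover by affine open subsets stable under \<open>-1\<close>.
\<close>

definition kummer_variety :: "'f :: field_char_0 set set \<Rightarrow> ('f \<Rightarrow> 'f) \<Rightarrow> 'f set set" where
  "kummer_variety A \<sigma> =
     (\<Union>R\<in>A. blowup_charts (invariants \<sigma> R) (two_torsion_image_ideal \<sigma> R))"


section \<open>Elliptic curves and their twists\<close>

definition weierstrass_cubic :: "rat poly \<Rightarrow> bool" where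
  "weierstrass_cubic f \<longleftrightarrow>
     Polynomial.degree f = 3 \<and> Polynomial.lead_coeff f = 1 \<and> coprime f (pderiv f)"

text \<open>
  The algebraic closure of the rational function field in two variables. It contains the function
  fields of all curves \<open>c y\<^sup>2 = f(x)\<close> and of the products of two of them.
\<close>

type_synonym ambient = "rat poly fract poly fract alg_closure"

definition gen_x1 :: ambient where
  "gen_x1 = to_ac (to_fract [:to_fract [:0, 1:]:])"

definition gen_x2 :: ambient where
  "gen_x2 = to_ac (to_fract [:0, 1:])"

definition gen_y :: "rat \<Rightarrow> rat poly \<Rightarrow> ambient \<Rightarrow> ambient" where
  "gen_y c f x = (SOME y. of_rat c * y\<^sup>2 = poly (map_poly of_rat f) x)"

text \<open>
  The smooth projective plane curve with affine equation \<open>c y\<^sup>2 = f(x)\<close>, given by a generic point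
  \<open>(x, y)\<close>. Its two charts are the loci where \<open>Z \<noteq> 0\<close> and \<open>Y \<noteq> 0\<close> in
  \<open>[X : Y : Z]\<close>, with \<open>x = X/Z\<close> and \<open>y = Y/Z\<close>; they cover the curve,
  the point at infinity being \<open>[0 : 1 : 0]\<close>.
\<close>

definition elliptic_curve_at :: "ambient \<Rightarrow> ambient \<Rightarrow> ambient set set" where
  "elliptic_curve_at x y = {rat_subalgebra hull {x, y}, rat_subalgebra hull {x / y, 1 / y}}"

definition twist :: "rat poly \<Rightarrow> rat \<Rightarrow> ambient set set" where
  "twist f c = elliptic_curve_at gen_x1 (gen_y c f gen_x1)"

definition suitable_twists :: "rat poly \<Rightarrow> 'k :: {field_char_0, topological_space} itself \<Rightarrow> bool" where
  "suitable_twists f K \<longleftrightarrow>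
     (\<forall>d :: 'k. d \<noteq> 0 \<longrightarrow>
        (\<exists>c. c \<noteq> 0 \<and> (\<exists>e :: 'k. e \<noteq> 0 \<and> d / of_rat c = e\<^sup>2) \<and>
             rational_points_dense (twist f c) K))"

definition elliptic_square :: "rat poly \<Rightarrow> ambient set set" where
  "elliptic_square f =
     product_variety (elliptic_curve_at gen_x1 (gen_y 1 f gen_x1))
                     (elliptic_curve_at gen_x2 (gen_y 1 f gen_x2))"

definition square_function_field :: "rat poly \<Rightarrow> ambient set" where
  "square_function_field f =
     rat_subfield hull {gen_x1, gen_y 1 f gen_x1, gen_x2, gen_y 1 f gen_x2}"

text \<open>
  The action of \<open>-1\<close> on the function field of \<open>E \<times> E\<close>, where \<open>-(x, y) = (x, -y)\<close> on each
  factor. The four conditions determine the homomorphism on that field; values outside it are not used.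
\<close>

definition neg_pullback :: "rat poly \<Rightarrow> ambient \<Rightarrow> ambient" where
  "neg_pullback f = (SOME \<sigma>. rat_alg_hom (square_function_field f) \<sigma> \<and>
     \<sigma> gen_x1 = gen_x1 \<and> \<sigma> (gen_y 1 f gen_x1) = - gen_y 1 f gen_x1 \<and>
     \<sigma> gen_x2 = gen_x2 \<and> \<sigma> (gen_y 1 f gen_x2) = - gen_y 1 f gen_x2)"

end

theory Submission
  imports Defs
begin

text \<open>
  A \<open>\<rat>\<^sub>p\<close>-point of the Kummer surface is described by local coordinates \<open>z\<^sub>1\<close>, \<open>z\<^sub>2\<close> on the two
  quotients of \<open>E\<close> by \<open>-1\<close> and the ratio \<open>\<lambda>\<close> of two functions \<open>s\<^sub>1\<close>, \<open>s\<^sub>2\<close> that are odd under \<open>-1\<close>.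
  With \<open>s\<^sub>i\<^sup>2 = G\<^sub>i(z\<^sub>i)\<close>, these satisfy \<open>G\<^sub>2(z\<^sub>2) = \<lambda>\<^sup>2 G\<^sub>1(z\<^sub>1)\<close>. The zeros of the \<open>G\<^sub>i\<close> are simple, so a
  Newton iteration moves a point on an exceptional curve slightly to one with \<open>G\<^sub>1(z\<^sub>1) = d \<noteq> 0\<close>. Such a
  point lifts to a pair of \<open>\<rat>\<^sub>p\<close>-points on \<open>E\<^sup>d\<close>, which is isomorphic over \<open>\<rat>\<^sub>p\<close> to a twist \<open>E\<^sup>c\<close> with dense
  rational points; pairs of rational points on \<open>E\<^sup>c\<close> map to rational points of the Kummer surface. The
  blow-up is controlled by the fact that the ideal of the image of \<open>E[2] \<times> E[2]\<close> is generated by the products of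
  two odd coordinates: modulo these, a function is a polynomial of degree at most 2 in each \<open>x\<^sub>i\<close>, and it
  vanishes at the \<open>3 \<times> 3\<close> grid of roots of \<open>f\<close> only if it is zero.
\<close>

section \<open>Subalgebras and homomorphisms\<close>

text \<open>One \<open>d\<close> serves both factors because
  \<open>G\<^sub>2(z\<^sub>2) / G\<^sub>1(z\<^sub>1)\<close> is the square
  \<open>\<lambda>\<^sup>2\<close>; here it matters that the same curve is taken twice. A pair of
  rational points of \<open>E^c\<close> gives rational values to squares, products and ratios of the
  odd functions, not to these functions themselves, so rational points of the quotient are built by
  adjoining the ratio alone to \<rat>(x1, x2). As points are encoded as homomorphisms, this means
  extending homomorphisms through transcendental and quadratic steps, and it rests on
  \<open>y1\<close>, \<open>y2\<close> and \<open>y1 * y2\<close> being irrational over \<rat>(x1,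
  x2). A chart of the blow-up contains \<open>b / a\<close> for every \<open>b\<close> in the ideal,
  and the definition only says that \<open>b\<close> vanishes at certain complex points. Knowing
  generators makes \<open>b / s\<^sup>2\<close>, for a suitable odd \<open>s\<close>, an expression
  in finitely many functions with known limits. The chart at infinity has no even generator, only
  two odd ones; which of them serves as \<open>s\<close> depends on the point, so the two charts
  need three local models.\<close>

lemma rat_subalgebra_hull [intro, simp]: "rat_subalgebra (rat_subalgebra hull G)"
  by (rule hull_in) (auto simp: rat_subalgebra_def)

lemma rat_subalgebra_range_of_rat: "rat_subalgebra (range of_rat)"
  unfolding rat_subalgebra_def by (auto simp flip: of_rat_add of_rat_mult intro!: rangeI)

lemma rat_subfield_hull: "rat_subfield (rat_subfield hull G)"
  by (rule hull_in) (fastforce simp: rat_subfield_def rat_subalgebra_def)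

lemma rat_subalgebraD:
  assumes "rat_subalgebra R"
  shows "of_rat q \<in> R" "u \<in> R \<Longrightarrow> v \<in> R \<Longrightarrow> u + v \<in> R"
    "u \<in> R \<Longrightarrow> v \<in> R \<Longrightarrow> u * v \<in> R"
  using assms by (auto simp: rat_subalgebra_def)

lemma rat_subalgebraI:
  assumes "\<And>q. of_rat q \<in> R" "\<And>u v. u \<in> R \<Longrightarrow> v \<in> R \<Longrightarrow> u + v \<in> R" "\<And>u v. u \<in> R \<Longrightarrow> v \<in> R \<Longrightarrow> u * v \<in> R"
  shows "rat_subalgebra R"
  using assms by (auto simp: rat_subalgebra_def)

locale subalg =
  fixes R :: "'f :: field_char_0 set"
  assumes sub: "rat_subalgebra R"
begin

lemma of_rat [simp, intro]: "of_rat q \<in> R"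
  and add [intro]: "u \<in> R \<Longrightarrow> v \<in> R \<Longrightarrow> u + v \<in> R"
  and mult [intro]: "u \<in> R \<Longrightarrow> v \<in> R \<Longrightarrow> u * v \<in> R"
  using rat_subalgebraD[OF sub] by auto

lemma zero [simp, intro]: "0 \<in> R" and one [simp, intro]: "1 \<in> R"
  using of_rat[of 0] of_rat[of 1] by auto

lemma uminus [intro]: "u \<in> R \<Longrightarrow> - u \<in> R"
  using mult[of "of_rat (-1)" u] of_rat[of "-1"] by (simp add: of_rat_minus)

lemma diff [intro]: "u \<in> R \<Longrightarrow> v \<in> R \<Longrightarrow> u - v \<in> R"
  using add[of u "-v"] uminus[of v] by auto

lemma power [intro]: "u \<in> R \<Longrightarrow> u ^ n \<in> R"
  by (induction n) auto

lemma sum [intro]: "(\<And>i. i \<in> A \<Longrightarrow> g i \<in> R) \<Longrightarrow> sum g A \<in> R"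
  by (induction A rule: infinite_finite_induct) auto

lemma poly [intro]: "(\<And>i. Polynomial.coeff p i \<in> R) \<Longrightarrow> u \<in> R \<Longrightarrow> poly p u \<in> R"
  by (auto simp: poly_altdef)

lemma rat_poly [intro]: "u \<in> R \<Longrightarrow> poly (map_poly of_rat p) u \<in> R"
  by (rule poly) (auto simp: coeff_map_poly)

lemma numeral [simp, intro]: "numeral n \<in> R"
  using of_rat[of "numeral n"] by simp

lemma hull_le: "G \<subseteq> R \<Longrightarrow> rat_subalgebra hull G \<subseteq> R"
  by (rule hull_minimal[of _ _ rat_subalgebra]) (auto simp: sub)

end

lemma subalg_hull: "subalg (rat_subalgebra hull G)"
  by unfold_locales auto

locale rat_hom = subalg R for R :: "'f :: field_char_0 set" +
  fixes h :: "'f \<Rightarrow> 'k :: field_char_0"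
  assumes hom: "rat_alg_hom R h"
begin

lemma h1 [simp]: "h 1 = 1"
  and h_add: "u \<in> R \<Longrightarrow> v \<in> R \<Longrightarrow> h (u + v) = h u + h v"
  and h_mult: "u \<in> R \<Longrightarrow> v \<in> R \<Longrightarrow> h (u * v) = h u * h v"
  using hom by (auto simp: rat_alg_hom_def)

lemma h0 [simp]: "h 0 = 0"
  using h_add[of 0 0] by simp

lemma h_uminus: "u \<in> R \<Longrightarrow> h (- u) = - h u"
  using h_add[of u "-u"] by (auto simp: uminus eq_neg_iff_add_eq_0 add.commute)

lemma h_diff: "u \<in> R \<Longrightarrow> v \<in> R \<Longrightarrow> h (u - v) = h u - h v"
  using h_add[of u "-v"] h_uminus[of v] by (auto simp: uminus)

lemma h_of_nat: "h (of_nat n) = of_nat n"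
proof (induction n)
  case (Suc n)
  have "of_nat n \<in> R"
    using of_rat[of "of_nat n"] by simp
  then show ?case
    using Suc by (simp add: h_add)
qed simp

lemma h_of_int: "h (of_int n) = of_int n"
proof (cases n rule: int_cases2)
  case (nonneg m)
  then show ?thesis by (simp add: h_of_nat)
next
  case (nonpos m)
  have "of_nat m \<in> R"
    using of_rat[of "of_nat m"] by simp
  then show ?thesis
    using nonpos by (simp add: h_of_nat h_uminus)
qed

lemma h_of_rat [simp]: "h (of_rat q) = of_rat q"
proof -
  obtain a b where q: "q = of_int a / of_int b" "b \<noteq> 0"
    by (metis quotient_of_div quotient_of_denom_pos surj_pair less_irrefl)
  have "h (of_rat q) * of_int b = h (of_rat q) * h (of_rat (of_int b))"
    by (simp add: h_of_int)
  also have "\<dots> = h (of_rat (q * of_int b))"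
    by (simp add: h_mult[symmetric] of_rat_mult del: of_rat_of_int_eq)
  also have "q * of_int b = of_int a"
    using q by simp
  finally have "h (of_rat q) * of_int b = of_int a"
    by (simp add: h_of_int)
  moreover have "of_rat q * (of_int b :: 'k) = of_int a"
    using q by (simp add: of_rat_divide)
  ultimately show ?thesis
    using q by (metis mult_right_cancel of_int_0_eq_iff)
qed

lemma h_power: "u \<in> R \<Longrightarrow> h (u ^ n) = h u ^ n"
  by (induction n) (auto simp: h_mult power)

lemma h_sum: "(\<And>i. i \<in> A \<Longrightarrow> g i \<in> R) \<Longrightarrow> h (sum g A) = (\<Sum>i\<in>A. h (g i))"
  by (induction A rule: infinite_finite_induct) (auto simp: h_add sum)

lemma h_poly:
  assumes "\<And>i. Polynomial.coeff p i \<in> R" "u \<in> R"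
  shows "h (poly p u) = poly (map_poly h p) (h u)"
  using assms(1)
proof (induction p)
  case (pCons a p)
  have a: "a \<in> R"
    using pCons.prems[of 0] by simp
  have p: "Polynomial.coeff p i \<in> R" for i
    using pCons.prems[of "Suc i"] by simp
  then have "poly p u \<in> R"
    using assms(2) by (rule poly)
  with a p pCons.IH assms(2) show ?case
    by (simp add: map_poly_pCons h_add h_mult mult)
qed simp

lemma h_rat_poly:
  assumes "u \<in> R"
  shows "h (poly (map_poly of_rat p) u) = poly (map_poly of_rat p) (h u)"
  using assms by (subst h_poly) (auto simp: coeff_map_poly map_poly_map_poly o_def)

lemma h_inverse: "u \<in> R \<Longrightarrow> inverse u \<in> R \<Longrightarrow> h (inverse u) = inverse (h u)"
  using h_mult[of u "inverse u"] by (cases "u = 0") (auto simp: inverse_unique)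

lemma restrict: "rat_subalgebra S \<Longrightarrow> S \<subseteq> R \<Longrightarrow> rat_hom S h"
  using hom by unfold_locales (auto simp: rat_alg_hom_def)

end

lemma rat_homI:
  assumes "rat_subalgebra R" "h 1 = 1"
    "\<And>u v. u \<in> R \<Longrightarrow> v \<in> R \<Longrightarrow> h (u + v) = h u + h v"
    "\<And>u v. u \<in> R \<Longrightarrow> v \<in> R \<Longrightarrow> h (u * v) = h u * h v"
  shows "rat_hom R h"
  using assms by unfold_locales (auto simp: rat_alg_hom_def)

text \<open>Starting point for the homomorphisms built below: the prime field maps to any field of
  characteristic 0, and coordinates are then adjoined one at a time.\<close>

lemma ex_rat_hom_of_rat:
  obtains h :: "'f :: field_char_0 \<Rightarrow> 'k :: field_char_0" where "rat_hom (range of_rat) h"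
proof
  define h :: "'f \<Rightarrow> 'k" where "h z = of_rat (inv_into UNIV of_rat z)" for z
  have h: "h (of_rat q) = of_rat q" for q
    by (simp add: h_def inv_f_f inj_def)
  show "rat_hom (range of_rat) h"
    by (rule rat_homI)
      (use h[of 1] in \<open>auto simp: rat_subalgebra_range_of_rat h of_rat_add of_rat_mult simp flip: of_rat_add of_rat_mult\<close>)
qed

section \<open>Extending homomorphisms\<close>

text \<open>Elements of R[z] are \<open>poly q z\<close> for a unique \<open>q\<close> over
  \<open>R\<close>, so \<open>THE\<close> selects it, and evaluating the image of \<open>q\<close>
  at an arbitrary \<open>w\<close> is a well-defined homomorphism.\<close>

lemma (in rat_hom) ex_adjoin_transcendental:
  fixes z :: 'f and w :: 'k
  assumes transc: "\<And>q. \<forall>i. Polynomial.coeff q i \<in> R \<Longrightarrow> poly q z = 0 \<Longrightarrow> q = 0"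
  obtains h' where "rat_hom (rat_subalgebra hull (insert z R)) h'" "\<And>u. u \<in> R \<Longrightarrow> h' u = h u" "h' z = w"
proof -
  define P where "P = {q :: 'f poly. \<forall>i. Polynomial.coeff q i \<in> R}"
  define S where "S = (\<lambda>q. poly q z) ` P"
  define h' where "h' u = poly (map_poly h (THE q. q \<in> P \<and> poly q z = u)) w" for u
  have P_add: "p + q \<in> P" and P_mult: "p * q \<in> P" if "p \<in> P" "q \<in> P" for p q
    using that by (auto simp: P_def coeff_mult)
  have P_diff: "p - q \<in> P" if "p \<in> P" "q \<in> P" for p q
    using that by (auto simp: P_def)
  have uniq: "p = q" if "p \<in> P" "q \<in> P" "poly p z = poly q z" for p q
    using transc[of "p - q"] P_diff[OF that(1,2)] that(3) by (auto simp: P_def)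
  have h': "h' (poly q z) = poly (map_poly h q) w" if "q \<in> P" for q
  proof -
    have "(THE p. p \<in> P \<and> poly p z = poly q z) = q"
      using that uniq by blast
    then show ?thesis by (simp add: h'_def)
  qed
  have const: "[:u:] \<in> P" if "u \<in> R" for u
    using that by (auto simp: P_def coeff_pCons split: nat.splits)
  have X: "[:0, 1:] \<in> P"
    by (auto simp: P_def coeff_pCons split: nat.splits)
  have "rat_hom S h'"
  proof (rule rat_homI)
    show "rat_subalgebra S"
      unfolding rat_subalgebra_def
    proof (intro conjI ballI subsetI)
      fix x :: 'f assume "x \<in> range of_rat"
      then show "x \<in> S"
        using const by (force simp: S_def)
    next
      fix u v assume "u \<in> S" "v \<in> S"
      then show "u + v \<in> S" "u * v \<in> S"
        using P_add P_mult by (auto simp: S_def simp flip: poly_add poly_mult)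
    qed
    show "h' 1 = 1"
      using h'[OF const[OF one]] by (simp add: map_poly_pCons)
    fix u v assume "u \<in> S" "v \<in> S"
    then obtain p q where pq: "p \<in> P" "q \<in> P" "u = poly p z" "v = poly q z"
      by (auto simp: S_def)
    have "map_poly h (p + q) = map_poly h p + map_poly h q"
      using pq(1,2) by (intro poly_eqI) (auto simp: coeff_map_poly P_def h_add)
    then show "h' (u + v) = h' u + h' v"
      using pq P_add by (simp add: h' flip: poly_add)
    have "map_poly h (p * q) = map_poly h p * map_poly h q"
    proof (rule poly_eqI)
      fix n
      show "Polynomial.coeff (map_poly h (p * q)) n = Polynomial.coeff (map_poly h p * map_poly h q) n"
        using pq(1,2) unfolding coeff_mult coeff_map_poly[of h, OF h0]
        by (subst h_sum) (auto simp: P_def h_mult)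
    qed
    then show "h' (u * v) = h' u * h' v"
      using pq P_mult by (simp add: h' flip: poly_mult)
  qed
  moreover have "h' u = h u" if "u \<in> R" for u
    using h'[OF const[OF that]] by (simp add: map_poly_pCons)
  moreover have "h' z = w"
    using h'[OF X] by (simp add: map_poly_pCons)
  moreover have "insert z R \<subseteq> S"
    using const X by (force simp: S_def)
  then have "rat_subalgebra hull (insert z R) \<subseteq> S"
    using \<open>rat_hom S h'\<close> by (intro hull_minimal) (auto simp: rat_hom_def subalg_def)
  ultimately show ?thesis
    using that[of h'] rat_hom.restrict[of S h'] by auto
qed

text \<open>R[y] is free over \<open>R\<close> with basis 1, \<open>y\<close>: the component
  \<open>B\<close> is unique by \<open>indep\<close>, and \<open>A\<close> with it. Multiplicativity
  of \<open>h A + h B * w\<close> then amounts to \<open>w\<^sup>2 = h (y\<^sup>2)\<close>. The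
  value \<open>w = 0\<close> is allowed, as two-torsion points require.\<close>

lemma (in rat_hom) ex_adjoin_sqrt:
  fixes y :: 'f and w :: 'k
  assumes sq: "y\<^sup>2 \<in> R" and indep: "\<And>A B. A \<in> R \<Longrightarrow> B \<in> R \<Longrightarrow> A + B * y = 0 \<Longrightarrow> B = 0"
    and w: "w\<^sup>2 = h (y\<^sup>2)"
  obtains h' where "rat_hom (rat_subalgebra hull (insert y R)) h'" "\<And>u. u \<in> R \<Longrightarrow> h' u = h u" "h' y = w"
proof -
  define S where "S = (\<lambda>(A, B). A + B * y) ` (R \<times> R)"
  define h' where "h' u = (case (THE AB. AB \<in> R \<times> R \<and> fst AB + snd AB * y = u) of (A, B) \<Rightarrow> h A + h B * w)" for u
  have uniq: "A = A' \<and> B = B'" if "A \<in> R" "B \<in> R" "A' \<in> R" "B' \<in> R" "A + B * y = A' + B' * y" for A B A' B'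
  proof -
    have "(A - A') + (B - B') * y = 0"
      using that by (simp add: algebra_simps)
    then have "B - B' = 0"
      using that indep[of "A - A'" "B - B'"] by auto
    then show ?thesis using that by auto
  qed
  have h': "h' (A + B * y) = h A + h B * w" if "A \<in> R" "B \<in> R" for A B
  proof -
    have "(THE AB. AB \<in> R \<times> R \<and> fst AB + snd AB * y = A + B * y) = (A, B)"
      by (rule the_equality) (use that uniq in auto)
    then show ?thesis by (simp add: h'_def)
  qed
  have mem: "A + B * y \<in> S" if "A \<in> R" "B \<in> R" for A B
    using that by (force simp: S_def)
  have mul: "(A + B * y) * (C + D * y) = (A * C + B * D * y\<^sup>2) + (A * D + B * C) * y" for A B C D
    by (simp add: algebra_simps power2_eq_square)
  have "rat_hom S h'"
  proof (rule rat_homI)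
    show "rat_subalgebra S"
      unfolding rat_subalgebra_def
    proof (intro conjI ballI subsetI)
      fix x :: 'f assume "x \<in> range of_rat"
      then show "x \<in> S"
        using mem[of x 0] by auto
    next
      fix u v assume "u \<in> S" "v \<in> S"
      then obtain A B C D where *: "A \<in> R" "B \<in> R" "C \<in> R" "D \<in> R" "u = A + B * y" "v = C + D * y"
        by (auto simp: S_def)
      have "u + v = (A + C) + (B + D) * y" using * by (simp add: algebra_simps)
      then show "u + v \<in> S" using * mem[of "A + C" "B + D"] add by metis
      show "u * v \<in> S" unfolding *(5,6) mul by (rule mem) (use * sq in auto)
    qed
    show "h' 1 = 1"
      using h'[of 1 0] by simp
    fix u v assume "u \<in> S" "v \<in> S"
    then obtain A B C D where *: "A \<in> R" "B \<in> R" "C \<in> R" "D \<in> R" "u = A + B * y" "v = C + D * y"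
      by (auto simp: S_def)
    have "u + v = (A + C) + (B + D) * y" using * by (simp add: algebra_simps)
    then show "h' (u + v) = h' u + h' v"
      using * h'[of "A + C" "B + D"] by (auto simp: h' h_add algebra_simps)
    have "h' (u * v) = h (A * C + B * D * y\<^sup>2) + h (A * D + B * C) * w"
      using * sq by (auto simp: mul intro!: h')
    also have "\<dots> = (h A + h B * w) * (h C + h D * w)"
      using * sq by (simp add: h_add h_mult mult add flip: w) (simp add: algebra_simps power2_eq_square)
    finally show "h' (u * v) = h' u * h' v"
      using * by (simp add: h')
  qed
  moreover have "h' u = h u" if "u \<in> R" for u
    using h'[of u 0] that by simp
  moreover have "h' y = w"
    using h'[of 0 1] by simp
  moreover have "insert y R \<subseteq> S"
    using mem[of _ 0] mem[of 0 1] by auto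
  then have "rat_subalgebra hull (insert y R) \<subseteq> S"
    using \<open>rat_hom S h'\<close> by (intro hull_minimal) (auto simp: rat_hom_def subalg_def)
  ultimately show ?thesis
    using that[of h'] rat_hom.restrict[of S h'] by auto
qed

text \<open>The local ring at a \<open>K\<close>-point: whatever does not vanish at the point is
  invertible. Quotients like \<open>rpoly N z / rpoly D z\<close> can then be evaluated.\<close>

locale local_hom = rat_hom +
  assumes inverse_closed: "u \<in> R \<Longrightarrow> h u \<noteq> 0 \<Longrightarrow> inverse u \<in> R"
begin

lemma divide_closed: "u \<in> R \<Longrightarrow> v \<in> R \<Longrightarrow> h v \<noteq> 0 \<Longrightarrow> u / v \<in> R"
  using mult[of u "inverse v"] inverse_closed[of v] by (simp add: divide_inverse)

lemma h_divide: "u \<in> R \<Longrightarrow> v \<in> R \<Longrightarrow> h v \<noteq> 0 \<Longrightarrow> h (u / v) = h u / h v"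
  using h_mult[of u "inverse v"] inverse_closed[of v] h_inverse[of v] by (simp add: divide_inverse)

end

context rat_hom
begin

lemma point_of_hom_iff:
  "(z, v) \<in> point_of_hom R h \<longleftrightarrow> (\<exists>u s. u \<in> R \<and> s \<in> R \<and> h s \<noteq> 0 \<and> z = u / s \<and> v = h u / h s)"
  by (auto simp: point_of_hom_def)

lemma point_of_hom_base: "u \<in> R \<Longrightarrow> (u, h u) \<in> point_of_hom R h"
  unfolding point_of_hom_iff by (rule exI[of _ u], rule exI[of _ 1]) auto

lemma point_of_hom_fun:
  assumes "(z, v) \<in> point_of_hom R h" "(z, v') \<in> point_of_hom R h"
  shows "v = v'"
proof -
  from assms obtain u s u' s' where *: "u \<in> R" "s \<in> R" "h s \<noteq> 0" "z = u / s" "v = h u / h s"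
    "u' \<in> R" "s' \<in> R" "h s' \<noteq> 0" "z = u' / s'" "v' = h u' / h s'"
    unfolding point_of_hom_iff by blast
  then have "s \<noteq> 0" "s' \<noteq> 0" by auto
  then have "u * s' = u' * s" using * by (simp add: field_simps)
  then have "h u * h s' = h u' * h s" using * by (metis h_mult)
  then show ?thesis using *(3,5,8,10) by (simp add: frac_eq_eq)
qed

text \<open>The domain of the graph \<open>point_of_hom R h\<close> is the localisation of
  \<open>R\<close> at the kernel of \<open>h\<close>. That it consists of fractions of
  \<open>R\<close> keeps it inside any subfield containing \<open>R\<close>, so the irrationality of
  a further square root can still be checked. The last clause serves to evaluate functions at a
  point known only by its graph.\<close>

lemma ex_localize:
  obtains R' h' where "local_hom R' h'" "R \<subseteq> R'" "\<And>u. u \<in> R \<Longrightarrow> h' u = h u"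
    "R' \<subseteq> {u / s |u s. u \<in> R \<and> s \<in> R}" "\<And>z v. (z, v) \<in> point_of_hom R h \<Longrightarrow> z \<in> R' \<and> h' z = v"
proof -
  define R' where "R' = fst ` point_of_hom R h"
  define h' where "h' z = (THE v. (z, v) \<in> point_of_hom R h)" for z
  have h': "h' z = v" if "(z, v) \<in> point_of_hom R h" for z v
    unfolding h'_def using that point_of_hom_fun by blast
  have graph: "z \<in> R' \<and> h' z = v" if "(z, v) \<in> point_of_hom R h" for z v
    using that h' by (force simp: R'_def)
  have ext: "u \<in> R' \<and> h' u = h u" if "u \<in> R" for u
    using graph[OF point_of_hom_base[OF that]] .
  have quot: "u / s \<in> R' \<and> h' (u / s) = h u / h s" if "u \<in> R" "s \<in> R" "h s \<noteq> 0" for u s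
    by (rule graph) (use that in \<open>auto simp: point_of_hom_iff\<close>)
  have cases: "\<exists>u s. u \<in> R \<and> s \<in> R \<and> h s \<noteq> 0 \<and> z = u / s" if "z \<in> R'" for z
    using that by (force simp: R'_def point_of_hom_def)
  have sum: "u / s + v / t = (u * t + v * s) / (s * t) \<and> (u / s) * (v / t) = (u * v) / (s * t)
      \<and> h u / h s + h v / h t = h (u * t + v * s) / h (s * t) \<and> (h u / h s) * (h v / h t) = h (u * v) / h (s * t)
      \<and> h (s * t) \<noteq> 0"
    if "u \<in> R" "s \<in> R" "h s \<noteq> 0" "v \<in> R" "t \<in> R" "h t \<noteq> 0" for u s v t
  proof -
    from that have "s \<noteq> 0" "t \<noteq> 0" by auto
    with that show ?thesis by (simp add: h_mult h_add mult field_simps)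
  qed
  have "rat_hom R' h'"
  proof (rule rat_homI)
    show "rat_subalgebra R'"
      unfolding rat_subalgebra_def
    proof (intro conjI ballI)
      show "range of_rat \<subseteq> R'" using ext by auto
      fix z z' assume "z \<in> R'" "z' \<in> R'"
      then obtain u s v t where *: "u \<in> R" "s \<in> R" "h s \<noteq> 0" "v \<in> R" "t \<in> R" "h t \<noteq> 0" "z = u / s" "z' = v / t"
        using cases by meson
      show "z + z' \<in> R'" "z * z' \<in> R'"
        using sum[OF *(1-6)] quot[of "u * t + v * s" "s * t"] quot[of "u * v" "s * t"] * by auto
    qed
    show "h' 1 = 1" using ext[OF one] by simp
    fix z z' assume "z \<in> R'" "z' \<in> R'"
    then obtain u s v t where *: "u \<in> R" "s \<in> R" "h s \<noteq> 0" "v \<in> R" "t \<in> R" "h t \<noteq> 0" "z = u / s" "z' = v / t"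
      using cases by meson
    show "h' (z + z') = h' z + h' z'" "h' (z * z') = h' z * h' z'"
      using sum[OF *(1-6)] quot[of "u * t + v * s" "s * t"] quot[of "u * v" "s * t"]
         quot[of u s] quot[of v t] * by auto
  qed
  then interpret r: rat_hom R' h' .
  have "local_hom R' h'"
  proof
    fix z assume z: "z \<in> R'" "h' z \<noteq> 0"
    then obtain u s where *: "u \<in> R" "s \<in> R" "h s \<noteq> 0" "z = u / s"
      using cases by meson
    then have "h u \<noteq> 0" using quot[of u s] z by auto
    then show "inverse z \<in> R'" using quot[of s u] * by simp
  qed
  then show ?thesis
    using that[of R' h'] ext graph cases by blast
qed

end

text \<open>Reversing the coefficients turns an equation for \<open>inverse z\<close> into one for
  \<open>z\<close>. This puts the coordinate \<open>1 / x\<close> at infinity on the same footing as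
  \<open>x\<close>.\<close>

lemma transcendental_inverse:
  fixes z :: "'f :: field"
  assumes "z \<noteq> 0" and q: "\<And>q. \<forall>i. Polynomial.coeff q i \<in> F \<Longrightarrow> poly q z = 0 \<Longrightarrow> q = 0"
    and F: "0 \<in> F" "\<forall>i. Polynomial.coeff q i \<in> F" and "poly q (inverse z) = 0"
  shows "q = 0"
proof -
  have "reflect_poly q = 0"
  proof (rule q)
    show "\<forall>i. Polynomial.coeff (reflect_poly q) i \<in> F"
      using F by (auto simp: coeff_reflect_poly)
    show "poly (reflect_poly q) z = 0"
      using assms by (simp add: poly_reflect_poly_nz)
  qed
  then show ?thesis by simp
qed

section \<open>Quadratic extensions of subfields\<close>

lemma subfield_divide: "rat_subfield F \<Longrightarrow> u \<in> F \<Longrightarrow> v \<in> F \<Longrightarrow> u / v \<in> F"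
  by (auto simp: rat_subfield_def rat_subalgebra_def divide_inverse)

lemma subfield_subalg: "rat_subfield F \<Longrightarrow> subalg F"
  by unfold_locales (auto simp: rat_subfield_def)

lemma subfield_sqrt_indep:
  assumes "rat_subfield F" "y \<notin> F" "A \<in> F" "B \<in> F" "A + B * y = 0"
  shows "B = 0"
proof (rule ccontr)
  interpret subalg F using assms(1) by (rule subfield_subalg)
  assume "B \<noteq> 0"
  then have "y = (- A) / B"
    using assms(5) by (simp add: field_simps eq_neg_iff_add_eq_0 add.commute)
  then show False
    using assms subfield_divide[OF assms(1), of "-A" B] by auto
qed

text \<open>When \<open>y\<^sup>2 \<in> F\<close>, this set is closed under inverses and is the
  field F(y).\<close>

definition adjoin_sqrt :: "'f :: field_char_0 set \<Rightarrow> 'f \<Rightarrow> 'f set" where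
  "adjoin_sqrt F y = {A + B * y | A B. A \<in> F \<and> B \<in> F}"

lemma rat_subfield_adjoin_sqrt:
  assumes F: "rat_subfield F" and y: "y\<^sup>2 \<in> F"
  shows "rat_subfield (adjoin_sqrt F y)"
proof -
  interpret subalg F using F by (rule subfield_subalg)
  have mem: "A + B * y \<in> adjoin_sqrt F y" if "A \<in> F" "B \<in> F" for A B
    using that by (auto simp: adjoin_sqrt_def)
  have mul: "(A + B * y) * (C + D * y) = (A * C + B * D * y\<^sup>2) + (A * D + B * C) * y" for A B C D
    by (simp add: algebra_simps power2_eq_square)
  show ?thesis
    unfolding rat_subfield_def rat_subalgebra_def
  proof (intro conjI ballI subsetI)
    fix x :: 'a assume "x \<in> range of_rat"
    then show "x \<in> adjoin_sqrt F y"
      using mem[of x 0] by auto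
  next
    fix u v assume "u \<in> adjoin_sqrt F y" "v \<in> adjoin_sqrt F y"
    then obtain A B C D where *: "A \<in> F" "B \<in> F" "C \<in> F" "D \<in> F" "u = A + B * y" "v = C + D * y"
      by (auto simp: adjoin_sqrt_def)
    have "u + v = (A + C) + (B + D) * y" using * by (simp add: algebra_simps)
    then show "u + v \<in> adjoin_sqrt F y" using * mem[of "A + C" "B + D"] add by metis
    show "u * v \<in> adjoin_sqrt F y" unfolding *(5,6) mul by (rule mem) (use * y in auto)
  next
    fix u assume "u \<in> adjoin_sqrt F y"
    then obtain A B where *: "A \<in> F" "B \<in> F" "u = A + B * y"
      by (auto simp: adjoin_sqrt_def)
    \<comment> \<open>The norm of \<open>u\<close>. It may vanish for nonzero \<open>u\<close>, as
      \<open>y\<close> may lie in \<open>F\<close>; then \<open>A = B * y\<close> and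
      \<open>u = 2 * A\<close>.\<close>
    define N where "N = A\<^sup>2 - B\<^sup>2 * y\<^sup>2"
    have N: "N \<in> F" "N = (A + B * y) * (A - B * y)"
      using * y by (auto simp: N_def power power2_eq_square algebra_simps)
    consider "A + B * y = 0" | "A - B * y = 0" | "N \<noteq> 0"
      using N by auto
    then show "inverse u \<in> adjoin_sqrt F y"
    proof cases
      case 1
      then show ?thesis using * mem[of 0 0] by auto
    next
      case 2
      then have "inverse u = 1 / (2 * A) + 0 * y"
        using *(3) by (simp add: field_simps)
      also have "\<dots> \<in> adjoin_sqrt F y"
        using * by (intro mem subfield_divide[OF F]) auto
      finally show ?thesis .
    next
      case 3
      have "u * (A / N + (- B / N) * y) = (A + B * y) * (A - B * y) / N"
        unfolding *(3) by (simp add: algebra_simps diff_divide_distrib add_divide_distrib)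
      then have "u * (A / N + (- B / N) * y) = 1"
        using 3 N(2) by simp
      then have "inverse u = A / N + (- B / N) * y"
        by (rule inverse_unique)
      also have "\<dots> \<in> adjoin_sqrt F y"
        using * N by (intro mem subfield_divide[OF F]) auto
      finally show ?thesis .
    qed
  qed
qed

lemma adjoin_sqrt_superset:
  assumes "rat_subfield F" shows "insert y F \<subseteq> adjoin_sqrt F y"
proof -
  interpret subalg F using assms by (rule subfield_subalg)
  have "y = 0 + 1 * y" "\<And>u. u = u + 0 * y" by auto
  then show ?thesis unfolding adjoin_sqrt_def by blast
qed

text \<open>Two square roots outside \<open>F\<close> generate the same quadratic extension only if
  their product is in \<open>F\<close>: the mixed term of \<open>(A + B * y)\<^sup>2\<close> must
  vanish, leaving \<open>y' = B * y\<close> or \<open>y' = A\<close>.\<close>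

lemma notin_adjoin_sqrt:
  assumes F: "rat_subfield F" and "y\<^sup>2 \<in> F" "y \<notin> F" "y'\<^sup>2 \<in> F" "y' \<notin> F" "y * y' \<notin> F"
  shows "y' \<notin> adjoin_sqrt F y"
proof
  interpret subalg F using F by (rule subfield_subalg)
  assume "y' \<in> adjoin_sqrt F y"
  then obtain A B where *: "A \<in> F" "B \<in> F" "y' = A + B * y"
    by (auto simp: adjoin_sqrt_def)
  have "(A\<^sup>2 + B\<^sup>2 * y\<^sup>2 - y'\<^sup>2) + (2 * A * B) * y = 0"
    using *(3) by (simp add: algebra_simps power2_eq_square)
  then have "2 * A * B = 0"
    by (rule subfield_sqrt_indep[OF F assms(3), rotated 2]) (use * assms in auto)
  then consider "A = 0" | "B = 0" by auto
  then show False
  proof cases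
    case 1
    then have "y * y' = B * y\<^sup>2" using * by (simp add: power2_eq_square)
    then show False using assms * mult by metis
  next
    case 2
    then show False using * assms by simp
  qed
qed

text \<open>Adjunction followed by localisation. The result lies in \<open>adjoin_sqrt K y\<close>,
  again a subfield, so a second square root can be adjoined with this field in place of
  \<open>K\<close>.\<close>

lemma (in local_hom) ex_local_adjoin_sqrt:
  fixes y :: 'a and w :: 'b
  assumes K: "rat_subfield K" "R \<subseteq> K" "y \<notin> K" and y: "y\<^sup>2 \<in> R" "w\<^sup>2 = h (y\<^sup>2)"
  obtains R' h' where "local_hom R' h'" "R \<subseteq> R'" "y \<in> R'" "R' \<subseteq> adjoin_sqrt K y"
    "\<And>u. u \<in> R \<Longrightarrow> h' u = h u" "h' y = w"
proof -
  have indep: "B = 0" if "A \<in> R" "B \<in> R" "A + B * y = 0" for A B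
    using subfield_sqrt_indep[OF K(1,3), of A B] that K(2) by auto
  obtain h1 where
    h1: "rat_hom (rat_subalgebra hull (insert y R)) h1" "\<And>u. u \<in> R \<Longrightarrow> h1 u = h u" "h1 y = w"
    by (rule ex_adjoin_sqrt[OF y(1) _ y(2)]) (use indep in blast)+
  have sub: "rat_subalgebra hull (insert y R) \<subseteq> adjoin_sqrt K y"
    by (rule hull_minimal)
       (use adjoin_sqrt_superset[OF K(1), of y] K rat_subfield_adjoin_sqrt[OF K(1), of y] y in \<open>auto simp: rat_subfield_def\<close>)
  interpret h1: rat_hom "rat_subalgebra hull (insert y R)" h1 by fact
  obtain R' h' where *: "local_hom R' h'" "rat_subalgebra hull (insert y R) \<subseteq> R'"
    "\<And>u. u \<in> rat_subalgebra hull (insert y R) \<Longrightarrow> h' u = h1 u"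
    "R' \<subseteq> {u / s |u s. u \<in> rat_subalgebra hull (insert y R) \<and> s \<in> rat_subalgebra hull (insert y R)}"
    by (rule h1.ex_localize) blast
  show ?thesis
  proof (rule that[OF *(1)])
    show "R' \<subseteq> adjoin_sqrt K y"
      using *(4) sub subfield_divide[OF rat_subfield_adjoin_sqrt[OF K(1), of y]] y(1) K(2) by blast
  qed (use * h1 hull_subset[of "insert y R" rat_subalgebra] in auto)
qed

section \<open>The function field\<close>

text \<open>In \<open>a\<^sup>2 = p * b\<^sup>2\<close> the two sides would have degrees of
  different parity.\<close>

lemma to_fract_not_square_odd_degree:
  fixes p :: "'a :: field poly"
  assumes "odd (Polynomial.degree p)"
  shows "\<alpha>\<^sup>2 \<noteq> to_fract p"
proof
  assume eq: "\<alpha>\<^sup>2 = to_fract p"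
  obtain a b where \<alpha>: "\<alpha> = to_fract a / to_fract b" "b \<noteq> 0"
    by (cases \<alpha>) (auto simp: Fract_conv_to_fract)
  have "p \<noteq> 0" using assms by auto
  have "to_fract (a\<^sup>2) = to_fract (p * b\<^sup>2)"
    using eq \<alpha> by (simp add: power_divide field_simps power2_eq_square)
  then have "a\<^sup>2 = p * b\<^sup>2" by (simp only: to_fract_eq_iff)
  then have "Polynomial.degree (a\<^sup>2) = Polynomial.degree p + Polynomial.degree (b\<^sup>2)"
    using \<open>p \<noteq> 0\<close> \<alpha> by (simp add: degree_mult_eq)
  moreover have "a \<noteq> 0"
    using \<open>a\<^sup>2 = p * b\<^sup>2\<close> \<open>p \<noteq> 0\<close> \<alpha>(2) by auto
  ultimately have "2 * Polynomial.degree a = Polynomial.degree p + 2 * Polynomial.degree b"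
    using \<alpha>(2) by (simp add: degree_power_eq)
  then show False
    using assms by presburger
qed

text \<open>The leading coefficients of numerator and denominator of a square root of
  \<open>c\<close> already give a square root of \<open>c\<close> in the base field.\<close>

lemma to_fract_not_square_const:
  fixes c :: "'a :: field"
  assumes "\<And>r. r\<^sup>2 \<noteq> c"
  shows "\<alpha>\<^sup>2 \<noteq> to_fract [:c:]"
proof
  assume eq: "\<alpha>\<^sup>2 = to_fract [:c:]"
  obtain a b where \<alpha>: "\<alpha> = to_fract a / to_fract b" "b \<noteq> 0"
    by (cases \<alpha>) (auto simp: Fract_conv_to_fract)
  have "to_fract a * to_fract a = to_fract [:c:] * (to_fract b * to_fract b)"
    using eq \<alpha> by (simp add: power_divide field_simps power2_eq_square)
  then have "to_fract (a\<^sup>2) = to_fract ([:c:] * b\<^sup>2)"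
    by (simp only: power2_eq_square to_fract_mult)
  then have "a\<^sup>2 = [:c:] * b\<^sup>2" by (simp only: to_fract_eq_iff)
  then have "(Polynomial.lead_coeff a)\<^sup>2 = c * (Polynomial.lead_coeff b)\<^sup>2"
    using lead_coeff_power[of a 2] lead_coeff_power[of b 2] by (cases "c = 0") auto
  then have "(Polynomial.lead_coeff a / Polynomial.lead_coeff b)\<^sup>2 = c"
    using \<alpha>(2) by (simp add: power_divide)
  then show False using assms by blast
qed

lemma rat_hom_to_ac: "rat_hom UNIV (to_ac :: 'a :: field_char_0 \<Rightarrow> 'a alg_closure)"
  by (rule rat_homI) (auto simp: rat_subalgebra_def)

lemma rat_hom_to_fract_const: "rat_hom UNIV (\<lambda>c :: 'a :: linordered_field. to_fract [:c:])"
proof (rule rat_homI)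
  fix u v :: 'a
  show "to_fract [:u + v:] = to_fract [:u:] + to_fract [:v:]"
    by (simp flip: to_fract_add)
  show "to_fract [:u * v:] = to_fract [:u:] * to_fract [:v:]"
    by (simp flip: to_fract_mult)
qed (auto simp: rat_subalgebra_def simp flip: one_pCons)

lemma poly_to_fract_X:
  fixes q :: "'a :: linordered_field poly"
  shows "poly (map_poly (\<lambda>c. to_fract [:c:]) q) (to_fract [:0, 1:]) = to_fract q"
proof (induction q)
  case (pCons a q)
  have "to_fract (pCons a q) = to_fract ([:a:] + [:0, 1:] * q)"
    by simp
  also have "\<dots> = to_fract [:a:] + to_fract [:0, 1:] * to_fract q"
    by (simp only: to_fract_add to_fract_mult)
  finally show ?case
    using pCons by (simp add: map_poly_pCons)
qed simp

lemma rat_poly_to_fract_X: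
  fixes q :: "rat poly"
  shows "poly (map_poly of_rat q) (to_fract [:0, 1 :: 'a :: linordered_field:]) = to_fract (map_poly of_rat q)"
proof -
  interpret rat_hom UNIV "\<lambda>c :: 'a. to_fract [:c:]" by (rule rat_hom_to_fract_const)
  have "map_poly of_rat q = map_poly (\<lambda>c :: 'a. to_fract [:c:]) (map_poly of_rat q)"
    by (subst map_poly_map_poly) (auto simp: o_def)
  then show ?thesis by (simp only: poly_to_fract_X)
qed

section \<open>The fields \<rat>(x1) and \<rat>(x1, x2) inside the ambient field\<close>

definition field_x1 :: "ambient set" where
  "field_x1 = range (\<lambda>c. to_ac (to_fract [:c:]))"

definition field_x12 :: "ambient set" where
  "field_x12 = range to_ac"

lemma rat_subfield_range:
  assumes "rat_hom UNIV h" shows "rat_subfield (range h)"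
proof -
  interpret rat_hom UNIV h by fact
  show ?thesis
    unfolding rat_subfield_def rat_subalgebra_def
  proof (intro conjI ballI subsetI)
    fix u :: 'b assume "u \<in> range of_rat"
    then obtain q where "u = h (of_rat q)" by auto
    then show "u \<in> range h" by blast
  qed (auto simp flip: h_add h_mult h_inverse)
qed

lemma rat_hom_x1: "rat_hom UNIV (\<lambda>c :: rat poly fract. to_ac (to_fract [:c:]))"
proof -
  interpret rat_hom UNIV "\<lambda>c :: rat poly fract. to_fract [:c:]" by (rule rat_hom_to_fract_const)
  show ?thesis by (rule rat_homI) (auto simp: h_add h_mult sub)
qed

lemma rat_subfield_x1: "rat_subfield field_x1"
  unfolding field_x1_def by (rule rat_subfield_range[OF rat_hom_x1])

lemma rat_subfield_x12: "rat_subfield field_x12"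
  unfolding field_x12_def by (rule rat_subfield_range[OF rat_hom_to_ac])

lemma field_x1_subset: "field_x1 \<subseteq> field_x12"
  by (auto simp: field_x1_def field_x12_def)

lemma gen_x1_in: "gen_x1 \<in> field_x1" and gen_x2_in: "gen_x2 \<in> field_x12"
  by (auto simp: gen_x1_def gen_x2_def field_x1_def field_x12_def)

lemma gen_x1_neq_0: "gen_x1 \<noteq> 0" and gen_x2_neq_0: "gen_x2 \<noteq> 0"
  by (auto simp: gen_x1_def gen_x2_def)

lemma poly_gen_x1: "poly (map_poly of_rat q) gen_x1 = to_ac (to_fract [:to_fract q:])"
proof -
  interpret rat_hom UNIV "\<lambda>c :: rat poly fract. to_ac (to_fract [:c:])" by (rule rat_hom_x1)
  have "poly (map_poly of_rat q) gen_x1 = to_ac (to_fract [:poly (map_poly of_rat q) (to_fract [:0, 1:]):])"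
    unfolding gen_x1_def by (subst h_rat_poly) auto
  then show ?thesis by (simp add: rat_poly_to_fract_X map_poly_idI)
qed

lemma poly_gen_x2: "poly (map_poly of_rat q) gen_x2 = to_ac (to_fract (map_poly of_rat q))"
proof -
  interpret rat_hom UNIV "to_ac :: rat poly fract poly fract \<Rightarrow> ambient" by (rule rat_hom_to_ac)
  show ?thesis unfolding gen_x2_def
    by (subst h_rat_poly[symmetric]) (auto simp: rat_poly_to_fract_X)
qed

lemma gen_x1_transcendental:
  assumes "\<forall>i. Polynomial.coeff q i \<in> range of_rat" "poly q gen_x1 = 0"
  shows "q = 0"
proof -
  define q' where "q' = map_poly (inv_into UNIV (of_rat :: rat \<Rightarrow> ambient)) q"
  have [simp]: "inv_into UNIV (of_rat :: rat \<Rightarrow> ambient) 0 = 0"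
    by (rule inv_f_eq) (auto simp: inj_def)
  have q: "q = map_poly of_rat q'"
    using assms(1) unfolding q'_def
    by (intro poly_eqI) (simp add: coeff_map_poly f_inv_into_f)
  then show ?thesis using assms(2) by (simp add: poly_gen_x1)
qed

lemma gen_x2_transcendental:
  assumes "\<forall>i. Polynomial.coeff q i \<in> field_x1" "poly q gen_x2 = 0"
  shows "q = 0"
proof -
  define \<iota> :: "rat poly fract \<Rightarrow> ambient" where "\<iota> = (\<lambda>c. to_ac (to_fract [:c:]))"
  define q' where "q' = map_poly (inv_into UNIV \<iota>) q"
  have [simp]: "inv_into UNIV \<iota> 0 = 0" "\<iota> 0 = 0"
    by (rule inv_f_eq) (auto simp: inj_def \<iota>_def)
  have q: "q = map_poly \<iota> q'"
    using assms(1) unfolding q'_def field_x1_def \<iota>_def[symmetric]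
    by (intro poly_eqI) (simp add: coeff_map_poly f_inv_into_f)
  interpret rat_hom UNIV "to_ac :: rat poly fract poly fract \<Rightarrow> ambient" by (rule rat_hom_to_ac)
  have "poly q gen_x2 = to_ac (poly (map_poly (\<lambda>c. to_fract [:c:]) q') (to_fract [:0, 1:]))"
    unfolding q gen_x2_def by (subst h_poly) (auto simp: map_poly_map_poly o_def \<iota>_def)
  then have "q' = 0"
    using assms(2) by (simp add: poly_to_fract_X)
  then show ?thesis using q by simp
qed

text \<open>\<open>gen_x1\<close> and \<open>gen_x2\<close> are algebraically independent, hence the
  two values can be prescribed freely, in any combination of finite coordinates and coordinates at
  infinity. Transcendence of \<open>z2\<close> over \<open>R1\<close> holds because
  \<open>R1\<close> lies in \<open>field_x1\<close>.\<close>

lemma ex_local_hom_x12: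
  fixes w1 w2 :: "'k :: field_char_0"
  assumes z1: "z1 = gen_x1 \<or> z1 = inverse gen_x1" and z2: "z2 = gen_x2 \<or> z2 = inverse gen_x2"
  obtains R h where "local_hom R h" "R \<subseteq> field_x12" "z1 \<in> R" "z2 \<in> R" "h z1 = w1" "h z2 = w2"
proof -
  interpret f1: subalg field_x1 by (rule subfield_subalg[OF rat_subfield_x1])
  have z1_in: "z1 \<in> field_x1"
    using z1 gen_x1_in rat_subfield_x1 by (auto simp: rat_subfield_def)
  have z2_in: "z2 \<in> field_x12"
    using z2 gen_x2_in rat_subfield_x12 by (auto simp: rat_subfield_def)
  obtain h0 :: "ambient \<Rightarrow> 'k" where "rat_hom (range of_rat) h0"
    by (rule ex_rat_hom_of_rat)
  then interpret h0: rat_hom "range of_rat" h0 .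
  have t1: "q = 0" if "\<forall>i. Polynomial.coeff q i \<in> range of_rat" "poly q z1 = 0" for q
    using z1 that gen_x1_transcendental h0.zero
      transcendental_inverse[of gen_x1 "range of_rat" q] gen_x1_neq_0 by metis
  obtain h1 where h1: "rat_hom (rat_subalgebra hull (insert z1 (range of_rat))) h1" "h1 z1 = w1"
  proof (rule h0.ex_adjoin_transcendental[of z1 w1])
    show "q = 0" if "\<forall>i. Polynomial.coeff q i \<in> range of_rat" "poly q z1 = 0" for q
      using that by (rule t1)
  qed (rule that)
  define R1 where "R1 = rat_subalgebra hull (insert z1 (range of_rat))"
  interpret h1: rat_hom R1 h1 using h1 unfolding R1_def by simp
  have R1: "R1 \<subseteq> field_x1" "z1 \<in> R1"
    unfolding R1_def using z1_in f1.of_rat by (intro f1.hull_le hull_inc; blast)+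
  have t2: "q = 0" if "\<forall>i. Polynomial.coeff q i \<in> R1" "poly q z2 = 0" for q
  proof -
    have q: "\<forall>i. Polynomial.coeff q i \<in> field_x1"
      using that R1 by blast
    show ?thesis
      using z2 that(2) q gen_x2_transcendental f1.zero
        transcendental_inverse[of gen_x2 field_x1 q] gen_x2_neq_0 by metis
  qed
  obtain h2 where h2: "rat_hom (rat_subalgebra hull (insert z2 R1)) h2" "h2 z2 = w2" "\<And>u. u \<in> R1 \<Longrightarrow> h2 u = h1 u"
  proof (rule h1.ex_adjoin_transcendental[of z2 w2])
    show "q = 0" if "\<forall>i. Polynomial.coeff q i \<in> R1" "poly q z2 = 0" for q
      using that by (rule t2)
  qed (rule that)
  define R2 where "R2 = rat_subalgebra hull (insert z2 R1)"
  interpret h2: rat_hom R2 h2 using h2 unfolding R2_def by simp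
  interpret f12: subalg field_x12 by (rule subfield_subalg[OF rat_subfield_x12])
  have R2: "R2 \<subseteq> field_x12" "insert z2 R1 \<subseteq> R2"
    unfolding R2_def using z2_in R1 field_x1_subset
    by (intro f12.hull_le hull_subset; blast)+
  obtain R h where *: "local_hom R h" "R2 \<subseteq> R" "\<And>u. u \<in> R2 \<Longrightarrow> h u = h2 u" "R \<subseteq> {u / s |u s. u \<in> R2 \<and> s \<in> R2}"
    by (rule h2.ex_localize) blast
  show ?thesis
  proof (rule that[OF *(1)])
    show "R \<subseteq> field_x12"
      using *(4) R2(1) subfield_divide[OF rat_subfield_x12] by blast
  qed (use * R2 R1 h1 h2 in auto)
qed

text \<open>The choice in \<open>gen_y\<close> is legitimate because the ambient field is
  algebraically closed.\<close>

lemma gen_y_sq: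
  assumes "c \<noteq> 0"
  shows "of_rat c * (gen_y c f x)\<^sup>2 = poly (map_poly of_rat f) x"
proof -
  obtain y :: ambient where "y ^ 2 = poly (map_poly of_rat f) x / of_rat c"
    using nth_root_exists[of 2] by auto
  then have "of_rat c * y\<^sup>2 = poly (map_poly of_rat f) x"
    using assms by simp
  then show ?thesis unfolding gen_y_def by (rule someI)
qed

text \<open>\<open>f / c\<close> has odd degree, so it is no square in \<rat>(x1), and a nonsquare
  of \<rat>(x1) stays a nonsquare in \<rat>(x1)(x2).\<close>

lemma not_square_x1:
  assumes "odd (Polynomial.degree f)" "c \<noteq> 0" "y \<in> field_x12"
  shows "of_rat c * y\<^sup>2 \<noteq> poly (map_poly of_rat f) gen_x1"
proof
  assume eq: "of_rat c * y\<^sup>2 = poly (map_poly of_rat f) gen_x1"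
  obtain \<alpha> where "y = to_ac \<alpha>" using assms(3) by (auto simp: field_x12_def)
  interpret ac: rat_hom UNIV "to_ac :: rat poly fract poly fract \<Rightarrow> ambient" by (rule rat_hom_to_ac)
  have "y\<^sup>2 = of_rat (inverse c) * poly (map_poly of_rat f) gen_x1"
    using eq assms(2) by (simp add: of_rat_inverse flip: eq)
  also have "\<dots> = poly (map_poly of_rat (Polynomial.smult (inverse c) f)) gen_x1"
    by (simp add: map_poly_smult of_rat_mult)
  also have "\<dots> = to_ac (to_fract [:to_fract (Polynomial.smult (inverse c) f):])"
    by (rule poly_gen_x1)
  finally have "\<alpha>\<^sup>2 = to_fract [:to_fract (Polynomial.smult (inverse c) f):]"
    using \<open>y = to_ac \<alpha>\<close> by (simp del: to_ac_power add: to_ac_power[symmetric])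
  moreover have "r\<^sup>2 \<noteq> to_fract (Polynomial.smult (inverse c) f)" for r
    by (rule to_fract_not_square_odd_degree) (use assms in auto)
  ultimately show False using to_fract_not_square_const by blast
qed

text \<open>Here \<rat>(x1) is the constant field and the degree is taken in x2; the factor f(x1) is
  a nonzero constant and leaves the degree odd.\<close>

lemma not_square_x2:
  assumes "odd (Polynomial.degree f)" "f \<noteq> 0" "y \<in> field_x12"
  shows "y\<^sup>2 \<noteq> poly (map_poly of_rat f) gen_x2"
    "y\<^sup>2 \<noteq> poly (map_poly of_rat f) gen_x1 * poly (map_poly of_rat f) gen_x2"
proof -
  obtain \<alpha> where \<alpha>: "y = to_ac \<alpha>" using assms(3) by (auto simp: field_x12_def)
  have deg: "Polynomial.degree (map_poly of_rat f :: rat poly fract poly) = Polynomial.degree f"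
    by (rule degree_map_poly) auto
  show "y\<^sup>2 \<noteq> poly (map_poly of_rat f) gen_x2"
    using to_fract_not_square_odd_degree[of "map_poly of_rat f :: rat poly fract poly" \<alpha>] assms(1) \<alpha>
    by (simp add: poly_gen_x2 deg del: to_ac_power add: to_ac_power[symmetric])
  have "poly (map_poly of_rat f) gen_x1 * poly (map_poly of_rat f) gen_x2
      = to_ac (to_fract (Polynomial.smult (to_fract f) (map_poly of_rat f)))"
    by (simp add: poly_gen_x1 poly_gen_x2 flip: to_ac_mult to_fract_mult)
  then show "y\<^sup>2 \<noteq> poly (map_poly of_rat f) gen_x1 * poly (map_poly of_rat f) gen_x2"
    using to_fract_not_square_odd_degree[of "Polynomial.smult (to_fract f) (map_poly of_rat f) :: rat poly fract poly" \<alpha>] assms \<alpha>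
    by (simp add: deg del: to_ac_power add: to_ac_power[symmetric])
qed

section \<open>Rational polynomials\<close>

abbreviation rpoly :: "rat poly \<Rightarrow> 'a :: field_char_0 \<Rightarrow> 'a" where
  "rpoly q x \<equiv> poly (map_poly of_rat q) x"

lemma map_poly_of_rat_add: "map_poly of_rat (p + q) = map_poly of_rat p + (map_poly of_rat q :: 'a :: field_char_0 poly)"
  by (intro poly_eqI) (simp add: coeff_map_poly of_rat_add)

lemma map_poly_of_rat_mult: "map_poly of_rat (p * q) = map_poly of_rat p * (map_poly of_rat q :: 'a :: field_char_0 poly)"
  by (intro poly_eqI) (simp add: coeff_map_poly coeff_mult of_rat_sum of_rat_mult)

lemma map_poly_of_rat_pderiv: "map_poly of_rat (pderiv p) = pderiv (map_poly of_rat p :: 'a :: field_char_0 poly)"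
  by (intro poly_eqI) (simp add: coeff_map_poly coeff_pderiv of_rat_mult del: of_nat_Suc)

lemma map_poly_of_rat_reflect: "map_poly of_rat (reflect_poly p) = reflect_poly (map_poly of_rat p :: 'a :: field_char_0 poly)"
proof -
  have "Polynomial.degree (map_poly of_rat p :: 'a poly) = Polynomial.degree p"
    by (rule degree_map_poly) auto
  then show ?thesis
    by (intro poly_eqI) (simp add: coeff_map_poly coeff_reflect_poly)
qed

lemma map_poly_of_rat_eq_0_iff [simp]: "map_poly of_rat p = (0 :: 'a :: field_char_0 poly) \<longleftrightarrow> p = 0"
  by (rule map_poly_eq_0_iff) auto

lemma rpoly_of_rat [simp]: "rpoly q (of_rat a) = of_rat (poly q a)"
  by (induction q) (auto simp: map_poly_pCons of_rat_add of_rat_mult)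

lemma rpoly_reflect:
  fixes w :: "'a :: field_char_0"
  assumes "w \<noteq> 0" shows "rpoly (reflect_poly q) w = w ^ Polynomial.degree q * rpoly q (inverse w)"
proof -
  have "Polynomial.degree (map_poly of_rat q :: 'a poly) = Polynomial.degree q"
    by (rule degree_map_poly) auto
  then show ?thesis
    using assms by (simp add: map_poly_of_rat_reflect poly_reflect_poly_nz)
qed

text \<open>A Bezout identity for \<open>f\<close> and its derivative survives evaluation at a point
  of any extension field.\<close>

lemma rpoly_pderiv_nonzero:
  fixes w :: "'a :: field_char_0"
  assumes "coprime f (pderiv f)" "rpoly f w = 0"
  shows "poly (pderiv (map_poly of_rat f)) w \<noteq> 0"
proof
  assume z: "poly (pderiv (map_poly of_rat f)) w = 0"
  obtain u v where "u * f + v * pderiv f = 1"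
    using assms(1) by (metis bezout_coefficients_fst_snd coprime_imp_gcd_eq_1)
  then have "rpoly (u * f + v * pderiv f) w = 1" by simp
  then show False
    using assms(2) z by (simp add: map_poly_of_rat_add map_poly_of_rat_mult map_poly_of_rat_pderiv)
qed

section \<open>Analysis over a complete valued field\<close>

text \<open>The type class supplies a metric only. Translation invariance and multiplicativity tie
  it to the field operations, and the limit laws are derived from them.\<close>

locale valued_field =
  fixes K :: "'k :: {field_char_0, complete_space} itself"
  assumes dist_diff: "dist x y = dist (x - y) (0 :: 'k)"
    and dist_mult: "dist (x * y) (0 :: 'k) = dist x 0 * dist y 0"
begin

definition val :: "'k \<Rightarrow> real" where "val x = dist x 0"

lemma dist_val: "dist x y = val (x - y)"
  unfolding val_def by (rule dist_diff)

lemma val_nonneg [simp]: "val x \<ge> 0" and val_0 [simp]: "val 0 = 0" and val_eq_0 [simp]: "val x = 0 \<longleftrightarrow> x = 0"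
  and val_pos [simp]: "val x > 0 \<longleftrightarrow> x \<noteq> 0"
  by (auto simp: val_def)

lemma val_mult: "val (x * y) = val x * val y"
  by (simp add: val_def dist_mult)

lemma val_minus [simp]: "val (- x) = val x"
  using dist_commute[of x 0] dist_val[of 0 x] by (simp add: val_def)

lemma val_add: "val (x + y) \<le> val x + val y"
  using dist_triangle[of x "- y" 0] dist_val[of x "-y"] dist_commute[of 0 "-y"] by (simp add: val_def[symmetric])

lemma val_1 [simp]: "val 1 = 1"
  using val_mult[of 1 1] val_eq_0[of 1] by simp

lemma val_divide: "val (x / y) = val x / val y"
  using val_mult[of "x / y" y] by (cases "y = 0") (auto simp: field_simps)

lemma val_power: "val (x ^ n) = val x ^ n"
  by (induction n) (auto simp: val_mult)

lemma tendsto_val_iff: "tendsto xs L F \<longleftrightarrow> tendsto (\<lambda>n. val (xs n - L)) 0 F"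
  using tendsto_dist_iff[of xs L F] by (simp add: dist_val)

lemma lim_add:
  assumes "tendsto xs L F" "tendsto ys M F"
  shows "tendsto (\<lambda>n. xs n + ys n) (L + M :: 'k) F"
  unfolding tendsto_val_iff
proof (rule tendsto_sandwich[OF _ _ tendsto_const])
  show "\<forall>\<^sub>F n in F. val (xs n + ys n - (L + M)) \<le> val (xs n - L) + val (ys n - M)"
  proof (rule always_eventually, rule)
    fix n show "val (xs n + ys n - (L + M)) \<le> val (xs n - L) + val (ys n - M)"
      using val_add[of "xs n - L" "ys n - M"] by (simp add: algebra_simps)
  qed
  show "tendsto (\<lambda>n. val (xs n - L) + val (ys n - M)) 0 F"
    using tendsto_add[of "\<lambda>n. val (xs n - L)" 0 F "\<lambda>n. val (ys n - M)" 0] assms by (simp add: tendsto_val_iff)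
qed auto

lemma lim_mult:
  assumes "tendsto xs L F" "tendsto ys M F"
  shows "tendsto (\<lambda>n. xs n * ys n) (L * M :: 'k) F"
  unfolding tendsto_val_iff
proof (rule tendsto_sandwich[OF _ _ tendsto_const])
  let ?b = "\<lambda>n. val (xs n - L) * val (ys n - M) + val (xs n - L) * val M + val L * val (ys n - M)"
  show "\<forall>\<^sub>F n in F. val (xs n * ys n - L * M) \<le> ?b n"
  proof (rule always_eventually, rule)
    fix n
    have "xs n * ys n - L * M = (xs n - L) * (ys n - M) + (xs n - L) * M + L * (ys n - M)"
      by (simp add: algebra_simps)
    then show "val (xs n * ys n - L * M) \<le> ?b n"
      using val_add[of "(xs n - L) * (ys n - M) + (xs n - L) * M" "L * (ys n - M)"]
        val_add[of "(xs n - L) * (ys n - M)" "(xs n - L) * M"] by (simp add: val_mult)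
  qed
  have "tendsto ?b (0 * 0 + 0 * val M + val L * 0) F"
    using assms by (intro tendsto_intros) (auto simp: tendsto_val_iff)
  then show "tendsto ?b 0 F" by simp
qed auto

lemma lim_inverse:
  assumes "tendsto xs L F" "L \<noteq> (0 :: 'k)"
  shows "tendsto (\<lambda>n. inverse (xs n)) (inverse L) F"
  unfolding tendsto_val_iff
proof (rule Lim_transform_eventually)
  have xs: "tendsto (\<lambda>n. val (xs n)) (val L) F"
    unfolding val_def using assms(1) by (intro tendsto_intros)
  have "tendsto (\<lambda>n. val (xs n - L) / (val (xs n) * val L)) (0 / (val L * val L)) F"
    using assms xs by (intro tendsto_intros) (auto simp: tendsto_val_iff)
  then show "tendsto (\<lambda>n. val (xs n - L) / (val (xs n) * val L)) 0 F" by simp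
  have "\<forall>\<^sub>F n in F. xs n \<noteq> 0"
    using tendsto_imp_eventually_ne[OF assms] .
  then show "\<forall>\<^sub>F n in F. val (xs n - L) / (val (xs n) * val L) = val (inverse (xs n) - inverse L)"
  proof eventually_elim
    case (elim n)
    then have "inverse (xs n) - inverse L = (- (xs n - L)) / (xs n * L)"
      using assms(2) by (simp add: field_simps)
    then show ?case by (simp only: val_divide val_minus val_mult)
  qed
qed

lemma lim_divide:
  assumes "tendsto xs L F" "tendsto ys M F" "M \<noteq> (0 :: 'k)"
  shows "tendsto (\<lambda>n. xs n / ys n) (L / M) F"
  unfolding divide_inverse by (intro lim_mult lim_inverse assms)

lemma lim_power:
  assumes "tendsto xs L F" shows "tendsto (\<lambda>n. xs n ^ m) (L ^ m :: 'k) F"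
  by (induction m) (auto intro: lim_mult assms)

lemma lim_poly:
  assumes "tendsto xs L F" shows "tendsto (\<lambda>n. poly q (xs n)) (poly q L :: 'k) F"
  by (induction q) (auto intro!: lim_add lim_mult assms)

text \<open>Strict differentiability, in the form that makes Newton's iteration a contraction.\<close>

lemma ex_poly_difference_quotient:
  fixes q :: "'k poly"
  obtains \<Delta> where "\<And>x y. poly q x - poly q y = (x - y) * \<Delta> x y"
    "\<And>w. tendsto (\<lambda>z. \<Delta> (fst z) (snd z)) (poly (pderiv q) w) (nhds (w, w))"
proof (induction q arbitrary: thesis)
  case 0
  show ?case by (rule 0[of "\<lambda>_ _. 0"]) auto
next
  case (pCons a q)
  obtain \<Delta> where \<Delta>: "\<And>x y. poly q x - poly q y = (x - y) * \<Delta> x y"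
    "\<And>w. tendsto (\<lambda>z. \<Delta> (fst z) (snd z)) (poly (pderiv q) w) (nhds (w, w))"
    by (rule pCons.IH) (rule that)
  have proj: "tendsto fst w (nhds (w, w))" "tendsto snd w (nhds (w, w))" for w :: 'k
    using tendsto_fst[OF filterlim_ident[of "nhds (w, w)"]] tendsto_snd[OF filterlim_ident[of "nhds (w, w)"]] by simp_all
  \<comment> \<open>The recursion comes from x q(x) - y q(y) = (x - y) q(x) + y (q(x) -
    q(y)).\<close>
  show ?case
  proof (rule pCons.prems[of "\<lambda>x y. poly q x + y * \<Delta> x y"])
    fix x y
    show "poly (pCons a q) x - poly (pCons a q) y = (x - y) * (poly q x + y * \<Delta> x y)"
      using arg_cong[OF \<Delta>(1)[of x y], of "\<lambda>t. y * t"] by (simp add: algebra_simps)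
  next
    fix w :: 'k
    show "tendsto (\<lambda>z. poly q (fst z) + snd z * \<Delta> (fst z) (snd z)) (poly (pderiv (pCons a q)) w) (nhds (w, w))"
      using lim_add[OF lim_poly[OF proj(1)] lim_mult[OF proj(2) \<Delta>(2)], of q w] by (simp add: pderiv_pCons)
  qed
qed

text \<open>The bounds are non-strict so that the balls are closed, hence complete, as the fixed
  point theorem requires.\<close>

lemma nhds_pairE:
  assumes "\<forall>\<^sub>F z in nhds (w, w :: 'k). P (fst z) (snd z)"
  obtains \<rho> where "\<rho> > 0" "\<And>x y. dist x w \<le> \<rho> \<Longrightarrow> dist y w \<le> \<rho> \<Longrightarrow> P x y"
proof -
  obtain d where d: "d > 0" "\<And>z. dist z (w, w) < d \<Longrightarrow> P (fst z) (snd z)"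
    using assms unfolding eventually_nhds_metric by blast
  show ?thesis
  proof (rule that[of "d / 4"])
    fix x y assume *: "dist x w \<le> d / 4" "dist y w \<le> d / 4"
    have "dist (x, y) (w, w) \<le> dist x w + dist y w"
      by (simp add: dist_Pair_Pair sqrt_sum_squares_le_sum)
    also have "\<dots> < d" using * d(1) by simp
    finally show "P x y" using d(2)[of "(x, y)"] by simp
  qed (use d in auto)
qed

text \<open>Newton's iteration with the slope frozen at \<open>m\<close>, the derivative at
  \<open>w\<close>: the fixed points of \<open>T\<close> are the solutions of
  \<open>poly N v = \<theta> * poly D v\<close>, and \<open>T\<close> contracts a closed ball around
  \<open>w\<close> by the factor 1/2.\<close>

lemma ex_perturbed_root:
  fixes N D :: "'k poly"
  assumes root: "poly N w = 0" and simple: "poly (pderiv N) w \<noteq> 0" and "\<epsilon> > 0"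
  obtains \<delta> where "\<delta> > 0" "\<And>\<theta>. val \<theta> < \<delta> \<Longrightarrow> \<exists>v. dist v w < \<epsilon> \<and> poly N v = \<theta> * poly D v"
proof -
  define m where "m = poly (pderiv N) w"
  have m: "m \<noteq> 0" "val m > 0" using simple by (auto simp: m_def)
  obtain \<Delta> where \<Delta>: "\<And>x y. poly N x - poly N y = (x - y) * \<Delta> x y"
    "\<And>w. tendsto (\<lambda>z. \<Delta> (fst z) (snd z)) (poly (pderiv N) w) (nhds (w, w))"
    by (rule ex_poly_difference_quotient[of N]) (rule that)
  obtain \<Delta>' where \<Delta>': "\<And>x y. poly D x - poly D y = (x - y) * \<Delta>' x y"
    "\<And>w. tendsto (\<lambda>z. \<Delta>' (fst z) (snd z)) (poly (pderiv D) w) (nhds (w, w))"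
    by (rule ex_poly_difference_quotient[of D]) (rule that)
  define C where "C = val (poly (pderiv D) w) + 1"
  have C: "C > 0" by (simp add: C_def add_nonneg_pos)
  have "\<forall>\<^sub>F z in nhds (w, w). dist (\<Delta> (fst z) (snd z)) m < val m / 4"
    using tendstoD[OF \<Delta>(2)[of w], of "val m / 4"] m by (simp add: m_def)
  moreover have "\<forall>\<^sub>F z in nhds (w, w). dist (\<Delta>' (fst z) (snd z)) (poly (pderiv D) w) < 1"
    using tendstoD[OF \<Delta>'(2)[of w], of 1] by simp
  ultimately have "\<forall>\<^sub>F z in nhds (w, w). dist (\<Delta> (fst z) (snd z)) m < val m / 4
      \<and> dist (\<Delta>' (fst z) (snd z)) (poly (pderiv D) w) < 1"
    by (rule eventually_conj)
  then obtain \<rho>0 where \<rho>0: "\<rho>0 > 0" "\<And>x y. dist x w \<le> \<rho>0 \<Longrightarrow> dist y w \<le> \<rho>0 \<Longrightarrow>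
      dist (\<Delta> x y) m < val m / 4 \<and> dist (\<Delta>' x y) (poly (pderiv D) w) < 1"
    by (rule nhds_pairE) (rule that)
  define \<rho> where "\<rho> = min \<rho>0 (\<epsilon> / 2)"
  have \<rho>: "\<rho> > 0" "\<rho> \<le> \<rho>0" "\<rho> < \<epsilon>" using \<rho>0 \<open>\<epsilon> > 0\<close> by (auto simp: \<rho>_def)
  \<comment> \<open>The first bound lets the perturbation change the slope by at most
    \<open>val m / 4\<close>, where \<open>C\<close> bounds \<open>\<Delta>'\<close>; the second
    lets \<open>T\<close> move the centre by at most \<open>\<rho> / 2\<close>. The added 1 keeps
    the denominator positive.\<close>
  define \<delta> where "\<delta> = min (val m / (4 * C)) (\<rho> * val m / (2 * (val (poly D w) + 1)))"
  show ?thesis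
  proof (rule that[of \<delta>])
    show "\<delta> > 0" unfolding \<delta>_def min_less_iff_conj
      using m C \<rho> by (intro conjI divide_pos_pos mult_pos_pos) (auto simp: add_nonneg_pos)
    fix \<theta> assume \<theta>: "val \<theta> < \<delta>"
    define T where "T v = v - (poly N v - \<theta> * poly D v) / m" for v
    have lip: "dist (T x) (T y) \<le> 1 / 2 * dist x y" if xy: "x \<in> cball w \<rho>" "y \<in> cball w \<rho>" for x y
    proof -
      have xy': "dist x w \<le> \<rho>0" "dist y w \<le> \<rho>0"
        using xy \<rho> by (auto simp: dist_commute)
      have "T x - T y = (x - y) - ((poly N x - poly N y) - \<theta> * (poly D x - poly D y)) / m"
        by (simp add: T_def algebra_simps diff_divide_distrib add_divide_distrib)
      also have "\<dots> = (x - y) * ((m - \<Delta> x y + \<theta> * \<Delta>' x y) / m)"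
        unfolding \<Delta>(1) \<Delta>'(1) using m by (simp add: field_simps)
      finally have eq: "val (T x - T y) = val (x - y) * (val (m - \<Delta> x y + \<theta> * \<Delta>' x y) / val m)"
        by (simp add: val_mult val_divide)
      have 1: "val (m - \<Delta> x y) \<le> val m / 4"
        using \<rho>0(2)[OF xy'] by (simp add: dist_commute flip: dist_val)
      have "val (\<Delta>' x y) \<le> val (\<Delta>' x y - poly (pderiv D) w) + val (poly (pderiv D) w)"
        using val_add[of "\<Delta>' x y - poly (pderiv D) w" "poly (pderiv D) w"] by simp
      then have "val (\<Delta>' x y) \<le> C"
        using \<rho>0(2)[OF xy'] by (simp add: C_def dist_val)
      moreover have "val \<theta> \<le> val m / (4 * C)" using \<theta> by (simp add: \<delta>_def)
      ultimately have "val \<theta> * val (\<Delta>' x y) \<le> val m / (4 * C) * C"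
        using C m by (intro mult_mono divide_nonneg_pos) auto
      also have "\<dots> = val m / 4" using C by simp
      finally have "val (m - \<Delta> x y + \<theta> * \<Delta>' x y) \<le> val m / 2"
        using 1 val_add[of "m - \<Delta> x y" "\<theta> * \<Delta>' x y"] by (simp add: val_mult)
      then have "val (m - \<Delta> x y + \<theta> * \<Delta>' x y) / val m \<le> 1 / 2"
        using m by (simp add: field_simps)
      then have "val (x - y) * (val (m - \<Delta> x y + \<theta> * \<Delta>' x y) / val m) \<le> val (x - y) * (1 / 2)"
        by (intro mult_left_mono) auto
      then show ?thesis unfolding dist_val eq by simp
    qed
    have Tw: "dist (T w) w \<le> \<rho> / 2"
    proof -
      have "dist (T w) w = val \<theta> * val (poly D w) / val m"
        using root by (simp add: dist_val T_def val_mult val_divide)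
      also have "val \<theta> \<le> \<rho> * val m / (2 * (val (poly D w) + 1))"
        using \<theta> by (simp add: \<delta>_def)
      then have "val \<theta> * val (poly D w) / val m \<le> (\<rho> * val m / (2 * (val (poly D w) + 1))) * (val (poly D w) + 1) / val m"
        using m by (intro divide_right_mono mult_mono) (auto intro: order_trans[OF val_nonneg])
      also have "\<dots> = \<rho> / 2"
      proof -
        have cancel: "a * b / (2 * c) * c / b = a / 2" if "b \<noteq> 0" "c \<noteq> 0" for a b c :: real
          using that by simp
        show ?thesis
          by (rule cancel) (use m add_nonneg_pos[OF val_nonneg[of "poly D w"], of 1] in auto)
      qed
      finally show ?thesis .
    qed
    have "\<exists>!x\<in>cball w \<rho>. T x = x"
    proof (rule Banach_fix[where c = "1/2"])
      show "complete (cball w \<rho>)" by (simp add: complete_eq_closed)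
      show "T ` cball w \<rho> \<subseteq> cball w \<rho>"
      proof clarify
        fix x assume x: "x \<in> cball w \<rho>"
        have "dist (T x) w \<le> dist (T x) (T w) + dist (T w) w"
          by (rule dist_triangle)
        also have "dist (T x) (T w) \<le> 1 / 2 * dist x w"
          using x \<rho> by (intro lip) auto
        also have "dist x w \<le> \<rho>" using x by (simp add: dist_commute)
        finally show "T x \<in> cball w \<rho>" using Tw by (simp add: dist_commute)
      qed
    qed (use \<rho> lip in auto)
    then obtain v where v: "v \<in> cball w \<rho>" "T v = v" by blast
    then have "(poly N v - \<theta> * poly D v) / m = 0" by (simp add: T_def)
    then show "\<exists>v. dist v w < \<epsilon> \<and> poly N v = \<theta> * poly D v"
      using m v(1) \<rho> by (intro exI[of _ v]) (auto simp: dist_commute)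
  qed
qed

end

text \<open>The value at \<open>p\<close> is recorded because powers of \<open>p\<close> then give
  arbitrarily small nonzero perturbations.\<close>

locale padic_field = valued_field K for K :: "'k :: {field_char_0, complete_space} itself" +
  fixes p :: nat
  assumes prime: "Factorial_Ring.prime p" and val_p: "dist (of_nat p) (0 :: 'k) = 1 / real p"

lemma padic_fieldI:
  assumes "Factorial_Ring.prime p" "padic_completion p TYPE('k :: {field_char_0, complete_space})"
  shows "padic_field TYPE('k) p"
proof
  show "dist x y = dist (x - y) 0" "dist (x * y) 0 = dist x 0 * dist y 0" for x y :: 'k
    using assms(2) unfolding padic_completion_def by blast+
  have q: "quotient_of (of_nat p) = (int p, 1)"
    using quotient_of_int[of "int p"] by (simp add: of_int_def)
  have "dist (of_nat p) (0 :: 'k) = padic_abs p (of_nat p)"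
    using assms(2) unfolding padic_completion_def by (metis of_rat_of_nat_eq)
  also have "\<dots> = real p powi (- 1)"
    using assms(1) q prime_gt_1_nat[OF assms(1)] by (auto simp: padic_abs_def multiplicity_self)
  also have "\<dots> = 1 / real p"
    by (simp add: power_int_minus field_simps)
  finally show "dist (of_nat p) (0 :: 'k) = 1 / real p" .
qed (use assms in auto)

context padic_field
begin

lemma pow_tendsto_0: "(\<lambda>n. of_nat p ^ n :: 'k) \<longlonglongrightarrow> 0"
proof -
  have "(\<lambda>n. (1 / real p) ^ n) \<longlonglongrightarrow> 0"
    using prime_gt_1_nat[OF prime] by (intro LIMSEQ_power_zero) auto
  then show ?thesis
    using val_p by (simp add: tendsto_val_iff val_power) (simp add: val_def)
qed

text \<open>The points \<open>w + of_nat p ^ n\<close> are distinct and tend to \<open>w\<close>,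
  while \<open>q\<close> has finitely many roots.\<close>

lemma ex_approx_nonroots:
  fixes q :: "'k poly"
  assumes "q \<noteq> 0"
  obtains x where "x \<longlonglongrightarrow> w" "\<forall>\<^sub>F n in sequentially. poly q (x n) \<noteq> 0"
proof (rule that[of "\<lambda>n. w + of_nat p ^ n"])
  show "(\<lambda>n. w + of_nat p ^ n) \<longlonglongrightarrow> w"
    using lim_add[OF tendsto_const pow_tendsto_0, of w] by simp
  have "inj (\<lambda>n. w + (of_nat p ^ n :: 'k))"
  proof (rule injI)
    fix m n assume "w + (of_nat p ^ m :: 'k) = w + of_nat p ^ n"
    then have "of_nat (p ^ m) = (of_nat (p ^ n) :: 'k)" by simp
    then have "p ^ m = p ^ n" using of_nat_eq_iff by blast
    then show "m = n" using prime_gt_1_nat[OF prime] by simp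
  qed
  then have "finite ((\<lambda>n. w + of_nat p ^ n) -` {x. poly q x = 0})"
    by (intro finite_vimageI poly_roots_finite assms)
  then show "\<forall>\<^sub>F n in sequentially. poly q (w + of_nat p ^ n) \<noteq> 0"
    by (simp add: vimage_def eventually_cofinite flip: cofinite_eq_sequentially)
qed

end

section \<open>Approximation by rational data\<close>

text \<open>
  On each chart of \<open>y\<^sup>2 = f(x)\<close> there is a coordinate \<open>z\<close>, invariant under \<open>-1\<close>, and an
  anti-invariant function \<open>o\<close>, with \<open>o\<^sup>2 = N(z) / D(z)\<close>. The three cases are \<open>(z, o) = (x, y)\<close>,
  \<open>(x, 1 / y)\<close> and, at infinity, \<open>(1 / x, x / y)\<close>.
\<close>

definition local_model :: "rat poly \<Rightarrow> rat poly \<Rightarrow> rat poly \<Rightarrow> bool" where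
  "local_model f N D \<longleftrightarrow> (N, D) \<in> {(f, 1), (1, f), ([:0, 1:], reflect_poly f)}"

text \<open>For \<open>N = f\<close> this is separability; 1 has no root, and X has derivative
  1.\<close>

lemma local_model_simple_root:
  fixes w :: "'k :: field_char_0"
  assumes "coprime f (pderiv f)" "local_model f N D" "rpoly N w = 0"
  shows "poly (pderiv (map_poly of_rat N)) w \<noteq> 0"
  using assms rpoly_pderiv_nonzero[of f w]
  by (auto simp: local_model_def map_poly_pCons pderiv_pCons)

text \<open>Density in coordinates, for affine points: generic data never involve the point at
  infinity. This form separates the analysis from the encoding of points as homomorphisms.\<close>

definition (in valued_field) twist_dense :: "rat poly \<Rightarrow> rat \<Rightarrow> bool" where
  "twist_dense f c \<longleftrightarrow> (\<forall>(u :: 'k) v \<epsilon>. of_rat c * v\<^sup>2 = rpoly f u \<longrightarrow> \<epsilon> > 0 \<longrightarrow>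
     (\<exists>u' v'. c * v'\<^sup>2 = poly f u' \<and> dist (of_rat u') u < \<epsilon> \<and> dist (of_rat v') v < \<epsilon>))"

context valued_field
begin

lemma lim_of_dist_less:
  fixes x :: 'k
  assumes "\<And>n. dist (xs n) x < 1 / real (Suc n)"
  shows "xs \<longlonglongrightarrow> x"
  unfolding tendsto_val_iff dist_val[symmetric]
proof (rule tendsto_sandwich[where f = "\<lambda>_. 0" and h = "\<lambda>n. 1 / real (Suc n)"])
  show "\<forall>\<^sub>F n in sequentially. dist (xs n) x \<le> 1 / real (Suc n)"
    using assms by (intro always_eventually allI less_imp_le)
  show "(\<lambda>n. 1 / real (Suc n)) \<longlonglongrightarrow> 0"
    using LIMSEQ_inverse_real_of_nat by (simp add: inverse_eq_divide)
qed simp_all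

lemma twist_denseE:
  fixes u v :: 'k
  assumes "twist_dense f c" "of_rat c * v\<^sup>2 = rpoly f u"
  obtains U V where "\<And>n. c * (V n)\<^sup>2 = poly f (U n)" "(\<lambda>n. of_rat (U n)) \<longlonglongrightarrow> u" "(\<lambda>n. of_rat (V n)) \<longlonglongrightarrow> v"
proof -
  define P where "P n uv \<longleftrightarrow> c * (snd uv)\<^sup>2 = poly f (fst uv) \<and>
      dist (of_rat (fst uv)) u < 1 / real (Suc n) \<and> dist (of_rat (snd uv)) v < 1 / real (Suc n)" for n uv
  have "\<exists>uv. P n uv" for n
  proof -
    have "1 / real (Suc n) > 0" by simp
    with assms obtain u' v' where "c * v'\<^sup>2 = poly f u'" "dist (of_rat u') u < 1 / real (Suc n)"
      "dist (of_rat v') v < 1 / real (Suc n)"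
      unfolding twist_dense_def by blast
    then have "P n (u', v')" by (simp add: P_def)
    then show ?thesis by blast
  qed
  then have h: "P n (SOME uv. P n uv)" for n
    by (rule someI_ex)
  define h where "h n = (SOME uv. P n uv)" for n
  note h = h[folded h_def]
  show ?thesis
    by (rule that[of "\<lambda>n. snd (h n)" "\<lambda>n. fst (h n)"]; (rule lim_of_dist_less)?) (use h in \<open>simp_all add: P_def\<close>)
qed

text \<open>In the three models the pair \<open>(w, e)\<close> corresponds to the points
  \<open>(w, e)\<close>, \<open>(w, 1 / (c * e))\<close> and \<open>(1 / w, 1 / (c * e * w))\<close>
  of the twist by \<open>c\<close>, so density on the twist carries over by continuity. From
  \<open>nz\<close> come \<open>e \<noteq> 0\<close> and, in the third model,
  \<open>w \<noteq> 0\<close>.\<close>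

lemma local_model_dense:
  fixes w e :: 'k
  assumes f: "Polynomial.degree f = 3" and model: "local_model f N D" and dense: "twist_dense f c" and "c \<noteq> 0"
    and eq: "rpoly N w = of_rat c * e\<^sup>2 * rpoly D w" and nz: "rpoly N w \<noteq> 0"
  obtains W E where "\<forall>\<^sub>F n in sequentially. poly N (W n) = c * (E n)\<^sup>2 * poly D (W n)"
    "(\<lambda>n. of_rat (W n)) \<longlonglongrightarrow> w" "(\<lambda>n. of_rat (E n)) \<longlonglongrightarrow> e"
proof -
  have [simp]: "e \<noteq> 0" using eq nz by auto
  from model consider "N = f" "D = 1" | "N = 1" "D = f" | "N = [:0, 1:]" "D = reflect_poly f"
    by (auto simp: local_model_def)
  then show ?thesis
  proof cases
    case 1
    then have "of_rat c * e\<^sup>2 = rpoly f w" using eq by simp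
    then obtain U V where UV: "\<And>n. c * (V n)\<^sup>2 = poly f (U n)" "(\<lambda>n. of_rat (U n)) \<longlonglongrightarrow> w" "(\<lambda>n. of_rat (V n)) \<longlonglongrightarrow> e"
      using twist_denseE[OF dense] by blast
    show ?thesis
      by (rule that[of U V]) (use UV 1 in simp_all)
  next
    case 2
    define v where "v = inverse (of_rat c * e)"
    have "of_rat c * v\<^sup>2 = rpoly f w"
      using eq 2 \<open>c \<noteq> 0\<close> by (simp add: v_def field_simps power2_eq_square)
    then obtain U V where UV: "\<And>n. c * (V n)\<^sup>2 = poly f (U n)" "(\<lambda>n. of_rat (U n)) \<longlonglongrightarrow> w" "(\<lambda>n. of_rat (V n)) \<longlonglongrightarrow> v"
      using twist_denseE[OF dense] by blast
    have v: "v \<noteq> 0" using \<open>c \<noteq> 0\<close> by (simp add: v_def)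
    show ?thesis
    proof (rule that[of U "\<lambda>n. inverse (c * V n)"])
      have "\<forall>\<^sub>F n in sequentially. of_rat (V n) \<noteq> (0 :: 'k)"
        using tendsto_imp_eventually_ne[OF UV(3) v] .
      then show "\<forall>\<^sub>F n in sequentially. poly N (U n) = c * (inverse (c * V n))\<^sup>2 * poly D (U n)"
      proof eventually_elim
        case (elim n)
        then show ?case using 2 \<open>c \<noteq> 0\<close> UV(1)[of n, symmetric] by (simp add: field_simps power2_eq_square)
      qed
      have "(\<lambda>n. inverse (of_rat c * of_rat (V n))) \<longlonglongrightarrow> inverse (of_rat c * v)"
        using v \<open>c \<noteq> 0\<close> by (intro lim_inverse lim_mult UV tendsto_const) auto
      then show "(\<lambda>n. of_rat (inverse (c * V n))) \<longlonglongrightarrow> e"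
        using \<open>c \<noteq> 0\<close> by (simp add: v_def of_rat_inverse of_rat_mult mult.assoc[symmetric])
    qed fact
  next
    case 3
    have [simp]: "w \<noteq> 0" using nz 3 by (auto simp: map_poly_pCons)
    have refl: "rpoly D w = w ^ 3 * rpoly f (inverse w)"
      using 3 f by (simp add: rpoly_reflect)
    define v where "v = inverse (of_rat c * e * w)"
    have "1 = of_rat c * e\<^sup>2 * w\<^sup>2 * rpoly f (inverse w)"
      using eq 3(1) unfolding refl by (simp add: map_poly_pCons power2_eq_square power3_eq_cube mult.assoc)
    then have "of_rat c * v\<^sup>2 = rpoly f (inverse w)"
      using \<open>c \<noteq> 0\<close> by (simp add: v_def field_simps power2_eq_square)
    then obtain U V where UV: "\<And>n. c * (V n)\<^sup>2 = poly f (U n)" "(\<lambda>n. of_rat (U n)) \<longlonglongrightarrow> inverse w" "(\<lambda>n. of_rat (V n)) \<longlonglongrightarrow> v"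
      using twist_denseE[OF dense] by blast
    have v: "v \<noteq> 0" using \<open>c \<noteq> 0\<close> by (simp add: v_def)
    show ?thesis
    proof (rule that[of "\<lambda>n. inverse (U n)" "\<lambda>n. U n / (c * V n)"])
      have "\<forall>\<^sub>F n in sequentially. of_rat (V n) \<noteq> (0 :: 'k)" "\<forall>\<^sub>F n in sequentially. of_rat (U n) \<noteq> (0 :: 'k)"
        using tendsto_imp_eventually_ne[OF UV(3) v] tendsto_imp_eventually_ne[OF UV(2), of 0] by auto
      then show "\<forall>\<^sub>F n in sequentially. poly N (inverse (U n)) = c * (U n / (c * V n))\<^sup>2 * poly D (inverse (U n))"
      proof eventually_elim
        case (elim n)
        then have "poly D (inverse (U n)) = inverse (U n) ^ 3 * poly f (U n)"
          using 3 f by (simp add: poly_reflect_poly_nz)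
        then show ?case using elim 3 \<open>c \<noteq> 0\<close> UV(1)[of n, symmetric]
          by (simp add: field_simps power2_eq_square power3_eq_cube)
      qed
      show "(\<lambda>n. of_rat (inverse (U n))) \<longlonglongrightarrow> w"
        using lim_inverse[OF UV(2)] by (simp add: of_rat_inverse)
      have "(\<lambda>n. of_rat (U n) / (of_rat c * of_rat (V n))) \<longlonglongrightarrow> inverse w / (of_rat c * v)"
        using v \<open>c \<noteq> 0\<close> by (intro lim_divide lim_mult UV tendsto_const) auto
      then show "(\<lambda>n. of_rat (U n / (c * V n))) \<longlonglongrightarrow> e"
        using \<open>c \<noteq> 0\<close> by (simp add: v_def of_rat_divide of_rat_mult field_simps)
    qed
  qed
qed

end

text \<open>
  The equation of the Kummer surface, with \<open>w1\<close>, \<open>w2\<close> and \<open>l\<close> the values of \<open>z1\<close>, \<open>z2\<close> and the ratio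
  of the two anti-invariant functions. It makes sense on the exceptional curves as well, where
  \<open>N1\<close> and \<open>N2\<close> vanish; these are excluded here.
\<close>

definition generic_data :: "rat poly \<Rightarrow> rat poly \<Rightarrow> rat poly \<Rightarrow> rat poly \<Rightarrow> 'k :: field_char_0 \<Rightarrow> 'k \<Rightarrow> 'k \<Rightarrow> bool" where
  "generic_data N1 D1 N2 D2 w1 w2 l \<longleftrightarrow>
     rpoly N1 w1 \<noteq> 0 \<and> rpoly D1 w1 \<noteq> 0 \<and> rpoly N2 w2 \<noteq> 0 \<and> rpoly D2 w2 \<noteq> 0 \<and> l \<noteq> 0 \<and>
     rpoly N2 w2 * rpoly D1 w1 = l\<^sup>2 * rpoly N1 w1 * rpoly D2 w2"

text \<open>Write N1(w1) / D1(w1) as \<open>c * e\<^sup>2\<close>. The Kummer equation says that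
  N2(w2) / D2(w2) is \<open>c * (l * e)\<^sup>2\<close>, so both coordinates come from points of the
  one twist by \<open>c\<close>, with odd coordinates \<open>e\<close> and \<open>l * e\<close>. The
  ratio of rational approximations to these tends to \<open>l\<close>.\<close>

lemma (in valued_field) generic_data_dense:
  fixes w1 w2 l :: 'k
  assumes f: "Polynomial.degree f = 3"
    and twists: "\<And>d :: 'k. d \<noteq> 0 \<Longrightarrow> \<exists>c. c \<noteq> 0 \<and> (\<exists>e :: 'k. d = of_rat c * e\<^sup>2) \<and> twist_dense f c"
    and model: "local_model f N1 D1" "local_model f N2 D2"
    and gen: "generic_data N1 D1 N2 D2 w1 w2 l" and "\<epsilon> > 0"
  obtains a b r :: rat where "generic_data N1 D1 N2 D2 a b r"
    "dist (of_rat a) w1 < \<epsilon>" "dist (of_rat b) w2 < \<epsilon>" "dist (of_rat r) l < \<epsilon>"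
proof -
  have nz: "rpoly N1 w1 \<noteq> 0" "rpoly D1 w1 \<noteq> 0" "rpoly N2 w2 \<noteq> 0" "rpoly D2 w2 \<noteq> 0" "l \<noteq> 0"
    and eq: "rpoly N2 w2 * rpoly D1 w1 = l\<^sup>2 * rpoly N1 w1 * rpoly D2 w2"
    using gen by (auto simp: generic_data_def)
  obtain c e where c: "c \<noteq> 0" "rpoly N1 w1 / rpoly D1 w1 = of_rat c * e\<^sup>2" "twist_dense f c"
    using twists[of "rpoly N1 w1 / rpoly D1 w1"] nz by auto
  have e: "e \<noteq> 0" using c nz by auto
  have eq1: "rpoly N1 w1 = of_rat c * e\<^sup>2 * rpoly D1 w1"
    using c nz by (simp add: field_simps)
  have eq2: "rpoly N2 w2 = of_rat c * (l * e)\<^sup>2 * rpoly D2 w2"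
    using eq nz unfolding eq1 by (simp add: field_simps power2_eq_square)
  obtain A E where A: "\<forall>\<^sub>F n in sequentially. poly N1 (A n) = c * (E n)\<^sup>2 * poly D1 (A n)"
    "(\<lambda>n. of_rat (A n)) \<longlonglongrightarrow> w1" "(\<lambda>n. of_rat (E n)) \<longlonglongrightarrow> e"
    using local_model_dense[OF f model(1) c(3,1) eq1 nz(1)] by blast
  obtain B E' where B: "\<forall>\<^sub>F n in sequentially. poly N2 (B n) = c * (E' n)\<^sup>2 * poly D2 (B n)"
    "(\<lambda>n. of_rat (B n)) \<longlonglongrightarrow> w2" "(\<lambda>n. of_rat (E' n)) \<longlonglongrightarrow> l * e"
    using local_model_dense[OF f model(2) c(3,1) eq2 nz(3)] by blast
  have r: "(\<lambda>n. of_rat (E' n / E n)) \<longlonglongrightarrow> l"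
    using lim_divide[OF B(3) A(3) e] e by (simp add: of_rat_divide)
  have ev: "\<forall>\<^sub>F n in sequentially. poly q (xs n) \<noteq> 0"
    if "(\<lambda>n. of_rat (xs n)) \<longlonglongrightarrow> x" "rpoly q x \<noteq> 0" for q xs and x :: 'k
    using tendsto_imp_eventually_ne[OF lim_poly[OF that(1)] that(2)] by simp
  have "\<forall>\<^sub>F n in sequentially. generic_data N1 D1 N2 D2 (A n) (B n) (E' n / E n)
     \<and> dist (of_rat (A n)) w1 < \<epsilon> \<and> dist (of_rat (B n)) w2 < \<epsilon> \<and> dist (of_rat (E' n / E n)) l < \<epsilon>"
    using A(1) B(1) ev[OF A(2) nz(1)] ev[OF A(2) nz(2)] ev[OF B(2) nz(3)] ev[OF B(2) nz(4)]
      tendstoD[OF A(2) \<open>\<epsilon> > 0\<close>] tendstoD[OF B(2) \<open>\<epsilon> > 0\<close>] tendstoD[OF r \<open>\<epsilon> > 0\<close>]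
  proof eventually_elim
    case (elim n)
    then have "E n \<noteq> 0" "E' n \<noteq> 0" by auto
    with elim show ?case
      by (simp add: generic_data_def map_poly_idI field_simps power2_eq_square)
  qed
  then show ?thesis
    using that by (metis (no_types, lifting) eventually_happens' sequentially_bot)
qed

text \<open>If N2(w2) is nonzero the data are already generic. Otherwise \<open>w1\<close> and
  \<open>l\<close> are moved so that \<open>N1\<close> and the ratio become nonzero; the Kummer
  equation then prescribes the value of N2 / D2 at the second coordinate, and \<open>w2\<close>, a
  simple root of \<open>N2\<close>, is moved to attain it.\<close>

lemma (in padic_field) data_dense:
  fixes w1 w2 l :: 'k
  assumes f: "Polynomial.degree f = 3" "coprime f (pderiv f)"
    and twists: "\<And>d :: 'k. d \<noteq> 0 \<Longrightarrow> \<exists>c. c \<noteq> 0 \<and> (\<exists>e :: 'k. d = of_rat c * e\<^sup>2) \<and> twist_dense f c"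
    and model: "local_model f N1 D1" "local_model f N2 D2"
    and nz: "rpoly D1 w1 \<noteq> 0" "rpoly D2 w2 \<noteq> 0"
    and eq: "rpoly N2 w2 * rpoly D1 w1 = l\<^sup>2 * rpoly N1 w1 * rpoly D2 w2" and "\<epsilon> > 0"
  obtains a b r :: rat where "generic_data N1 D1 N2 D2 a b r"
    "dist (of_rat a) w1 < \<epsilon>" "dist (of_rat b) w2 < \<epsilon>" "dist (of_rat r) l < \<epsilon>"
proof -
  have "\<exists>w1' w2' l'. generic_data N1 D1 N2 D2 w1' w2' l' \<and> dist w1' w1 < \<epsilon> / 2 \<and> dist w2' w2 < \<epsilon> / 2 \<and> dist l' l < \<epsilon> / 2"
  proof (cases "rpoly N2 w2 = 0")
    case False
    then have "generic_data N1 D1 N2 D2 w1 w2 l"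
      using eq nz by (auto simp: generic_data_def)
    then show ?thesis using \<open>\<epsilon> > 0\<close> by fastforce
  next
    case True
    have f0: "f \<noteq> 0" using f by auto
    have N1: "map_poly of_rat N1 \<noteq> (0 :: 'k poly)"
      using model f0 by (auto simp: local_model_def)
    have "\<forall>\<^sub>F v in nhds w2. rpoly D2 v \<noteq> 0"
      using tendsto_imp_eventually_ne[OF lim_poly[OF filterlim_ident] nz(2)] by simp
    then obtain \<epsilon>' where \<epsilon>': "\<epsilon>' > 0" "\<And>v. dist v w2 < \<epsilon>' \<Longrightarrow> rpoly D2 v \<noteq> 0"
      unfolding eventually_nhds_metric by blast
    obtain \<delta> where \<delta>: "\<delta> > 0" "\<And>\<theta>. val \<theta> < \<delta> \<Longrightarrow> \<exists>v. dist v w2 < min (\<epsilon> / 2) \<epsilon>' \<and> rpoly N2 v = \<theta> * rpoly D2 v"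
      using ex_perturbed_root[of "map_poly of_rat N2" w2 "min (\<epsilon> / 2) \<epsilon>'" "map_poly of_rat D2"]
        True local_model_simple_root[OF f(2) model(2)] \<epsilon>'(1) \<open>\<epsilon> > 0\<close> by auto
    obtain W where W: "W \<longlonglongrightarrow> w1" "\<forall>\<^sub>F n in sequentially. rpoly N1 (W n) \<noteq> 0"
      using ex_approx_nonroots[OF N1] by blast
    obtain L where L: "L \<longlonglongrightarrow> l" "\<forall>\<^sub>F n in sequentially. poly [:0, 1 :: 'k:] (L n) \<noteq> 0"
      using ex_approx_nonroots[of "[:0, 1 :: 'k:]"] by auto
    \<comment> \<open>The value that N2 / D2 has to take. It tends to 0, since N2(w2) = 0 forces
      \<open>l\<^sup>2 * rpoly N1 w1 = 0\<close>.\<close>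
    define \<theta> where "\<theta> n = (L n)\<^sup>2 * rpoly N1 (W n) / rpoly D1 (W n)" for n
    have "\<theta> \<longlonglongrightarrow> l\<^sup>2 * rpoly N1 w1 / rpoly D1 w1"
      unfolding \<theta>_def by (intro lim_divide lim_mult lim_power lim_poly W L nz)
    also have "l\<^sup>2 * rpoly N1 w1 / rpoly D1 w1 = 0"
      using eq True nz by simp
    finally have \<theta>: "\<theta> \<longlonglongrightarrow> 0" .
    have "\<forall>\<^sub>F n in sequentially. (\<exists>v. generic_data N1 D1 N2 D2 (W n) v (L n) \<and> dist v w2 < \<epsilon> / 2)
      \<and> dist (W n) w1 < \<epsilon> / 2 \<and> dist (L n) l < \<epsilon> / 2"
      using W(2) L(2) tendstoD[OF W(1) half_gt_zero[OF \<open>\<epsilon> > 0\<close>]] tendstoD[OF L(1) half_gt_zero[OF \<open>\<epsilon> > 0\<close>]] tendstoD[OF \<theta> \<delta>(1)]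
        tendsto_imp_eventually_ne[OF lim_poly[OF W(1)] nz(1)]
    proof eventually_elim
      case (elim n)
      obtain v where v: "dist v w2 < min (\<epsilon> / 2) \<epsilon>'" "rpoly N2 v = \<theta> n * rpoly D2 v"
        using \<delta>(2)[of "\<theta> n"] elim by (auto simp: val_def)
      then show ?case
        using elim \<epsilon>'(2)[of v] by (intro conjI exI[of _ v]) (auto simp: generic_data_def \<theta>_def)
    qed
    then obtain n where "(\<exists>v. generic_data N1 D1 N2 D2 (W n) v (L n) \<and> dist v w2 < \<epsilon> / 2)
      \<and> dist (W n) w1 < \<epsilon> / 2 \<and> dist (L n) l < \<epsilon> / 2"
      using eventually_happens' sequentially_bot by blast
    then show ?thesis by blast
  qed
  then obtain w1' w2' l' where *: "generic_data N1 D1 N2 D2 w1' w2' l'"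
    "dist w1' w1 < \<epsilon> / 2" "dist w2' w2 < \<epsilon> / 2" "dist l' l < \<epsilon> / 2" by blast
  obtain a b r :: rat where "generic_data N1 D1 N2 D2 a b r"
    "dist (of_rat a) w1' < \<epsilon> / 2" "dist (of_rat b) w2' < \<epsilon> / 2" "dist (of_rat r) l' < \<epsilon> / 2"
    using generic_data_dense[OF f(1) twists model *(1), of "\<epsilon> / 2"] \<open>\<epsilon> > 0\<close> by auto
  then show ?thesis
    using * dist_triangle[of "of_rat a" w1 w1'] dist_triangle[of "of_rat b" w2 w2'] dist_triangle[of "of_rat r" l l']
    by (intro that[of a b r]) auto
qed

section \<open>Even and odd elements\<close>

text \<open>For \<open>G \<subseteq> A\<close> this is the ideal of \<open>A\<close> generated by
  \<open>G\<close>; for \<open>G\<close> the odd generators it is the odd part of the ring.\<close>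

inductive_set module_span :: "'f :: field_char_0 set \<Rightarrow> 'f set \<Rightarrow> 'f set" for A G where
  zero: "0 \<in> module_span A G"
| step: "m \<in> module_span A G \<Longrightarrow> a \<in> A \<Longrightarrow> g \<in> G \<Longrightarrow> m + a * g \<in> module_span A G"

context subalg
begin

lemma module_span_base: "g \<in> G \<Longrightarrow> g \<in> module_span R G"
  using module_span.step[OF module_span.zero one, of g G] by simp

lemma module_span_add: "m' \<in> module_span R G \<Longrightarrow> m \<in> module_span R G \<Longrightarrow> m + m' \<in> module_span R G"
  by (induction rule: module_span.induct) (auto simp: add.assoc[symmetric] intro: module_span.step)

lemma module_span_mult: "m \<in> module_span R G \<Longrightarrow> a \<in> R \<Longrightarrow> a * m \<in> module_span R G"
proof (induction rule: module_span.induct)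
  case (step m b g)
  then have "a * m + (a * b) * g \<in> module_span R G"
    by (intro module_span.step) auto
  then show ?case by (simp add: algebra_simps)
qed (auto intro: module_span.zero)

lemma module_span_subset: "G \<subseteq> R \<Longrightarrow> module_span R G \<subseteq> R"
proof
  fix x assume "x \<in> module_span R G" "G \<subseteq> R"
  then show "x \<in> R"
    by (induction rule: module_span.induct) auto
qed

lemma module_span_prod:
  assumes G: "\<And>g g'. g \<in> G \<Longrightarrow> g' \<in> G \<Longrightarrow> g * g' \<in> R"
  shows "m \<in> module_span R G \<Longrightarrow> m' \<in> module_span R G \<Longrightarrow> m * m' \<in> R"
proof (induction rule: module_span.induct)
  case (step m a g)
  have "g * m' \<in> R"
    using step.prems
  proof (induction rule: module_span.induct)
    case (step m b g')
    have "g * m + b * (g * g') \<in> R"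
      using step G \<open>g \<in> G\<close> by auto
    then show ?case by (simp add: algebra_simps)
  qed auto
  then have "m * m' + a * (g * m') \<in> R"
    using step by auto
  then show ?case by (simp add: algebra_simps)
qed auto

end

definition products :: "'f :: field_char_0 set \<Rightarrow> 'f set" where
  "products od = {q * q' | q q'. q \<in> od \<and> q' \<in> od}"

text \<open>The degree 0 part when \<open>ev\<close> is given degree 0 and \<open>od\<close> degree
  1 modulo 2; it turns out to be the ring of invariants.\<close>

definition even_part :: "'f :: field_char_0 set \<Rightarrow> 'f set \<Rightarrow> 'f set" where
  "even_part ev od = rat_subalgebra hull (ev \<union> products od)"

lemma subalg_even_part: "subalg (even_part ev od)"
  unfolding even_part_def by (rule subalg_hull)

lemma even_part_gens: "ev \<subseteq> even_part ev od" "products od \<subseteq> even_part ev od"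
  "q \<in> od \<Longrightarrow> q' \<in> od \<Longrightarrow> q * q' \<in> even_part ev od"
  unfolding even_part_def using hull_subset[of "ev \<union> products od" rat_subalgebra] by (auto simp: products_def)

text \<open>A product of two odd elements is even, so the sums of even and odd elements already form
  a ring. That the sum is direct comes later, from the involution.\<close>

lemma even_odd_decomposition:
  assumes "z \<in> rat_subalgebra hull (ev \<union> od)"
  obtains \<alpha> \<beta> where "\<alpha> \<in> even_part ev od" "\<beta> \<in> module_span (even_part ev od) od" "z = \<alpha> + \<beta>"
proof -
  interpret A: subalg "even_part ev od" by (rule subalg_even_part)
  define M where "M = module_span (even_part ev od) od"
  define Z where "Z = {\<alpha> + \<beta> | \<alpha> \<beta>. \<alpha> \<in> even_part ev od \<and> \<beta> \<in> M}"
  have mem: "\<alpha> + \<beta> \<in> Z" if "\<alpha> \<in> even_part ev od" "\<beta> \<in> M" for \<alpha> \<beta>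
    using that by (auto simp: Z_def)
  have M0: "0 \<in> M" unfolding M_def by (rule module_span.zero)
  have "rat_subalgebra Z"
    unfolding rat_subalgebra_def
  proof (intro conjI ballI subsetI)
    fix x :: 'a assume "x \<in> range of_rat"
    then show "x \<in> Z" using mem[of x 0] M0 by auto
  next
    fix u v assume "u \<in> Z" "v \<in> Z"
    then obtain a b c d where *: "a \<in> even_part ev od" "b \<in> M" "c \<in> even_part ev od" "d \<in> M" "u = a + b" "v = c + d"
      by (auto simp: Z_def)
    have "(a + c) + (b + d) \<in> Z"
      using * by (intro mem) (auto simp: M_def intro: A.module_span_add)
    then show "u + v \<in> Z" using * by (simp add: algebra_simps)
    have "b * d \<in> even_part ev od"
      using * A.module_span_prod[of od b d] even_part_gens(3) by (auto simp: M_def)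
    then have "(a * c + b * d) + (a * d + c * b) \<in> Z"
      using * by (intro mem) (auto simp: M_def intro: A.module_span_add A.module_span_mult)
    then show "u * v \<in> Z" using * by (simp add: algebra_simps)
  qed
  moreover have "ev \<union> od \<subseteq> Z"
  proof
    fix z assume "z \<in> ev \<union> od"
    then show "z \<in> Z"
    proof
      assume "z \<in> ev"
      then show ?thesis using mem[of z 0] M0 even_part_gens(1) by auto
    next
      assume "z \<in> od"
      then show ?thesis using mem[of 0 z] A.module_span_base by (auto simp: M_def)
    qed
  qed
  ultimately have "rat_subalgebra hull (ev \<union> od) \<subseteq> Z"
    by (intro hull_minimal)
  then show ?thesis using assms that unfolding Z_def M_def by auto
qed

lemma even_part_subset: "even_part ev od \<subseteq> rat_subalgebra hull (ev \<union> od)"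
proof -
  interpret subalg "rat_subalgebra hull (ev \<union> od)" by (rule subalg_hull)
  show ?thesis unfolding even_part_def
    by (rule hull_le) (auto simp: products_def intro!: mult intro: hull_inc)
qed

lemma module_span_odd_subset: "module_span (even_part ev od) od \<subseteq> rat_subalgebra hull (ev \<union> od)"
proof
  fix x assume "x \<in> module_span (even_part ev od) od"
  then show "x \<in> rat_subalgebra hull (ev \<union> od)"
  proof (induction rule: module_span.induct)
    case zero
    then show ?case using subalg.zero[OF subalg_hull] .
  next
    case (step m a g)
    then show ?case
      using even_part_subset[of ev od] hull_subset[of "ev \<union> od" rat_subalgebra]
      by (intro subalg.add[OF subalg_hull] subalg.mult[OF subalg_hull]) auto
  qed
qed

text \<open>On the two summands \<open>\<sigma>\<close> is 1 and -1, so the odd part of an invariant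
  element satisfies \<open>\<beta> = - \<beta>\<close> and is 0 in characteristic 0.\<close>

lemma invariants_eq_even_part:
  assumes hom: "rat_hom S \<sigma>" and S: "rat_subalgebra hull (ev \<union> od) \<subseteq> S"
    and ev: "\<And>z. z \<in> ev \<Longrightarrow> \<sigma> z = z" and od: "\<And>z. z \<in> od \<Longrightarrow> \<sigma> z = - z"
  shows "invariants \<sigma> (rat_subalgebra hull (ev \<union> od)) = even_part ev od"
proof -
  interpret h: rat_hom "rat_subalgebra hull (ev \<union> od)" \<sigma>
    using rat_hom.restrict[OF hom _ S] by simp
  have gens: "ev \<subseteq> rat_subalgebra hull (ev \<union> od)" "od \<subseteq> rat_subalgebra hull (ev \<union> od)"
    using hull_subset[of "ev \<union> od" rat_subalgebra] by auto
  have fix_even: "\<sigma> \<alpha> = \<alpha>" if "\<alpha> \<in> even_part ev od" for \<alpha>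
  proof -
    have "even_part ev od \<subseteq> {z \<in> rat_subalgebra hull (ev \<union> od). \<sigma> z = z}"
      unfolding even_part_def
    proof (rule hull_minimal)
      show "ev \<union> products od \<subseteq> {z \<in> rat_subalgebra hull (ev \<union> od). \<sigma> z = z}"
        using gens by (auto simp: products_def ev od subset_eq h.h_mult intro!: h.mult)
      show "rat_subalgebra {z \<in> rat_subalgebra hull (ev \<union> od). \<sigma> z = z}"
        by (rule rat_subalgebraI) (auto simp: h.h_add h.h_mult h.add h.mult)
    qed
    then show ?thesis using that by blast
  qed
  have neg_odd: "\<sigma> \<beta> = - \<beta>" if "\<beta> \<in> module_span (even_part ev od) od" for \<beta>
    using that
  proof (induction rule: module_span.induct)
    case (step m a g)
    then have "m \<in> rat_subalgebra hull (ev \<union> od)" "a \<in> rat_subalgebra hull (ev \<union> od)" "g \<in> rat_subalgebra hull (ev \<union> od)"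
      using module_span_odd_subset even_part_subset gens by blast+
    then show ?case
      using step by (simp add: h.h_add h.h_mult h.mult fix_even od)
  qed auto
  show ?thesis
  proof (intro equalityI subsetI)
    fix z assume z: "z \<in> invariants \<sigma> (rat_subalgebra hull (ev \<union> od))"
    then obtain \<alpha> \<beta> where *: "\<alpha> \<in> even_part ev od" "\<beta> \<in> module_span (even_part ev od) od" "z = \<alpha> + \<beta>"
      using even_odd_decomposition[of z ev od] unfolding invariants_def by blast
    have "\<sigma> z = \<alpha> - \<beta>"
      unfolding *(3) using * even_part_subset[of ev od] module_span_odd_subset[of ev od]
      by (subst h.h_add) (auto simp: fix_even neg_odd)
    then have "\<beta> = 0" using z *(3) by (simp add: invariants_def)
    then show "z \<in> even_part ev od" using * by simp
  qed (use even_part_subset[of ev od] fix_even in \<open>auto simp: invariants_def\<close>)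
qed

text \<open>In an even element, every monomial with an odd factor contains a product of two of them
  and lies in the ideal; what remains is a polynomial in the even generators.\<close>

lemma even_part_mod_products:
  assumes "b \<in> even_part ev od"
  obtains e j where "e \<in> rat_subalgebra hull ev" "j \<in> module_span (even_part ev od) (products od)" "b = e + j"
proof -
  interpret A: subalg "even_part ev od" by (rule subalg_even_part)
  interpret E: subalg "rat_subalgebra hull ev" by (rule subalg_hull)
  define J where "J = module_span (even_part ev od) (products od)"
  have E_le: "rat_subalgebra hull ev \<subseteq> even_part ev od"
    by (rule A.hull_le[OF even_part_gens(1)])
  have J_le: "J \<subseteq> even_part ev od"
    unfolding J_def by (rule A.module_span_subset[OF even_part_gens(2)])
  define Z where "Z = {e + j | e j. e \<in> rat_subalgebra hull ev \<and> j \<in> J}"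
  have mem: "e + j \<in> Z" if "e \<in> rat_subalgebra hull ev" "j \<in> J" for e j
    using that by (auto simp: Z_def)
  have J0: "0 \<in> J" unfolding J_def by (rule module_span.zero)
  have "rat_subalgebra Z"
    unfolding rat_subalgebra_def
  proof (intro conjI ballI subsetI)
    fix x :: 'a assume "x \<in> range of_rat"
    then show "x \<in> Z" using mem[of x 0] J0 by auto
  next
    fix u v assume "u \<in> Z" "v \<in> Z"
    then obtain a b c d where *: "a \<in> rat_subalgebra hull ev" "b \<in> J" "c \<in> rat_subalgebra hull ev" "d \<in> J" "u = a + b" "v = c + d"
      by (auto simp: Z_def)
    have "(a + c) + (b + d) \<in> Z"
      using * by (intro mem) (auto simp: J_def intro: A.module_span_add)
    then show "u + v \<in> Z" using * by (simp add: algebra_simps)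
    have "a * c + (a * d + (c + d) * b) \<in> Z"
      using * E_le J_le by (intro mem) (auto simp: J_def intro!: A.module_span_add A.module_span_mult)
    then show "u * v \<in> Z" using * by (simp add: algebra_simps)
  qed
  moreover have "ev \<union> products od \<subseteq> Z"
  proof
    fix z assume "z \<in> ev \<union> products od"
    then show "z \<in> Z"
    proof
      assume "z \<in> ev"
      then show ?thesis using mem[of z 0] J0 hull_inc[of z ev rat_subalgebra] by auto
    next
      assume "z \<in> products od"
      then show ?thesis using mem[of 0 z] A.module_span_base by (auto simp: J_def)
    qed
  qed
  ultimately have "even_part ev od \<subseteq> Z"
    unfolding even_part_def by (intro hull_minimal)
  then show ?thesis using assms that unfolding Z_def J_def by auto
qed

section \<open>Local models of the curve\<close>

text \<open>The generators of the two charts sorted by their sign under -1. At infinity both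
  generators are odd.\<close>

definition chart :: "'f :: field_char_0 \<Rightarrow> 'f \<Rightarrow> 'f set \<Rightarrow> 'f set \<Rightarrow> bool" where
  "chart x y ev od \<longleftrightarrow> ev = {x} \<and> od = {y} \<or> ev = {} \<and> od = {x / y, 1 / y}"

text \<open>A chart with a local model on it: \<open>z\<close> is the even coordinate,
  \<open>s\<close> the odd function, and every odd generator is \<open>s\<close> or
  \<open>s * z\<close>. The chart at infinity has two models, with \<open>s = 1 / y\<close> away
  from the origin of the group and \<open>s = x / y\<close> around it.\<close>

definition chart_model :: "rat poly \<Rightarrow> 'f :: field_char_0 \<Rightarrow> 'f \<Rightarrow> 'f set \<Rightarrow> 'f set \<Rightarrow>
    rat poly \<Rightarrow> rat poly \<Rightarrow> 'f \<Rightarrow> 'f \<Rightarrow> bool" where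
  "chart_model f x y ev od N D z s \<longleftrightarrow>
     ev = {x} \<and> od = {y} \<and> N = f \<and> D = 1 \<and> z = x \<and> s = y \<or>
     ev = {} \<and> od = {x / y, 1 / y} \<and> N = 1 \<and> D = f \<and> z = x \<and> s = 1 / y \<or>
     ev = {} \<and> od = {x / y, 1 / y} \<and> N = [:0, 1:] \<and> D = reflect_poly f \<and> z = inverse x \<and> s = x / y"

lemma elliptic_curve_at_charts:
  "elliptic_curve_at x y = {rat_subalgebra hull (ev \<union> od) | ev od. chart x y ev od}"
proof -
  have "{x, y} = {y, x}" by auto
  then show ?thesis
    by (auto simp: elliptic_curve_at_def chart_def conj_disj_distribL ex_disj_distrib)
qed

lemma product_variety_charts:
  "product_variety (elliptic_curve_at x y) (elliptic_curve_at x' y') =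
     {rat_subalgebra hull ((ev \<union> ev') \<union> (od \<union> od')) | ev od ev' od'. chart x y ev od \<and> chart x' y' ev' od'}"
proof -
  have "rat_subalgebra hull (rat_subalgebra hull (ev \<union> od) \<union> rat_subalgebra hull (ev' \<union> od'))
      = rat_subalgebra hull ((ev \<union> ev') \<union> (od \<union> od'))" for ev od ev' od' :: "ambient set"
  proof -
    have "rat_subalgebra hull (rat_subalgebra hull (ev \<union> od) \<union> rat_subalgebra hull (ev' \<union> od'))
        = rat_subalgebra hull ((ev \<union> od) \<union> (ev' \<union> od'))"
      by (metis hull_Un_left hull_Un_right)
    then show ?thesis by (simp add: Un_ac)
  qed
  then show ?thesis unfolding product_variety_def elliptic_curve_at_charts by blast
qed

section \<open>The function field of the product and its involution\<close>

locale weierstrass =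
  fixes f :: "rat poly"
  assumes cubic: "weierstrass_cubic f"
begin

lemma deg: "Polynomial.degree f = 3" and coprime: "coprime f (pderiv f)" and f0: "f \<noteq> 0"
  using cubic by (auto simp: weierstrass_cubic_def)

lemma ex_coeffs: obtains a b c where "f = [:c, b, a, 1:]"
proof -
  have "f = [:Polynomial.coeff f 0, Polynomial.coeff f 1, Polynomial.coeff f 2, 1:]"
  proof (rule poly_eqI)
    fix n
    have "Polynomial.coeff f 3 = 1"
      using cubic deg unfolding weierstrass_cubic_def by metis
    moreover have "Polynomial.coeff f n = 0" if "n > 3" using that deg by (simp add: coeff_eq_0)
    moreover have "n = 0 \<or> n = 1 \<or> n = 2 \<or> n = 3 \<or> n > 3" by auto
    ultimately show "Polynomial.coeff f n = Polynomial.coeff [:Polynomial.coeff f 0, Polynomial.coeff f 1, Polynomial.coeff f 2, 1:] n"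
      by (auto simp: coeff_pCons numeral_2_eq_2 numeral_3_eq_3 split: nat.splits)
  qed
  then show ?thesis using that by blast
qed

lemma rpoly_reflect_0: "rpoly (reflect_poly f) 0 = (1 :: 'a :: field_char_0)"
proof -
  have "Polynomial.degree (map_poly of_rat f :: 'a poly) = Polynomial.degree f"
    by (rule degree_map_poly) auto
  moreover have "Polynomial.coeff f 3 = 1"
    using cubic deg unfolding weierstrass_cubic_def by metis
  ultimately show ?thesis
    using deg by (simp add: map_poly_of_rat_reflect coeff_map_poly)
qed

abbreviation "y1 \<equiv> gen_y 1 f gen_x1"
abbreviation "y2 \<equiv> gen_y 1 f gen_x2"

lemma y1_sq: "y1\<^sup>2 = rpoly f gen_x1" and y2_sq: "y2\<^sup>2 = rpoly f gen_x2"
  using gen_y_sq[of 1 f gen_x1] gen_y_sq[of 1 f gen_x2] by auto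

sublocale x12: subalg field_x12 by (rule subfield_subalg[OF rat_subfield_x12])

lemma gen_in_x12: "gen_x1 \<in> field_x12" "gen_x2 \<in> field_x12"
  using gen_x1_in gen_x2_in field_x1_subset by auto

lemma rpoly_in_x12: "rpoly q gen_x1 \<in> field_x12" "rpoly q gen_x2 \<in> field_x12"
  using gen_in_x12 by (auto intro: x12.rat_poly)

lemma y_notin: "y1 \<notin> field_x12" "y2 \<notin> field_x12" "y1 * y2 \<notin> field_x12"
  using not_square_x1[of f 1 y1] not_square_x2(1)[of f y2] not_square_x2(2)[of f "y1 * y2"] deg f0 y1_sq y2_sq
  by (auto simp: power_mult_distrib)

lemma y_neq_0: "y1 \<noteq> 0" "y2 \<noteq> 0"
  using y_notin x12.zero by metis+

lemma y2_notin: "y2 \<notin> adjoin_sqrt field_x12 y1"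
  using y_notin rpoly_in_x12 by (intro notin_adjoin_sqrt[OF rat_subfield_x12]) (auto simp: y1_sq y2_sq)

text \<open>A map as in the choice defining \<open>neg_pullback\<close> exists: the identity of
  \<rat>(x1, x2) is extended by sending \<open>y1\<close>, then \<open>y2\<close>, to its negative,
  which has the same square. The second sign is free because \<open>y2\<close> remains irrational
  after \<open>y1\<close> is adjoined.\<close>

lemma neg_pullback_props:
  "rat_alg_hom (square_function_field f) (neg_pullback f) \<and>
     neg_pullback f gen_x1 = gen_x1 \<and> neg_pullback f y1 = - y1 \<and>
     neg_pullback f gen_x2 = gen_x2 \<and> neg_pullback f y2 = - y2"
proof -
  interpret id: local_hom field_x12 "\<lambda>z. z"
    using rat_subfield_x12 by unfold_locales (auto simp: rat_alg_hom_def rat_subfield_def)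
  obtain R h where R: "local_hom R h" "field_x12 \<subseteq> R" "y1 \<in> R" "R \<subseteq> adjoin_sqrt field_x12 y1"
    "\<And>u. u \<in> field_x12 \<Longrightarrow> h u = u" "h y1 = - y1"
    by (rule id.ex_local_adjoin_sqrt[OF rat_subfield_x12, of y1 "- y1"])
       (use y_notin rpoly_in_x12 y1_sq in auto)
  interpret h: local_hom R h by fact
  have sub1: "rat_subfield (adjoin_sqrt field_x12 y1)"
    using rpoly_in_x12 y1_sq by (intro rat_subfield_adjoin_sqrt rat_subfield_x12) auto
  have y2_sq_in: "y2\<^sup>2 \<in> field_x12" using rpoly_in_x12 y2_sq by auto
  obtain S \<sigma> where S: "local_hom S \<sigma>" "R \<subseteq> S" "y2 \<in> S"
    "\<And>u. u \<in> R \<Longrightarrow> \<sigma> u = h u" "\<sigma> y2 = - y2"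
  proof (rule h.ex_local_adjoin_sqrt[OF sub1 R(4) y2_notin, of "- y2"])
    show "y2\<^sup>2 \<in> R" using y2_sq_in R(2) by blast
    show "(- y2)\<^sup>2 = h (y2\<^sup>2)" using R(5)[OF y2_sq_in] by simp
  qed (rule that)
  interpret \<sigma>: local_hom S \<sigma> by fact
  have "adjoin_sqrt (adjoin_sqrt field_x12 y1) y2 \<subseteq> S"
  proof
    fix u assume "u \<in> adjoin_sqrt (adjoin_sqrt field_x12 y1) y2"
    then obtain a b c d where "u = (a + b * y1) + (c + d * y1) * y2"
      "a \<in> field_x12" "b \<in> field_x12" "c \<in> field_x12" "d \<in> field_x12"
      unfolding adjoin_sqrt_def by blast
    then show "u \<in> S"
      using S(2,3) R(2,3) by (simp add: subset_eq) (intro \<sigma>.add \<sigma>.mult; blast)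
  qed
  moreover have "square_function_field f \<subseteq> adjoin_sqrt (adjoin_sqrt field_x12 y1) y2"
    unfolding square_function_field_def
  proof (rule hull_minimal)
    show "rat_subfield (adjoin_sqrt (adjoin_sqrt field_x12 y1) y2)"
      using y2_sq_in adjoin_sqrt_superset[OF rat_subfield_x12]
      by (intro rat_subfield_adjoin_sqrt sub1) auto
    show "{gen_x1, y1, gen_x2, y2} \<subseteq> adjoin_sqrt (adjoin_sqrt field_x12 y1) y2"
      using gen_in_x12 adjoin_sqrt_superset[OF rat_subfield_x12, of y1] adjoin_sqrt_superset[OF sub1, of y2]
      by auto
  qed
  ultimately have "rat_alg_hom (square_function_field f) \<sigma>"
    using \<sigma>.hom unfolding rat_alg_hom_def by blast
  moreover have "\<sigma> u = u" if "u \<in> field_x12" for u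
    using S(4)[OF subsetD[OF R(2) that]] R(5)[OF that] by (rule trans)
  then have "\<sigma> gen_x1 = gen_x1" "\<sigma> gen_x2 = gen_x2"
    using gen_in_x12 by blast+
  moreover have "\<sigma> y1 = - y1"
    using S(4)[OF R(3)] R(6) by (rule trans)
  moreover define P where "P \<sigma>' \<longleftrightarrow> rat_alg_hom (square_function_field f) \<sigma>' \<and>
     \<sigma>' gen_x1 = gen_x1 \<and> \<sigma>' y1 = - y1 \<and> \<sigma>' gen_x2 = gen_x2 \<and> \<sigma>' y2 = - y2" for \<sigma>' :: "ambient \<Rightarrow> ambient"
  ultimately have "P \<sigma>"
    using S(5) unfolding P_def by blast
  then have "P (SOME \<sigma>'. P \<sigma>')"
    by (rule someI[of P])
  then have "P (neg_pullback f)"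
    unfolding neg_pullback_def P_def .
  then show ?thesis
    unfolding P_def .
qed

lemma rat_hom_neg_pullback: "rat_hom (square_function_field f) (neg_pullback f)"
  using neg_pullback_props rat_subfield_hull
  by unfold_locales (auto simp: square_function_field_def rat_subfield_def)

text \<open>Lets statements about charts be proved once for both factors of the product.\<close>

definition factor :: "ambient \<Rightarrow> ambient \<Rightarrow> bool" where
  "factor x y \<longleftrightarrow> (x, y) \<in> {(gen_x1, y1), (gen_x2, y2)}"

lemma factor1: "factor gen_x1 y1" and factor2: "factor gen_x2 y2"
  by (auto simp: factor_def)

lemma factorD:
  assumes "factor x y"
  shows "y\<^sup>2 = rpoly f x" "x \<noteq> 0" "y \<noteq> 0" "x \<in> field_x12" "y \<notin> field_x12"
    "neg_pullback f x = x" "neg_pullback f y = - y" "x \<in> square_function_field f" "y \<in> square_function_field f"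
  using assms y1_sq y2_sq gen_x1_neq_0 gen_x2_neq_0 y_neq_0 gen_in_x12 y_notin neg_pullback_props
  unfolding factor_def square_function_field_def by (auto intro: hull_inc)

lemma chart_sign:
  assumes "factor x y" "chart x y ev od"
  shows "z \<in> ev \<Longrightarrow> neg_pullback f z = z" "z \<in> od \<Longrightarrow> neg_pullback f z = - z"
    "ev \<union> od \<subseteq> square_function_field f"
proof -
  interpret h: rat_hom "square_function_field f" "neg_pullback f" by (rule rat_hom_neg_pullback)
  have F: "rat_subfield (square_function_field f)"
    unfolding square_function_field_def by (rule rat_subfield_hull)
  note x = factorD[OF assms(1)]
  have inv: "inverse y \<in> square_function_field f"
    using F x by (auto simp: rat_subfield_def)
  have [simp]: "neg_pullback f (inverse y) = - inverse y"
    using x inv by (simp add: h.h_inverse)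
  show "z \<in> ev \<Longrightarrow> neg_pullback f z = z" "z \<in> od \<Longrightarrow> neg_pullback f z = - z"
    "ev \<union> od \<subseteq> square_function_field f"
    using assms(2) x inv by (auto simp: chart_def divide_inverse h.h_mult)
qed

lemma invariants_chart:
  assumes "chart gen_x1 y1 ev od" "chart gen_x2 y2 ev' od'"
  shows "invariants (neg_pullback f) (rat_subalgebra hull ((ev \<union> ev') \<union> (od \<union> od'))) = even_part (ev \<union> ev') (od \<union> od')"
proof (rule invariants_eq_even_part[OF rat_hom_neg_pullback])
  interpret h: rat_hom "square_function_field f" "neg_pullback f" by (rule rat_hom_neg_pullback)
  note c = chart_sign[OF factor1 assms(1)] chart_sign[OF factor2 assms(2)]
  show "rat_subalgebra hull ((ev \<union> ev') \<union> (od \<union> od')) \<subseteq> square_function_field f"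
    using c by (intro h.hull_le) auto
qed (use chart_sign[OF factor1 assms(1)] chart_sign[OF factor2 assms(2)] in auto)

text \<open>Irrationality passes from \<open>y\<close> to the odd function \<open>s\<close> through
  \<open>y = k * s\<close> with \<open>k\<close> in \<rat>(x1, x2). The relation between
  \<open>s\<^sup>2\<close> and \<open>z\<close> is the equation of the curve in the model.\<close>

lemma chart_modelD:
  assumes fac: "factor x y" and m: "chart_model f x y ev od N D z s"
  shows "local_model f N D" "s\<^sup>2 * rpoly D z = rpoly N z" "s \<noteq> 0" "s \<in> od" "od \<subseteq> {s, s * z}" "ev \<subseteq> {z}"
    "z \<in> field_x12" "s\<^sup>2 \<in> field_x12" "s \<notin> field_x12" "\<exists>k\<in>field_x12. k \<noteq> 0 \<and> y = k * s"
    "z = x \<or> z = inverse x"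
proof -
  note x = factorD[OF fac]
  have F: "inverse u \<in> field_x12" if "u \<in> field_x12" for u
    using rat_subfield_x12 that by (auto simp: rat_subfield_def)
  have fx: "rpoly f x \<noteq> 0" using x by (metis power_not_zero)
  show model: "local_model f N D" using m by (auto simp: chart_model_def local_model_def)
  have "x\<^sup>2 * (inverse x ^ 3 * rpoly f x) = y\<^sup>2 * inverse x"
    using x by (simp add: power2_eq_square power3_eq_cube field_simps)
  then show "s\<^sup>2 * rpoly D z = rpoly N z"
    using m x fx deg by (auto simp: chart_model_def rpoly_reflect map_poly_pCons power_divide divide_eq_eq)
  show "s \<noteq> 0" "s \<in> od" "od \<subseteq> {s, s * z}" "ev \<subseteq> {z}" "z = x \<or> z = inverse x"
    using m x by (auto simp: chart_model_def)
  show "z \<in> field_x12"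
    using m x F by (auto simp: chart_model_def)
  have y2: "y\<^sup>2 \<in> field_x12" "y\<^sup>2 \<noteq> 0" using x by (auto intro: x12.rat_poly)
  show k: "\<exists>k\<in>field_x12. k \<noteq> 0 \<and> y = k * s"
    using m
    unfolding chart_model_def
  proof (elim disjE conjE)
    assume "s = y" then show ?thesis by (intro bexI[of _ 1]) auto
  next
    assume "s = 1 / y" then show ?thesis
      using y2 x(3) by (intro bexI[of _ "y\<^sup>2"]) (auto simp: power2_eq_square)
  next
    assume "s = x / y" then show ?thesis
      using y2 x(2,3,4) F by (intro bexI[of _ "y\<^sup>2 * inverse x"]) (auto simp: power2_eq_square intro!: x12.mult)
  qed
  then obtain k where k: "k \<in> field_x12" "k \<noteq> 0" "y = k * s" by blast
  then show "s \<notin> field_x12" using x by auto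
  have "s\<^sup>2 = y\<^sup>2 * inverse k * inverse k" using k by (simp add: power2_eq_square field_simps)
  then show "s\<^sup>2 \<in> field_x12" using y2 F k by auto
qed

end

section \<open>Homomorphisms with prescribed coordinates\<close>

context weierstrass
begin

text \<open>The product matters when \<open>s\<close> and \<open>s'\<close> are adjoined in turn,
  the quotient when \<open>s' / s\<close> is adjoined alone.\<close>

lemma chart_model_notin:
  assumes "chart_model f gen_x1 y1 ev od N D z s" "chart_model f gen_x2 y2 ev' od' N' D' z' s'"
  shows "s * s' \<notin> field_x12" "s' / s \<notin> field_x12"
proof -
  note m = chart_modelD[OF factor1 assms(1)] chart_modelD[OF factor2 assms(2)]
  obtain k k' where k: "k \<in> field_x12" "k' \<in> field_x12" "y1 = k * s" "y2 = k' * s'"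
    using m(10,21) by blast
  have "y1 * y2 = (k * k') * (s * s')" using k by simp
  then show ss': "s * s' \<notin> field_x12" using y_notin(3) k x12.mult by metis
  have "s * s' = s' / s * s\<^sup>2" using m(3) by (simp add: power2_eq_square)
  then show "s' / s \<notin> field_x12" using ss' m(8) x12.mult by metis
qed

text \<open>The squares of the odd functions are determined by \<open>z\<close> and
  \<open>z'\<close> as N / D, which makes sense in the local ring because \<open>D\<close> does not
  vanish at the prescribed value.\<close>

lemma ex_local_hom_coordinates:
  fixes w w' :: "'k :: field_char_0"
  assumes "chart_model f gen_x1 y1 ev od N D z s" "chart_model f gen_x2 y2 ev' od' N' D' z' s'"
    and "rpoly D w \<noteq> 0" "rpoly D' w' \<noteq> 0"
  obtains R h where "local_hom R h" "R \<subseteq> field_x12" "z \<in> R" "z' \<in> R" "h z = w" "h z' = w'"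
    "s\<^sup>2 \<in> R" "h (s\<^sup>2) = rpoly N w / rpoly D w" "s'\<^sup>2 \<in> R" "h (s'\<^sup>2) = rpoly N' w' / rpoly D' w'"
proof -
  note m = chart_modelD[OF factor1 assms(1)]
  note m' = chart_modelD[OF factor2 assms(2)]
  obtain R h where R: "local_hom R h" "R \<subseteq> field_x12" "z \<in> R" "z' \<in> R" "h z = w" "h z' = w'"
    by (rule ex_local_hom_x12[OF m(11) m'(11)])
  interpret local_hom R h by fact
  have sq: "t\<^sup>2 \<in> R \<and> h (t\<^sup>2) = rpoly P v / rpoly Q v"
    if t: "t\<^sup>2 * rpoly Q u = rpoly P u" "u \<in> R" "h u = v" "rpoly Q v \<noteq> 0" for t u v P Q
  proof -
    have in_R: "rpoly Q u \<in> R" "rpoly P u \<in> R" using t by (auto intro: rat_poly)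
    have val: "h (rpoly Q u) = rpoly Q v" "h (rpoly P u) = rpoly P v"
      using t by (simp_all add: h_rat_poly)
    then have "rpoly Q u \<noteq> 0" using t by auto
    then have "t\<^sup>2 = rpoly P u / rpoly Q u" using t by (simp add: field_simps)
    then show ?thesis
      using divide_closed[OF in_R(2,1)] h_divide[OF in_R(2,1)] val t(4) by simp
  qed
  show ?thesis
    by (rule that[OF R]) (use sq[OF m(2) R(3,5) assms(3)] sq[OF m'(2) R(4,6) assms(4)] in auto)
qed

text \<open>Points over pairs of two-torsion points: both odd functions are square roots of
  functions vanishing there and receive the value 0.\<close>

lemma ex_special_hom:
  fixes w w' :: "'k :: field_char_0"
  assumes c: "chart_model f gen_x1 y1 ev od N D z s" "chart_model f gen_x2 y2 ev' od' N' D' z' s'"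
    and D: "rpoly D w \<noteq> 0" "rpoly D' w' \<noteq> 0" and root: "rpoly N w = 0" "rpoly N' w' = 0"
  obtains R h where "local_hom R h" "z \<in> R" "z' \<in> R" "s \<in> R" "s' \<in> R"
    "h z = w" "h z' = w'" "h s = 0" "h s' = 0"
proof -
  note m = chart_modelD[OF factor1 c(1)]
  note m' = chart_modelD[OF factor2 c(2)]
  obtain R0 h0 where R0: "local_hom R0 h0" "R0 \<subseteq> field_x12" "z \<in> R0" "z' \<in> R0" "h0 z = w" "h0 z' = w'"
    "s\<^sup>2 \<in> R0" "h0 (s\<^sup>2) = rpoly N w / rpoly D w" "s'\<^sup>2 \<in> R0" "h0 (s'\<^sup>2) = rpoly N' w' / rpoly D' w'"
    by (rule ex_local_hom_coordinates[OF c D])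
  interpret h0: local_hom R0 h0 by fact
  obtain R1 h1 where R1: "local_hom R1 h1" "R0 \<subseteq> R1" "s \<in> R1" "R1 \<subseteq> adjoin_sqrt field_x12 s"
    "\<And>u. u \<in> R0 \<Longrightarrow> h1 u = h0 u" "h1 s = 0"
  proof (rule h0.ex_local_adjoin_sqrt[OF rat_subfield_x12 R0(2) m(9) R0(7), of 0])
    show "0\<^sup>2 = h0 (s\<^sup>2)" using R0(8) root by simp
  qed (rule that)
  interpret h1: local_hom R1 h1 by fact
  have K: "rat_subfield (adjoin_sqrt field_x12 s)"
    by (rule rat_subfield_adjoin_sqrt[OF rat_subfield_x12 m(8)])
  have notin: "s' \<notin> adjoin_sqrt field_x12 s"
    by (rule notin_adjoin_sqrt[OF rat_subfield_x12 m(8,9) m'(8,9) chart_model_notin(1)[OF c]])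
  obtain R2 h2 where R2: "local_hom R2 h2" "R1 \<subseteq> R2" "s' \<in> R2"
    "\<And>u. u \<in> R1 \<Longrightarrow> h2 u = h1 u" "h2 s' = 0"
  proof (rule h1.ex_local_adjoin_sqrt[OF K R1(4) notin, of 0])
    show "s'\<^sup>2 \<in> R1" using R0(9) R1(2) by blast
    show "0\<^sup>2 = h1 (s'\<^sup>2)" using R0(10) R1(5)[OF R0(9)] root by simp
  qed (rule that)
  have *: "u \<in> R2 \<and> h2 u = h0 u" if "u \<in> R0" for u
    using that R1(2,5) R2(2,4) by (metis subsetD)
  show ?thesis
  proof (rule that[OF R2(1)])
    show "s \<in> R2" "h2 s = 0" using R1 R2 by (auto simp: subset_eq)
    show "s' \<in> R2" "h2 s' = 0" by fact+
    show "z \<in> R2" "z' \<in> R2" "h2 z = w" "h2 z' = w'"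
      using *[OF R0(3)] *[OF R0(4)] R0(5,6) by auto
  qed
qed

text \<open>A point of the quotient away from the two-torsion. Values of \<open>s\<close> and
  \<open>s'\<close> would be square roots that need not exist in the target field, whereas the
  square of their ratio has the value \<open>l\<^sup>2\<close>; so \<open>s' / s\<close> is adjoined
  alone.\<close>

lemma ex_generic_hom:
  fixes w w' l :: "'k :: field_char_0"
  assumes c: "chart_model f gen_x1 y1 ev od N D z s" "chart_model f gen_x2 y2 ev' od' N' D' z' s'"
    and gen: "generic_data N D N' D' w w' l"
  obtains R h where "local_hom R h" "z \<in> R" "z' \<in> R" "s' / s \<in> R" "s\<^sup>2 \<in> R"
    "h z = w" "h z' = w'" "h (s' / s) = l"
proof -
  have nz: "rpoly N w \<noteq> 0" "rpoly D w \<noteq> 0" "rpoly N' w' \<noteq> 0" "rpoly D' w' \<noteq> 0"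
    and eq: "rpoly N' w' * rpoly D w = l\<^sup>2 * rpoly N w * rpoly D' w'"
    using gen by (auto simp: generic_data_def)
  obtain R0 h0 where R0: "local_hom R0 h0" "R0 \<subseteq> field_x12" "z \<in> R0" "z' \<in> R0" "h0 z = w" "h0 z' = w'"
    "s\<^sup>2 \<in> R0" "h0 (s\<^sup>2) = rpoly N w / rpoly D w" "s'\<^sup>2 \<in> R0" "h0 (s'\<^sup>2) = rpoly N' w' / rpoly D' w'"
    by (rule ex_local_hom_coordinates[OF c nz(2,4)])
  interpret h0: local_hom R0 h0 by fact
  have s_nz: "h0 (s\<^sup>2) \<noteq> 0" using R0(8) nz by simp
  obtain R1 h1 where R1: "local_hom R1 h1" "R0 \<subseteq> R1" "s' / s \<in> R1"
    "\<And>u. u \<in> R0 \<Longrightarrow> h1 u = h0 u" "h1 (s' / s) = l"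
  proof (rule h0.ex_local_adjoin_sqrt[OF rat_subfield_x12 R0(2) chart_model_notin(2)[OF c], of l])
    show "(s' / s)\<^sup>2 \<in> R0"
      unfolding power_divide using R0(7,9) s_nz by (intro h0.divide_closed)
    show "l\<^sup>2 = h0 ((s' / s)\<^sup>2)"
      unfolding power_divide h0.h_divide[OF R0(9,7) s_nz] R0(8,10)
      using nz eq by (simp add: field_simps)
  qed (rule that)
  show ?thesis
    by (rule that[OF R1(1)]) (use R0 R1(2-) in \<open>auto simp: subset_eq\<close>)
qed

section \<open>The ideal of the image of the two-torsion subgroup\<close>

text \<open>Values of \<open>x\<close> at the two-torsion points of a chart. The chart at infinity
  contains only the origin among them and has no even generator; the dummy value 0 makes it a grid
  direction with a single node.\<close>

definition special_values :: "ambient set \<Rightarrow> complex set" where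
  "special_values ev = (if ev = {} then {0} else {\<alpha>. rpoly f \<alpha> = 0})"

lemma card_complex_roots: "card {\<alpha> :: complex. rpoly f \<alpha> = 0} = 3"
proof -
  define g :: "complex poly" where "g = map_poly of_rat f"
  have g: "Polynomial.degree g = 3" "g \<noteq> 0"
    using deg f0 by (simp_all add: g_def degree_map_poly)
  have "rsquarefree g"
    unfolding rsquarefree_roots g_def using rpoly_pderiv_nonzero[OF coprime] by blast
  then have "Polynomial.smult (Polynomial.lead_coeff g) (\<Prod>z | poly g z = 0. [:- z, 1:]) = g"
    by (rule complex_poly_decompose_rsquarefree)
  then have "Polynomial.degree g = Polynomial.degree (\<Prod>z | poly g z = 0. [:- z, 1:])"
    using g(2) by (metis degree_smult_eq leading_coeff_0_iff)
  also have "\<dots> = (\<Sum>z | poly g z = 0. Polynomial.degree [:- z, 1:])"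
    by (rule degree_prod_eq_sum_degree) auto
  also have "\<dots> = card {z. poly g z = 0}" by simp
  finally show ?thesis using g by (simp add: g_def)
qed

text \<open>A polynomial of degree at most 2 with three distinct roots is 0. At infinity only
  \<open>u0\<close> is left, and it is read off at the dummy value.\<close>

lemma quadratic_vanishing:
  assumes "\<And>\<alpha>. \<alpha> \<in> special_values ev \<Longrightarrow> u0 + u1 * \<alpha> + u2 * \<alpha>\<^sup>2 = 0" and "ev = {} \<Longrightarrow> u1 = 0 \<and> u2 = 0"
  shows "u0 = 0 \<and> u1 = 0 \<and> u2 = 0"
proof (cases "ev = {}")
  case True
  then show ?thesis using assms by (auto simp: special_values_def)
next
  case False
  have "[:u0, u1, u2:] = 0"
  proof (rule ccontr)
    assume nz: "[:u0, u1, u2:] \<noteq> 0"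
    have "{\<alpha>. rpoly f \<alpha> = 0} \<subseteq> {\<alpha>. poly [:u0, u1, u2:] \<alpha> = 0}"
      using assms(1) False by (auto simp: special_values_def power2_eq_square algebra_simps)
    then have "3 \<le> card {\<alpha>. poly [:u0, u1, u2:] \<alpha> = 0}"
      using card_mono[OF poly_roots_finite[OF nz]] card_complex_roots by metis
    also have "\<dots> \<le> Polynomial.degree [:u0, u1, u2:]"
      by (rule card_poly_roots_bound[OF nz])
    also have "\<dots> \<le> 2" by (simp add: degree_pCons_eq_if)
    finally show False by simp
  qed
  then show ?thesis by simp
qed

lemma ex_special_model:
  assumes "chart x y ev od" "\<alpha> \<in> special_values ev"
  obtains N D z s w where "chart_model f x y ev od N D z s" "rpoly D w \<noteq> 0" "rpoly N w = (0 :: complex)"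
    "\<And>u. u \<in> ev \<Longrightarrow> u = z \<and> w = \<alpha>"
proof -
  from assms(1) consider "ev = {x}" "od = {y}" | "ev = {}" "od = {x / y, 1 / y}"
    by (auto simp: chart_def)
  then show ?thesis
  proof cases
    case 1
    then show ?thesis
      using assms(2) by (intro that[of f 1 x y \<alpha>]) (auto simp: chart_model_def special_values_def)
  next
    case 2
    then show ?thesis
      using rpoly_reflect_0[where 'a = complex] by (intro that[of "[:0, 1:]" "reflect_poly f" "inverse x" "x / y" 0])
        (auto simp: chart_model_def map_poly_pCons)
  qed
qed

text \<open>Supplies the complex points against which the ideal is tested: they kill the odd
  generators and realise every node of the grid.\<close>

lemma ex_two_torsion_hom:
  assumes c: "chart gen_x1 y1 ev od" "chart gen_x2 y2 ev' od'"
    and \<alpha>: "\<alpha> \<in> special_values ev" "\<alpha>' \<in> special_values ev'"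
  obtains h where "rat_hom (rat_subalgebra hull ((ev \<union> ev') \<union> (od \<union> od'))) h"
    "\<And>u. u \<in> ev \<Longrightarrow> h u = \<alpha>" "\<And>u. u \<in> ev' \<Longrightarrow> h u = \<alpha>'" "\<And>u. u \<in> od \<union> od' \<Longrightarrow> h u = 0"
proof -
  obtain N D z s w where m: "chart_model f gen_x1 y1 ev od N D z s" "rpoly D w \<noteq> 0" "rpoly N w = (0 :: complex)"
    "\<And>u. u \<in> ev \<Longrightarrow> u = z \<and> w = \<alpha>"
    by (rule ex_special_model[OF c(1) \<alpha>(1)]) (rule that)
  obtain N' D' z' s' w' where m': "chart_model f gen_x2 y2 ev' od' N' D' z' s'" "rpoly D' w' \<noteq> 0" "rpoly N' w' = (0 :: complex)"
    "\<And>u. u \<in> ev' \<Longrightarrow> u = z' \<and> w' = \<alpha>'"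
    by (rule ex_special_model[OF c(2) \<alpha>(2)]) (rule that)
  obtain R h where R: "local_hom R h" "z \<in> R" "z' \<in> R" "s \<in> R" "s' \<in> R"
    "h z = w" "h z' = w'" "h s = 0" "h s' = 0"
    by (rule ex_special_hom[OF m(1) m'(1) m(2) m'(2) m(3) m'(3)])
  interpret local_hom R h by fact
  have od: "u \<in> R \<and> h u = 0" if "u \<in> od \<union> od'" for u
    using that R chart_modelD(5)[OF factor1 m(1)] chart_modelD(5)[OF factor2 m'(1)]
    by (auto simp: h_mult mult dest!: subsetD)
  have ev: "u \<in> R \<and> h u = \<alpha>" if "u \<in> ev" for u
    using m(4)[OF that] R by simp
  have ev': "u \<in> R \<and> h u = \<alpha>'" if "u \<in> ev'" for u
    using m'(4)[OF that] R by simp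
  show ?thesis
  proof (rule that[of h])
    show "rat_hom (rat_subalgebra hull ((ev \<union> ev') \<union> (od \<union> od'))) h"
      using od ev ev' by (intro restrict rat_subalgebra_hull hull_le) blast
  qed (use od ev ev' in auto)
qed

end

text \<open>Division with remainder by a monic cubic that lies in the ideal, for polynomials in
  \<open>x\<close> over \<open>A0\<close>.\<close>

lemma (in subalg) reduce_mod_cubic:
  fixes x :: 'f
  assumes A0: "subalg A0" "A0 \<subseteq> R" and x: "x \<in> R" and G: "G \<subseteq> R"
    and cubic: "rpoly [:c, b, a, 1:] x \<in> module_span R G" and e: "e \<in> rat_subalgebra hull (insert x A0)"
  shows "\<exists>a0\<in>A0. \<exists>a1\<in>A0. \<exists>a2\<in>A0. \<exists>j\<in>module_span R G. e = a0 + a1 * x + a2 * x\<^sup>2 + j"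
proof -
  interpret A0: subalg A0 by fact
  define J where "J = module_span R G"
  have J_add: "j + j' \<in> J" if "j \<in> J" "j' \<in> J" for j j'
    using that unfolding J_def by (intro module_span_add)
  have J_mult: "r * j \<in> J" if "j \<in> J" "r \<in> R" for j r
    using that unfolding J_def by (intro module_span_mult)
  have J0: "0 \<in> J" unfolding J_def by (rule module_span.zero)
  have J_le: "J \<subseteq> R" unfolding J_def by (rule module_span_subset[OF G])
  define g where "g = rpoly [:c, b, a, 1:] x"
  have g: "g \<in> J" using cubic by (simp add: g_def J_def)
  define Z where "Z = {a0 + a1 * x + a2 * x\<^sup>2 + j | a0 a1 a2 j. a0 \<in> A0 \<and> a1 \<in> A0 \<and> a2 \<in> A0 \<and> j \<in> J}"
  have mem: "a0 + a1 * x + a2 * x\<^sup>2 + j \<in> Z" if "a0 \<in> A0" "a1 \<in> A0" "a2 \<in> A0" "j \<in> J" for a0 a1 a2 j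
    using that by (auto simp: Z_def)
  have Z_add: "u + v \<in> Z" if "u \<in> Z" "v \<in> Z" for u v
  proof -
    from that obtain a0 a1 a2 j b0 b1 b2 k where *: "a0 \<in> A0" "a1 \<in> A0" "a2 \<in> A0" "j \<in> J"
      "b0 \<in> A0" "b1 \<in> A0" "b2 \<in> A0" "k \<in> J" "u = a0 + a1 * x + a2 * x\<^sup>2 + j" "v = b0 + b1 * x + b2 * x\<^sup>2 + k"
      unfolding Z_def by blast
    have "(a0 + b0) + (a1 + b1) * x + (a2 + b2) * x\<^sup>2 + (j + k) \<in> Z"
      using * by (intro mem A0.add J_add)
    then show ?thesis using * by (simp add: algebra_simps)
  qed
  have Z_x: "x * u \<in> Z" if "u \<in> Z" for u
  proof -
    from that obtain a0 a1 a2 j where *: "a0 \<in> A0" "a1 \<in> A0" "a2 \<in> A0" "j \<in> J" "u = a0 + a1 * x + a2 * x\<^sup>2 + j"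
      unfolding Z_def by blast
    \<comment> \<open>The term \<open>a2 * x ^ 3\<close> is replaced using
      \<open>x ^ 3 = g - a * x\<^sup>2 - b * x - c\<close>.\<close>
    have "(- of_rat c * a2) + (a0 - of_rat b * a2) * x + (a1 - of_rat a * a2) * x\<^sup>2 + (x * j + a2 * g) \<in> Z"
      using * g x A0(2) by (intro mem J_add J_mult A0.add A0.diff A0.mult A0.uminus A0.of_rat) auto
    moreover have "x * u = (- of_rat c * a2) + (a0 - of_rat b * a2) * x + (a1 - of_rat a * a2) * x\<^sup>2 + (x * j + a2 * g)"
      unfolding *(5) g_def by (simp add: map_poly_pCons algebra_simps power2_eq_square)
    ultimately show ?thesis by simp
  qed
  have Z_A0: "r * u \<in> Z" if "u \<in> Z" "r \<in> A0" for r u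
  proof -
    from that obtain a0 a1 a2 j where *: "a0 \<in> A0" "a1 \<in> A0" "a2 \<in> A0" "j \<in> J" "u = a0 + a1 * x + a2 * x\<^sup>2 + j"
      unfolding Z_def by blast
    have "(r * a0) + (r * a1) * x + (r * a2) * x\<^sup>2 + r * j \<in> Z"
      using * that A0(2) by (intro mem J_mult A0.mult) auto
    then show ?thesis using * by (simp add: algebra_simps)
  qed
  have Z_J: "j \<in> Z" if "j \<in> J" for j
    using mem[OF A0.zero A0.zero A0.zero that] by simp
  have Z_base: "r \<in> Z" if "r \<in> A0" for r
    using mem[OF that A0.zero A0.zero J0] by simp
  have Z_R: "u \<in> R" if "u \<in> Z" for u
    using that x A0(2) J_le unfolding Z_def by (blast intro: add mult power)
  have "rat_subalgebra Z"
  proof (rule rat_subalgebraI)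
    show "of_rat q \<in> Z" for q by (intro Z_base A0.of_rat)
    fix u v assume uv: "u \<in> Z" "v \<in> Z"
    then show "u + v \<in> Z" by (rule Z_add)
    from uv(1) obtain a0 a1 a2 j where *: "a0 \<in> A0" "a1 \<in> A0" "a2 \<in> A0" "j \<in> J" "u = a0 + a1 * x + a2 * x\<^sup>2 + j"
      unfolding Z_def by blast
    have "v * j \<in> Z" using * uv by (blast intro: Z_J J_mult Z_R)
    then have "a0 * v + x * (a1 * v) + x * (x * (a2 * v)) + v * j \<in> Z"
      using Z_add[OF Z_add[OF Z_add[OF Z_A0[OF uv(2) *(1)] Z_x[OF Z_A0[OF uv(2) *(2)]]]
          Z_x[OF Z_x[OF Z_A0[OF uv(2) *(3)]]]]] by blast
    then show "u * v \<in> Z" using * by (simp add: algebra_simps power2_eq_square)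
  qed
  moreover have "x \<in> Z" using mem[OF A0.zero A0.one A0.zero J0] by simp
  then have "insert x A0 \<subseteq> Z" using Z_base by blast
  ultimately have "rat_subalgebra hull (insert x A0) \<subseteq> Z"
    by (intro hull_minimal)
  then show ?thesis using e unfolding Z_def J_def by blast
qed

context weierstrass
begin

text \<open>\<open>y\<^sup>2\<close> is a product of two odd generators, so the monic cubic f(x)
  lies in the ideal. In the chart at infinity there is nothing to reduce and \<open>e\<close> is its
  own constant term.\<close>

lemma reduce_chart:
  assumes c: "factor x y" "chart x y ev od" and sub: "ev \<subseteq> EV" "od \<subseteq> OD"
    and A0: "subalg A0" "A0 \<subseteq> even_part EV OD" and e: "e \<in> rat_subalgebra hull (ev \<union> A0)"
  shows "\<exists>a0\<in>A0. \<exists>a1\<in>A0. \<exists>a2\<in>A0. \<exists>j\<in>module_span (even_part EV OD) (products OD).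
    e = a0 + a1 * x + a2 * x\<^sup>2 + j \<and> (ev = {} \<longrightarrow> a1 = 0 \<and> a2 = 0)"
proof -
  interpret A: subalg "even_part EV OD" by (rule subalg_even_part)
  interpret A0: subalg A0 by fact
  from c(2) consider "ev = {x}" "od = {y}" | "ev = {}" "od = {x / y, 1 / y}"
    by (auto simp: chart_def)
  then show ?thesis
  proof cases
    case 1
    obtain a b c' where f: "f = [:c', b, a, 1:]" by (rule ex_coeffs)
    have "y * y \<in> products OD" using 1 sub by (auto simp: products_def)
    then have "rpoly f x \<in> module_span (even_part EV OD) (products OD)"
      using factorD(1)[OF c(1)] A.module_span_base[of "y * y" "products OD"] by (simp add: power2_eq_square)
    moreover have "x \<in> even_part EV OD"
      using 1 sub even_part_gens(1)[of EV OD] by auto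
    ultimately show ?thesis
      using A.reduce_mod_cubic[OF A0 _ even_part_gens(2), of x c' b a e] e 1 f by simp
  next
    case 2
    then have "e \<in> A0" using e hull_same[of rat_subalgebra A0] A0.sub by simp
    then show ?thesis
      using 2 module_span.zero[of "even_part EV OD" "products OD"] A0.zero
      by (intro bexI[of _ e] bexI[of _ 0]) auto
  qed
qed

text \<open>The reduction is done in \<open>x1\<close> over polynomials in \<open>x2\<close>, then
  in \<open>x2\<close> for each of the three coefficients, which leaves nine rational numbers.
  Evaluation at the two-torsion points and interpolation in one variable after the other show that
  all nine vanish.\<close>

lemma two_torsion_image_ideal_subset:
  assumes c: "chart gen_x1 y1 ev od" "chart gen_x2 y2 ev' od'"
  shows "two_torsion_image_ideal (neg_pullback f) (rat_subalgebra hull ((ev \<union> ev') \<union> (od \<union> od')))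
    \<subseteq> module_span (even_part (ev \<union> ev') (od \<union> od')) (products (od \<union> od'))"
proof
  define S where "S = rat_subalgebra hull ((ev \<union> ev') \<union> (od \<union> od'))"
  define A where "A = even_part (ev \<union> ev') (od \<union> od')"
  define J where "J = module_span A (products (od \<union> od'))"
  interpret A: subalg A unfolding A_def by (rule subalg_even_part)
  interpret \<sigma>: rat_hom "square_function_field f" "neg_pullback f" by (rule rat_hom_neg_pullback)
  note sg = chart_sign[OF factor1 c(1)] chart_sign[OF factor2 c(2)]
  have S_sub: "S \<subseteq> square_function_field f"
    unfolding S_def using sg(3,6) by (intro \<sigma>.hull_le) blast
  have gens: "ev \<union> ev' \<subseteq> S" "od \<union> od' \<subseteq> S"
    unfolding S_def by (auto intro: hull_inc)
  have A_S: "A \<subseteq> S" unfolding A_def S_def by (rule even_part_subset)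
  have J_A: "J \<subseteq> A" unfolding J_def by (rule A.module_span_subset) (use even_part_gens(2) in \<open>auto simp: A_def\<close>)
  fix b assume "b \<in> two_torsion_image_ideal (neg_pullback f) (rat_subalgebra hull ((ev \<union> ev') \<union> (od \<union> od')))"
  then have b: "b \<in> A" and van: "\<And>h :: ambient \<Rightarrow> complex. rat_alg_hom S h \<Longrightarrow> \<forall>z\<in>S. h (neg_pullback f z) = h z \<Longrightarrow> h b = 0"
    unfolding two_torsion_image_ideal_def invariants_chart[OF c] by (auto simp: A_def S_def)
  obtain e j where ej: "e \<in> rat_subalgebra hull (ev \<union> ev')" "j \<in> J" "b = e + j"
    using even_part_mod_products[of b "ev \<union> ev'" "od \<union> od'"] b unfolding A_def J_def by blast
  define A2 where "A2 = rat_subalgebra hull ev'"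
  interpret A2: subalg A2 unfolding A2_def by (rule subalg_hull)
  have A2_A: "A2 \<subseteq> A"
    unfolding A2_def by (rule A.hull_le) (use even_part_gens(1)[of "ev \<union> ev'" "od \<union> od'"] in \<open>auto simp: A_def\<close>)
  have "e \<in> rat_subalgebra hull (ev \<union> A2)"
    using ej(1) unfolding A2_def by (simp flip: hull_Un_right)
  then obtain a0 a1 a2 j1 where a: "a0 \<in> A2" "a1 \<in> A2" "a2 \<in> A2" "j1 \<in> J"
    "e = a0 + a1 * gen_x1 + a2 * gen_x1\<^sup>2 + j1" "ev = {} \<longrightarrow> a1 = 0 \<and> a2 = 0"
    using reduce_chart[OF factor1 c(1) _ _ A2.subalg_axioms, of "ev \<union> ev'" "od \<union> od'" e] A2_A
    unfolding A_def J_def by blast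
  \<comment> \<open>The clause for \<open>u = 0\<close> selects the zero representation. When
    \<open>ev\<close> is empty, \<open>a1\<close> and \<open>a2\<close> are 0, and the interpolation
    in \<open>x1\<close> needs their coefficients to be 0 as well.\<close>
  have red2: "\<exists>r0 r1 r2. \<exists>j\<in>J. u = of_rat r0 + of_rat r1 * gen_x2 + of_rat r2 * gen_x2\<^sup>2 + j \<and> (ev' = {} \<longrightarrow> r1 = 0 \<and> r2 = 0)
      \<and> (u = 0 \<longrightarrow> r0 = 0 \<and> r1 = 0 \<and> r2 = 0)"
    if "u \<in> A2" for u
  proof (cases "u = 0")
    case True
    then show ?thesis
      using module_span.zero[of A "products (od \<union> od')"] unfolding J_def
      by (intro exI[of _ 0] bexI[of _ 0]) auto
  next
    case False
    have Q: "subalg (range of_rat :: ambient set)"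
      by unfold_locales (rule rat_subalgebra_range_of_rat)
    have QA: "range of_rat \<subseteq> even_part (ev \<union> ev') (od \<union> od')"
      using A.of_rat unfolding A_def by blast
    have "u \<in> rat_subalgebra hull (ev' \<union> range of_rat)"
      using that hull_mono[of ev' "ev' \<union> range of_rat" rat_subalgebra] unfolding A2_def by blast
    from reduce_chart[OF factor2 c(2) _ _ Q QA this] obtain q0 q1 q2 j where
      *: "q0 \<in> range of_rat" "q1 \<in> range of_rat" "q2 \<in> range of_rat" "j \<in> J"
      "u = q0 + q1 * gen_x2 + q2 * gen_x2\<^sup>2 + j" "ev' = {} \<longrightarrow> q1 = 0 \<and> q2 = 0"
      unfolding A_def J_def by blast
    then obtain r0 r1 r2 where "q0 = of_rat r0" "q1 = of_rat r1" "q2 = of_rat r2" by blast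
    with * False show ?thesis by (intro exI[of _ r0] exI[of _ r1] exI[of _ r2] bexI[of _ j]) auto
  qed
  obtain p0 p1 p2 k0 where p: "k0 \<in> J" "a0 = of_rat p0 + of_rat p1 * gen_x2 + of_rat p2 * gen_x2\<^sup>2 + k0"
    "ev' = {} \<longrightarrow> p1 = 0 \<and> p2 = 0" "a0 = 0 \<longrightarrow> p0 = 0 \<and> p1 = 0 \<and> p2 = 0" using red2[OF a(1)] by blast
  obtain q0 q1 q2 k1 where q: "k1 \<in> J" "a1 = of_rat q0 + of_rat q1 * gen_x2 + of_rat q2 * gen_x2\<^sup>2 + k1"
    "ev' = {} \<longrightarrow> q1 = 0 \<and> q2 = 0" "a1 = 0 \<longrightarrow> q0 = 0 \<and> q1 = 0 \<and> q2 = 0" using red2[OF a(2)] by blast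
  obtain r0 r1 r2 k2 where r: "k2 \<in> J" "a2 = of_rat r0 + of_rat r1 * gen_x2 + of_rat r2 * gen_x2\<^sup>2 + k2"
    "ev' = {} \<longrightarrow> r1 = 0 \<and> r2 = 0" "a2 = 0 \<longrightarrow> r0 = 0 \<and> r1 = 0 \<and> r2 = 0" using red2[OF a(3)] by blast
  define val where "val c0 c1 c2 (\<beta> :: complex) = of_rat c0 + of_rat c1 * \<beta> + of_rat c2 * \<beta>\<^sup>2" for c0 c1 c2 :: rat and \<beta>
  have grid: "val p0 p1 p2 \<beta> + val q0 q1 q2 \<beta> * \<alpha> + val r0 r1 r2 \<beta> * \<alpha>\<^sup>2 = 0"
    if \<alpha>: "\<alpha> \<in> special_values ev" and \<beta>: "\<beta> \<in> special_values ev'" for \<alpha> \<beta>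
  proof -
    obtain h where h: "rat_hom S h" "\<And>u. u \<in> ev \<Longrightarrow> h u = \<alpha>" "\<And>u. u \<in> ev' \<Longrightarrow> h u = \<beta>" "\<And>u. u \<in> od \<union> od' \<Longrightarrow> h u = 0"
      using ex_two_torsion_hom[OF c \<alpha> \<beta>] unfolding S_def by blast
    interpret h: rat_hom S h by fact
    \<comment> \<open>That \<open>h\<close> is a fixed point of -1 is checked on generators: even
      ones are fixed, odd ones change sign and have value 0. Membership of the image in
      \<open>S\<close> is carried along so that the condition is preserved by sums and
      products.\<close>
    have "S \<subseteq> {z \<in> S. neg_pullback f z \<in> S \<and> h (neg_pullback f z) = h z}"
      unfolding S_def
    proof (rule hull_minimal, fold S_def)
      show "ev \<union> ev' \<union> (od \<union> od') \<subseteq> {z \<in> S. neg_pullback f z \<in> S \<and> h (neg_pullback f z) = h z}"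
      proof
        fix z assume z: "z \<in> ev \<union> ev' \<union> (od \<union> od')"
        then have "z \<in> S" using gens by blast
        moreover have "neg_pullback f z = z \<or> neg_pullback f z = - z \<and> h z = 0"
          using z sg(1,2,4,5) h(4) by blast
        ultimately show "z \<in> {z \<in> S. neg_pullback f z \<in> S \<and> h (neg_pullback f z) = h z}"
          using h.h_uminus[of z] h.uminus[of z] by auto
      qed
      show "rat_subalgebra {z \<in> S. neg_pullback f z \<in> S \<and> h (neg_pullback f z) = h z}"
      proof (rule rat_subalgebraI)
        fix u v assume "u \<in> {z \<in> S. neg_pullback f z \<in> S \<and> h (neg_pullback f z) = h z}"
          "v \<in> {z \<in> S. neg_pullback f z \<in> S \<and> h (neg_pullback f z) = h z}"
        then have *: "u \<in> S" "neg_pullback f u \<in> S" "h (neg_pullback f u) = h u"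
          "v \<in> S" "neg_pullback f v \<in> S" "h (neg_pullback f v) = h v" by simp_all
        then have F: "u \<in> square_function_field f" "v \<in> square_function_field f" using S_sub by blast+
        show "u + v \<in> {z \<in> S. neg_pullback f z \<in> S \<and> h (neg_pullback f z) = h z}"
          using * F by (simp add: \<sigma>.h_add h.h_add h.add)
        show "u * v \<in> {z \<in> S. neg_pullback f z \<in> S \<and> h (neg_pullback f z) = h z}"
          using * F by (simp add: \<sigma>.h_mult h.h_mult h.mult)
      qed simp
    qed
    then have "h b = 0" using van[OF h.hom] by blast
    have hJ: "h t = 0" if "t \<in> J" for t
      using that unfolding J_def
    proof (induction rule: module_span.induct)
      case (step m r g)
      then obtain s s' where g: "g = s * s'" "s \<in> od \<union> od'" "s' \<in> od \<union> od'" by (auto simp: products_def)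
      then have "g \<in> S" "h g = 0" using gens h(4) by (auto simp: h.h_mult h.mult subset_eq)
      moreover have "m \<in> S" "r \<in> S" using step J_A A_S unfolding J_def by blast+
      ultimately show ?case using step by (simp add: h.h_add h.h_mult h.mult)
    qed simp
    have J_S: "J \<subseteq> S" using J_A A_S by blast
    have A2_S: "A2 \<subseteq> S" using A2_A A_S by blast
    have ev_cases: "(ev = {} \<or> ev = {gen_x1}) \<and> (ev' = {} \<or> ev' = {gen_x2})"
      using c by (auto simp: chart_def)
    have h2: "h u = val c0 c1 c2 \<beta>"
      if "k \<in> J" "u = of_rat c0 + of_rat c1 * gen_x2 + of_rat c2 * gen_x2\<^sup>2 + k" "ev' = {} \<longrightarrow> c1 = 0 \<and> c2 = 0"
      for u k c0 c1 c2
    proof (cases "ev' = {}")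
      case True
      then show ?thesis using that hJ[OF that(1)] J_S by (auto simp: val_def h.h_add subset_eq)
    next
      case False
      then have "gen_x2 \<in> S" "h gen_x2 = \<beta>" using ev_cases gens h(3) by auto
      then show ?thesis using that hJ[OF that(1)] J_S
        by (simp add: val_def h.h_add h.h_mult h.h_power h.add h.mult h.power subset_eq)
    qed
    have "h e = h b - h j"
      using ej J_S A_S b by (subst h.h_diff[symmetric]) auto
    then have "h e = 0" using \<open>h b = 0\<close> hJ[OF ej(2)] by simp
    moreover have "h e = h a0 + h a1 * \<alpha> + h a2 * \<alpha>\<^sup>2"
    proof (cases "ev = {}")
      case True
      then show ?thesis using a hJ[OF a(4)] J_S A2_S by (auto simp: h.h_add subset_eq)
    next
      case False
      then have "gen_x1 \<in> S" "h gen_x1 = \<alpha>" using ev_cases gens h(2) by auto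
      then show ?thesis using a hJ[OF a(4)] J_S A2_S
        by (simp add: h.h_add h.h_mult h.h_power h.add h.mult h.power subset_eq)
    qed
    ultimately show ?thesis
      using h2[OF p(1-3)] h2[OF q(1-3)] h2[OF r(1-3)] by simp
  qed
  have vals: "val p0 p1 p2 \<beta> = 0 \<and> val q0 q1 q2 \<beta> = 0 \<and> val r0 r1 r2 \<beta> = 0" if "\<beta> \<in> special_values ev'" for \<beta>
  proof (rule quadratic_vanishing[of ev])
    show "val q0 q1 q2 \<beta> = 0 \<and> val r0 r1 r2 \<beta> = 0" if "ev = {}"
      using that a(6) q(4) r(4) by (simp add: val_def)
  qed (rule grid[OF _ that])
  have zero: "c0 = 0 \<and> c1 = 0 \<and> c2 = 0"
    if "\<And>\<beta>. \<beta> \<in> special_values ev' \<Longrightarrow> val c0 c1 c2 \<beta> = 0" "ev' = {} \<longrightarrow> c1 = 0 \<and> c2 = 0" for c0 c1 c2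
    using quadratic_vanishing[of ev' "of_rat c0" "of_rat c1" "of_rat c2"] that by (simp add: val_def)
  have "a0 \<in> J" "a1 \<in> J" "a2 \<in> J"
  proof -
    have "p0 = 0 \<and> p1 = 0 \<and> p2 = 0" by (rule zero[OF _ p(3)]) (use vals in simp)
    moreover have "q0 = 0 \<and> q1 = 0 \<and> q2 = 0" by (rule zero[OF _ q(3)]) (use vals in simp)
    moreover have "r0 = 0 \<and> r1 = 0 \<and> r2 = 0" by (rule zero[OF _ r(3)]) (use vals in simp)
    ultimately show "a0 \<in> J" "a1 \<in> J" "a2 \<in> J"
      using p(1,2) q(1,2) r(1,2) by simp_all
  qed
  moreover have "gen_x1 \<in> A" if "ev \<noteq> {}"
    using that c(1) even_part_gens(1)[of "ev \<union> ev'" "od \<union> od'"] by (auto simp: chart_def A_def)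
  moreover have add: "u + v \<in> J" if "u \<in> J" "v \<in> J" for u v
    using that unfolding J_def by (intro A.module_span_add)
  moreover have "u * v \<in> J" if "u \<in> J" "v \<in> A" for u v
    using A.module_span_mult[of u _ v] that unfolding J_def by (simp add: mult.commute)
  ultimately have "e \<in> J"
    unfolding a(5) using a(4,6) A.power[of gen_x1 2] by (cases "ev = {}") simp_all
  then show "b \<in> module_span (even_part (ev \<union> ev') (od \<union> od')) (products (od \<union> od'))"
    using ej A.module_span_add unfolding J_def A_def by blast
qed

end

section \<open>Limits of rational points\<close>

lemma extend_scalars_point_of_hom:
  "extend_scalars (point_of_hom R h) = point_of_hom R (\<lambda>z. of_rat (h z) :: 'k :: field_char_0)"
  unfolding extend_scalars_def point_of_hom_def
  by (force simp: of_rat_divide image_iff)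

lemma rat_hom_of_rat_comp:
  assumes "rat_hom R h"
  shows "rat_hom R (\<lambda>z. of_rat (h z) :: 'k :: field_char_0)"
proof -
  interpret rat_hom R h by fact
  show ?thesis by (rule rat_homI[OF sub]) (simp_all add: h_add h_mult of_rat_add of_rat_mult)
qed

text \<open>The constant function 1 is regular at every point, so the subbasis covers all
  points.\<close>

lemma topspace_points_topology:
  assumes "\<And>R. R \<in> V \<Longrightarrow> rat_subalgebra R"
  shows "topspace (points_topology V) = (points V :: ('f :: field_char_0 \<times> 'k :: {field_char_0, topological_space}) set set)"
proof -
  have "\<exists>z U. open U \<and> (\<exists>v\<in>U. (z, v) \<in> P)" if P: "P \<in> points V" for P :: "('f \<times> 'k) set"
  proof -
    obtain R h where "P = point_of_hom R h" "rat_subalgebra R" "rat_alg_hom R h"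
      using P assms unfolding points_def by blast
    then interpret rat_hom R h by unfold_locales
    have "(1, h 1) \<in> P"
      unfolding \<open>P = _\<close> by (rule point_of_hom_base[OF one])
    then show ?thesis by (intro exI[of _ 1] exI[of _ UNIV]) auto
  qed
  then show ?thesis
    unfolding points_topology_def topology_generated_by_topspace by blast
qed

lemma openin_points_topology:
  "open U \<Longrightarrow> openin (points_topology V) {P \<in> points V. \<exists>v\<in>U. (z, v) \<in> P}"
  unfolding points_topology_def by (rule topology_generated_by_Basis) blast

context valued_field
begin

text \<open>A subbasic neighbourhood concerns one quotient \<open>u / t\<close> with
  \<open>h t \<noteq> 0\<close>, and pointwise convergence on \<open>C\<close> gives convergence of
  this quotient.\<close>

lemma point_in_closure:
  fixes h :: "'f :: field_char_0 \<Rightarrow> 'k" and g :: "nat \<Rightarrow> 'f \<Rightarrow> rat"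
  assumes V: "\<And>R. R \<in> V \<Longrightarrow> rat_subalgebra R" and C: "C \<in> V" and h: "rat_hom C h" and g: "\<forall>\<^sub>F n in sequentially. rat_hom C (g n)"
    and lim: "\<And>z. z \<in> C \<Longrightarrow> (\<lambda>n. of_rat (g n z)) \<longlonglongrightarrow> h z"
  shows "point_of_hom C h \<in> points_topology V closure_of (extend_scalars ` points V)"
proof -
  interpret h: rat_hom C h by fact
  define P where "P = point_of_hom C h"
  define Q where "Q n = (extend_scalars (point_of_hom C (g n)) :: ('f \<times> 'k) set)" for n
  have P: "P \<in> points V"
    unfolding P_def points_def using C h.hom by blast
  have Q: "Q n \<in> points V" if "rat_hom C (g n)" for n
  proof -
    interpret rat_hom C "\<lambda>z. of_rat (g n z) :: 'k" by (rule rat_hom_of_rat_comp[OF that])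
    show ?thesis unfolding Q_def extend_scalars_point_of_hom points_def using C hom by blast
  qed
  have ev: "\<forall>\<^sub>F n in sequentially. Q n \<in> T" if "openin (points_topology V) T" "P \<in> T" for T
  proof -
    have "generate_topology_on {{P \<in> points V. \<exists>v\<in>U. (z, v) \<in> P} | z U. open U} T"
      using that(1) unfolding points_topology_def openin_topology_generated_by_iff .
    then have "P \<in> T \<longrightarrow> (\<forall>\<^sub>F n in sequentially. Q n \<in> T)"
    proof (induction rule: generate_topology_on.induct)
      case (Int S T)
      then show ?case by (auto intro: eventually_conj elim: eventually_elim2)
    next
      case (UN k)
      show ?case
      proof
        assume "P \<in> \<Union> k"
        then obtain S where "S \<in> k" "P \<in> S" by blast
        then have "\<forall>\<^sub>F n in sequentially. Q n \<in> S" using UN by blast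
        then show "\<forall>\<^sub>F n in sequentially. Q n \<in> \<Union> k"
          by (rule eventually_mono) (use \<open>S \<in> k\<close> in blast)
      qed
    next
      case (Basis S)
      then obtain z U where S: "S = {P \<in> points V. \<exists>v\<in>U. (z, v) \<in> P}" "open U" by blast
      show ?case
      proof
        assume "P \<in> S"
        then obtain u t where ut: "u \<in> C" "t \<in> C" "h t \<noteq> 0" "z = u / t" "h u / h t \<in> U"
          unfolding S P_def by (auto simp: h.point_of_hom_iff)
        have "(\<lambda>n. of_rat (g n u) / of_rat (g n t)) \<longlonglongrightarrow> h u / h t"
          by (intro lim_divide lim ut)
        then have "\<forall>\<^sub>F n in sequentially. of_rat (g n u) / of_rat (g n t) \<in> U"
          using S(2) ut(5) by (rule topological_tendstoD)
        moreover have "\<forall>\<^sub>F n in sequentially. of_rat (g n t) \<noteq> (0 :: 'k)"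
          by (rule tendsto_imp_eventually_ne[OF lim[OF ut(2)] ut(3)])
        ultimately show "\<forall>\<^sub>F n in sequentially. Q n \<in> S"
          using g
        proof eventually_elim
          case (elim n)
          have "Q n = point_of_hom C (\<lambda>z. of_rat (g n z))"
            unfolding Q_def by (rule extend_scalars_point_of_hom)
          then have "(z, of_rat (g n u) / of_rat (g n t)) \<in> Q n"
            using ut elim(2) unfolding point_of_hom_def by blast
          then show ?case unfolding S using Q[OF elim(3)] elim(1) by blast
        qed
      qed
    qed simp
    then show ?thesis using that(2) by blast
  qed
  have "\<exists>y. y \<in> extend_scalars ` points V \<and> y \<in> T" if T: "P \<in> T" "openin (points_topology V) T" for T
  proof -
    obtain n where n: "Q n \<in> T" "rat_hom C (g n)"
      using eventually_happens'[OF sequentially_bot eventually_conj[OF ev[OF T(2,1)] g]] by blast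
    have "point_of_hom C (g n) \<in> points V"
      using C rat_hom.hom[OF n(2)] unfolding points_def by blast
    then have "Q n \<in> extend_scalars ` points V"
      unfolding Q_def by (rule imageI)
    with n(1) show ?thesis by blast
  qed
  moreover have "topspace (points_topology V) = (points V :: ('f \<times> 'k) set set)"
    by (rule topspace_points_topology) (rule V)
  ultimately show ?thesis
    unfolding in_closure_of P_def[symmetric] using P by simp
qed

end

text \<open>\<open>gen_x1\<close> may take any value \<open>u\<close>, and
  \<open>gen_y c f gen_x1\<close> is irrational over \<rat>(x1, x2), so it may be sent to either
  square root of f(u) / c.\<close>

lemma (in weierstrass) ex_twist_hom:
  fixes u v :: "'k :: field_char_0"
  assumes c: "c \<noteq> 0" and uv: "of_rat c * v\<^sup>2 = rpoly f u"
  obtains h where "rat_hom (rat_subalgebra hull {gen_x1, gen_y c f gen_x1}) h" "h gen_x1 = u" "h (gen_y c f gen_x1) = v"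
proof -
  define y where "y = gen_y c f gen_x1"
  have y: "of_rat c * y\<^sup>2 = rpoly f gen_x1"
    unfolding y_def by (rule gen_y_sq[OF c])
  \<comment> \<open>The value 0 of \<open>gen_x2\<close> is arbitrary; the twist involves
    \<open>gen_x1\<close> alone.\<close>
  obtain R h where R: "local_hom R h" "R \<subseteq> field_x12" "gen_x1 \<in> R" "gen_x2 \<in> R" "h gen_x1 = u" "h gen_x2 = 0"
    by (rule ex_local_hom_x12[of gen_x1 gen_x2]) auto
  interpret local_hom R h by fact
  have y2: "y\<^sup>2 = of_rat (inverse c) * rpoly f gen_x1"
    using c by (simp add: of_rat_inverse flip: y)
  have fx: "rpoly f gen_x1 \<in> R" using R(3) by (rule rat_poly)
  have notin: "y \<notin> field_x12"
    using not_square_x1[of f c y] deg c y by auto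
  have h_fx: "h (rpoly f gen_x1) = rpoly f u" using R by (simp add: h_rat_poly)
  obtain R' h' where R': "local_hom R' h'" "R \<subseteq> R'" "y \<in> R'" "\<And>u. u \<in> R \<Longrightarrow> h' u = h u" "h' y = v"
  proof (rule ex_local_adjoin_sqrt[OF rat_subfield_x12 R(2) notin, of v])
    show "y\<^sup>2 \<in> R" unfolding y2 by (rule mult[OF of_rat fx])
    show "v\<^sup>2 = h (y\<^sup>2)"
      unfolding y2 h_mult[OF of_rat fx] h_of_rat h_fx using c by (simp add: of_rat_inverse flip: uv)
  qed (rule that)
  interpret h': local_hom R' h' by fact
  show ?thesis
  proof (rule that[of h'])
    show "rat_hom (rat_subalgebra hull {gen_x1, gen_y c f gen_x1}) h'"
      using R' R(3) by (intro h'.restrict rat_subalgebra_hull h'.hull_le) (auto simp: y_def)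
  qed (use R' R in \<open>auto simp: y_def\<close>)
qed

text \<open>Topological density becomes density in coordinates because requiring \<open>x\<close>
  and \<open>y\<close> to be close to \<open>u\<close> and \<open>v\<close> defines an open set of
  points of the twist.\<close>

lemma (in weierstrass) suitable_twists_dense:
  assumes "valued_field TYPE('k :: {field_char_0, complete_space})" and tw: "suitable_twists f TYPE('k)" and d: "d \<noteq> (0 :: 'k)"
  shows "\<exists>c. c \<noteq> 0 \<and> (\<exists>e :: 'k. d = of_rat c * e\<^sup>2) \<and> valued_field.twist_dense TYPE('k) f c"
proof -
  interpret valued_field "TYPE('k)" by fact
  obtain c and e :: 'k where c: "c \<noteq> 0" "d / of_rat c = e\<^sup>2" "rational_points_dense (twist f c) TYPE('k)"
    using tw d unfolding suitable_twists_def by blast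
  define y where "y = gen_y c f gen_x1"
  have y: "of_rat c * y\<^sup>2 = rpoly f gen_x1"
    unfolding y_def by (rule gen_y_sq[OF c(1)])
  have "twist_dense f c"
    unfolding twist_dense_def
  proof (intro allI impI)
    fix u v :: 'k and \<epsilon> :: real assume uv: "of_rat c * v\<^sup>2 = rpoly f u" and "\<epsilon> > 0"
    define C where "C = rat_subalgebra hull {gen_x1, y}"
    obtain h where h: "rat_hom C h" "h gen_x1 = u" "h y = v"
      unfolding C_def y_def by (rule ex_twist_hom[OF c(1) uv])
    interpret h: rat_hom C h by fact
    define T where "T z x = {P \<in> points (twist f c). \<exists>v\<in>ball x \<epsilon>. (z, v) \<in> P}" for z and x :: 'k
    have gens: "gen_x1 \<in> C" "y \<in> C" unfolding C_def by (auto intro: hull_inc)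
    have "C \<in> twist f c" by (simp add: twist_def elliptic_curve_at_def C_def y_def)
    then have P: "point_of_hom C h \<in> points (twist f c)"
      unfolding points_def using h.hom by blast
    have in_T: "point_of_hom C h \<in> T gen_x1 u \<inter> T y v"
      using P h.point_of_hom_base[OF gens(1)] h.point_of_hom_base[OF gens(2)] h(2,3) \<open>\<epsilon> > 0\<close>
      by (auto simp: T_def intro: centre_in_ball[THEN iffD2])
    have "openin (points_topology (twist f c)) (T gen_x1 u \<inter> T y v)"
      unfolding T_def by (intro openin_Int openin_points_topology open_ball)
    moreover have "point_of_hom C h \<in> points_topology (twist f c) closure_of (extend_scalars ` points (twist f c))"
      using c(3) P unfolding rational_points_dense_def by simp
    ultimately obtain P' :: "(ambient \<times> rat) set" where P': "P' \<in> points (twist f c)" "extend_scalars P' \<in> T gen_x1 u \<inter> T y v"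
      using in_T unfolding in_closure_of by blast
    obtain R' g where g: "P' = point_of_hom R' g" "R' \<in> twist f c" "rat_alg_hom R' g"
      using P'(1) unfolding points_def by blast
    have "rat_subalgebra R'"
      using g(2) by (auto simp: twist_def elliptic_curve_at_def)
    then interpret g: rat_hom R' g using g(3) by unfold_locales
    \<comment> \<open>The rational point may be given by the chart at infinity; \<open>x\<close> and
      \<open>y\<close>, being regular at it, still lie in its local ring.\<close>
    obtain L k where L: "local_hom L k" "\<And>z v. (z, v) \<in> point_of_hom R' g \<Longrightarrow> z \<in> L \<and> k z = v"
      by (rule g.ex_localize) blast
    interpret k: local_hom L k by fact
    have coord: "z \<in> L \<and> dist (of_rat (k z)) x < \<epsilon>" if "extend_scalars P' \<in> T z x" for z x
      using that L(2) g(1) by (auto simp: T_def extend_scalars_def dist_commute)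
    have x: "gen_x1 \<in> L" "dist (of_rat (k gen_x1)) u < \<epsilon>" and y': "y \<in> L" "dist (of_rat (k y)) v < \<epsilon>"
      using coord[of gen_x1 u] coord[of y v] P'(2) by auto
    have "k (of_rat c * y\<^sup>2) = k (rpoly f gen_x1)" by (simp add: y)
    then have "c * (k y)\<^sup>2 = poly f (k gen_x1)"
      using x y' by (simp add: k.h_mult k.h_power k.h_rat_poly k.power map_poly_idI)
    then show "\<exists>u' v'. c * v'\<^sup>2 = poly f u' \<and> dist (of_rat u') u < \<epsilon> \<and> dist (of_rat v') v < \<epsilon>"
      using x y' by blast
  qed
  moreover have "d = of_rat c * e\<^sup>2" using c by (simp add: field_simps)
  ultimately show ?thesis using c(1) by blast
qed

section \<open>Approximation on a chart of the Kummer variety\<close>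

text \<open>That \<open>W = h (s1 * s1 / a)\<close> is nonzero means that \<open>s1\<^sup>2\<close>
  generates the ideal at the point, just as \<open>a\<close> does. So \<open>b / a\<close> is the
  quotient of \<open>b / s1\<^sup>2\<close> by \<open>a / s1\<^sup>2\<close>, which tend to
  \<open>h (b / a) / W\<close> and \<open>1 / W\<close>. These are expressed by functions whose
  convergence is assumed, also where \<open>h (s1\<^sup>2) = 0\<close>.\<close>

lemma (in valued_field) limit_on_blowup_chart:
  fixes h :: "'f :: field_char_0 \<Rightarrow> 'k" and g :: "nat \<Rightarrow> 'f \<Rightarrow> rat"
  assumes fin: "finite ev" "finite od" and I: "I \<subseteq> module_span (even_part ev od) (products od)" "products od \<subseteq> I"
    and a: "a \<in> I" "a \<noteq> 0"
    and C: "C = rat_subalgebra hull (even_part ev od \<union> {b / a | b. b \<in> I})" and h: "rat_hom C h"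
    and s1: "s1 \<noteq> 0" "s1 \<in> od" "s2 \<in> od"
    and ev: "\<And>u. u \<in> ev \<Longrightarrow> u = z1 \<and> h u = w1 \<or> u = z2 \<and> h u = w2"
    and od: "\<And>q. q \<in> od \<Longrightarrow> \<exists>s r \<rho>. (s = s1 \<or> s = s2) \<and> (r, \<rho>) \<in> {(1, 1), (z1, w1), (z2, w2)} \<and> q = s * r
        \<and> (\<forall>q'\<in>od. h (q * q' / a) = \<rho> * h (s * q' / a))"
    and W: "h (s1 * s1 / a) \<noteq> 0"
    and g: "\<And>n. local_hom (F n) (g n)" "\<And>n. z1 \<in> F n" "\<And>n. z2 \<in> F n" "\<And>n. s2 / s1 \<in> F n" "\<And>n. s1\<^sup>2 \<in> F n"
    and lim: "(\<lambda>n. of_rat (g n z1)) \<longlonglongrightarrow> w1" "(\<lambda>n. of_rat (g n z2)) \<longlonglongrightarrow> w2"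
      "(\<lambda>n. of_rat (g n (s2 / s1))) \<longlonglongrightarrow> h (s1 * s2 / a) / h (s1 * s1 / a)"
      "(\<lambda>n. of_rat (g n (s1\<^sup>2))) \<longlonglongrightarrow> h (s1\<^sup>2)"
  shows "(\<forall>\<^sub>F n in sequentially. rat_hom C (g n)) \<and> (\<forall>z\<in>C. (\<lambda>n. of_rat (g n z)) \<longlonglongrightarrow> h z)"
proof -
  define A where "A = even_part ev od"
  interpret A: subalg A unfolding A_def by (rule subalg_even_part)
  interpret h: rat_hom C h by fact
  interpret g: local_hom "F n" "g n" for n by (rule g(1))
  define W where "W = h (s1 * s1 / a)"
  have W0: "W \<noteq> 0" using W by (simp add: W_def)
  \<comment> \<open>Convergence is inherited by ring operations and by inverses of elements with nonzero limit, so it is enough to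
    reach the generators of \<open>C\<close>; dividing by \<open>s1\<^sup>2\<close> first is what resolves the quotients \<open>b / a\<close>.\<close>
  define T where "T z v \<longleftrightarrow> (\<forall>\<^sub>F n in sequentially. z \<in> F n) \<and> (\<lambda>n. of_rat (g n z)) \<longlonglongrightarrow> v" for z and v :: 'k
  have T_of_rat: "T (of_rat q) (of_rat q)" for q
    by (simp add: T_def)
  have T_1: "T 1 1" using T_of_rat[of 1] by simp
  have T_0: "T 0 0" using T_of_rat[of 0] by simp
  have T_add: "T (x + y) (u + v)" if "T x u" "T y v" for x y u v
    unfolding T_def
  proof
    have ev: "\<forall>\<^sub>F n in sequentially. x \<in> F n \<and> y \<in> F n"
      using that by (auto simp: T_def intro: eventually_conj)
    then show "\<forall>\<^sub>F n in sequentially. x + y \<in> F n"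
      by (rule eventually_mono) (auto intro: g.add)
    show "(\<lambda>n. of_rat (g n (x + y))) \<longlonglongrightarrow> u + v"
    proof (rule Lim_transform_eventually)
      show "(\<lambda>n. of_rat (g n x) + of_rat (g n y)) \<longlonglongrightarrow> u + v"
        using that by (intro lim_add) (auto simp: T_def)
      show "\<forall>\<^sub>F n in sequentially. of_rat (g n x) + of_rat (g n y) = (of_rat (g n (x + y)) :: 'k)"
        using ev by (rule eventually_mono) (auto simp: g.h_add of_rat_add)
    qed
  qed
  have T_mult: "T (x * y) (u * v)" if "T x u" "T y v" for x y u v
    unfolding T_def
  proof
    have ev: "\<forall>\<^sub>F n in sequentially. x \<in> F n \<and> y \<in> F n"
      using that by (auto simp: T_def intro: eventually_conj)
    then show "\<forall>\<^sub>F n in sequentially. x * y \<in> F n"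
      by (rule eventually_mono) (auto intro: g.mult)
    show "(\<lambda>n. of_rat (g n (x * y))) \<longlonglongrightarrow> u * v"
    proof (rule Lim_transform_eventually)
      show "(\<lambda>n. of_rat (g n x) * of_rat (g n y)) \<longlonglongrightarrow> u * v"
        using that by (intro lim_mult) (auto simp: T_def)
      show "\<forall>\<^sub>F n in sequentially. of_rat (g n x) * of_rat (g n y) = (of_rat (g n (x * y)) :: 'k)"
        using ev by (rule eventually_mono) (auto simp: g.h_mult of_rat_mult)
    qed
  qed
  have T_inverse: "T (inverse x) (inverse u)" if x: "T x u" and u: "u \<noteq> 0" for x u
    unfolding T_def
  proof
    have lim_x: "(\<lambda>n. of_rat (g n x)) \<longlonglongrightarrow> u" using x by (simp add: T_def)
    have "\<forall>\<^sub>F n in sequentially. x \<in> F n \<and> of_rat (g n x) \<noteq> (0 :: 'k)"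
      using x tendsto_imp_eventually_ne[OF lim_x u] by (auto simp: T_def intro: eventually_conj)
    then have ev: "\<forall>\<^sub>F n in sequentially. x \<in> F n \<and> inverse x \<in> F n"
      by (rule eventually_mono) (auto intro: g.inverse_closed)
    then show "\<forall>\<^sub>F n in sequentially. inverse x \<in> F n"
      by (rule eventually_mono) auto
    show "(\<lambda>n. of_rat (g n (inverse x))) \<longlonglongrightarrow> inverse u"
    proof (rule Lim_transform_eventually)
      show "(\<lambda>n. inverse (of_rat (g n x))) \<longlonglongrightarrow> inverse u"
        by (rule lim_inverse[OF lim_x u])
      show "\<forall>\<^sub>F n in sequentially. inverse (of_rat (g n x)) = (of_rat (g n (inverse x)) :: 'k)"
        using ev by (rule eventually_mono) (auto simp: g.h_inverse of_rat_inverse)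
    qed
  qed
  have T_base: "T z1 w1" "T z2 w2" "T (s2 / s1) (h (s1 * s2 / a) / W)" "T (s1\<^sup>2) (h (s1\<^sup>2))"
    using g lim by (auto simp: T_def W_def)

  have in_C: "A \<subseteq> C" "\<And>b. b \<in> I \<Longrightarrow> b / a \<in> C"
    unfolding C A_def[symmetric] by (auto intro!: hull_inc)
  have prods: "q * q' \<in> A" "q * q' \<in> I" "q * q' / a \<in> C" if "q \<in> od" "q' \<in> od" for q q'
  proof -
    have "q * q' \<in> products od" using that by (auto simp: products_def)
    then show "q * q' \<in> A" "q * q' \<in> I" using I(2) even_part_gens(2)[of od ev] unfolding A_def by blast+
    then show "q * q' / a \<in> C" using in_C(2) by blast
  qed
  have J_A: "module_span A (products od) \<subseteq> A"
    by (rule A.module_span_subset) (use even_part_gens(2)[of od ev] in \<open>simp add: A_def\<close>)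
  have a_A: "a \<in> A" using a(1) I(1) J_A unfolding A_def by blast
  \<comment> \<open>The symmetric array of values \<open>h (s * s' / a)\<close> has rank one, so the
    entry for \<open>s2\<close>, \<open>s2\<close> follows from the ratio.\<close>
  have rank: "h (s2 * s2 / a) * W = (h (s1 * s2 / a))\<^sup>2"
  proof -
    have "h (s2 * s2 / a) * W = h ((s2 * s2 / a) * (s1 * s1 / a))"
      unfolding W_def using prods s1 by (subst h.h_mult) auto
    also have "(s2 * s2 / a) * (s1 * s1 / a) = (s1 * s2 / a) * (s1 * s2 / a)" by simp
    also have "h \<dots> = (h (s1 * s2 / a))\<^sup>2"
      using prods s1 by (subst h.h_mult) (auto simp: power2_eq_square)
    finally show ?thesis .
  qed
  have T_param: "T (s * s' / s1\<^sup>2) (h (s * s' / a) / W)" if "s = s1 \<or> s = s2" "s' = s1 \<or> s' = s2" for s s'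
  proof -
    have "T (s1 * s1 / s1\<^sup>2) (h (s1 * s1 / a) / W)"
      using T_1 s1 W0 by (simp add: power2_eq_square W_def)
    moreover have 12: "T (s1 * s2 / s1\<^sup>2) (h (s1 * s2 / a) / W)"
      using T_base(3) s1 by (simp add: power2_eq_square)
    moreover have "T (s2 * s1 / s1\<^sup>2) (h (s2 * s1 / a) / W)"
      using 12 by (simp add: mult.commute)
    moreover have "T (s2 * s2 / s1\<^sup>2) (h (s2 * s2 / a) / W)"
    proof -
      have "h (s2 * s2 / a) / W = (h (s1 * s2 / a) / W) * (h (s1 * s2 / a) / W)"
        using rank W0 by (simp add: field_simps power2_eq_square)
      moreover have "s2 * s2 / s1\<^sup>2 = (s2 / s1) * (s2 / s1)" by (simp add: power2_eq_square)
      ultimately show ?thesis using T_mult[OF T_base(3) T_base(3)] by (simp only:)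
    qed
    ultimately show ?thesis using that by auto
  qed
  \<comment> \<open>Assumption \<open>od\<close> is applied to both arguments: each odd generator is
    \<open>s1\<close> or \<open>s2\<close> times 1, \<open>z1\<close> or \<open>z2\<close>, and the
    values of the quotients scale by the values of these factors.\<close>
  have T_prod_quot: "T (q * q' / s1\<^sup>2) (h (q * q' / a) / W)" if "q \<in> od" "q' \<in> od" for q q'
  proof -
    obtain s r \<rho> where q: "s = s1 \<or> s = s2" "(r, \<rho>) \<in> {(1, 1), (z1, w1), (z2, w2)}" "q = s * r"
      "\<forall>q'\<in>od. h (q * q' / a) = \<rho> * h (s * q' / a)" using od[OF \<open>q \<in> od\<close>] by blast
    obtain s' r' \<rho>' where q': "s' = s1 \<or> s' = s2" "(r', \<rho>') \<in> {(1, 1), (z1, w1), (z2, w2)}" "q' = s' * r'"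
      "\<forall>q\<in>od. h (q' * q / a) = \<rho>' * h (s' * q / a)" using od[OF \<open>q' \<in> od\<close>] by blast
    have "s \<in> od" using q(1) s1 by auto
    have "h (q * q' / a) = \<rho> * h (q' * s / a)" using q(4) that by (simp add: mult.commute)
    also have "h (q' * s / a) = \<rho>' * h (s' * s / a)" using q'(4) \<open>s \<in> od\<close> by blast
    also have "\<rho> * (\<rho>' * h (s' * s / a)) = \<rho> * \<rho>' * h (s * s' / a)" by (simp add: mult.commute[of s s'])
    finally have val: "h (q * q' / a) / W = \<rho> * \<rho>' * (h (s * s' / a) / W)" by simp
    have "T r \<rho>" "T r' \<rho>'" using q(2) q'(2) T_1 T_base by auto
    then have "T (r * r' * (s * s' / s1\<^sup>2)) (\<rho> * \<rho>' * (h (s * s' / a) / W))"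
      using T_param[OF q(1) q'(1)] by (intro T_mult)
    moreover have "q * q' / s1\<^sup>2 = r * r' * (s * s' / s1\<^sup>2)" using q(3) q'(3) by simp
    ultimately show ?thesis by (simp only: val)
  qed
  have h_a: "h b = h a * h (b / a)" if "b \<in> I" for b
    using h.h_mult[of a "b / a"] a a_A in_C that by auto
  \<comment> \<open>The products themselves are recovered from the quotients on multiplying by
    \<open>s1\<^sup>2\<close>, whose limit \<open>h (s1\<^sup>2)\<close> may be 0.\<close>
  have T_prod: "T (q * q') (h (q * q'))" if "q \<in> od" "q' \<in> od" for q q'
  proof -
    have "h (q * q') = h a * h (q * q' / a)" using h_a prods that by blast
    also have "\<dots> = (h (q * q' / a) / W) * h (s1\<^sup>2)"
      using h_a[OF prods(2)[OF s1(2,2)]] W0 by (simp add: W_def power2_eq_square)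
    finally have "h (q * q') = (h (q * q' / a) / W) * h (s1\<^sup>2)" .
    moreover have "q * q' = (q * q' / s1\<^sup>2) * s1\<^sup>2" using s1 by simp
    ultimately show ?thesis using T_mult[OF T_prod_quot[OF that] T_base(4)] by simp
  qed
  have sub_T: "rat_subalgebra {b \<in> C. T b (h b)}"
    by (rule rat_subalgebraI) (auto simp: h.h_add h.h_mult intro: T_of_rat T_add T_mult h.add h.mult)
  have gens_A: "ev \<union> products od \<subseteq> A" unfolding A_def even_part_def by (rule hull_subset)
  have T_gens: "T b (h b)" if "b \<in> ev \<union> products od" for b
    using that ev T_base(1,2) T_prod by (auto simp: products_def)
  have T_A: "T b (h b)" if "b \<in> A" for b
  proof -
    have "A \<subseteq> {b \<in> C. T b (h b)}"
      unfolding A_def even_part_def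
    proof (rule hull_minimal)
      show "ev \<union> products od \<subseteq> {b \<in> C. T b (h b)}" using gens_A in_C(1) T_gens by blast
    qed (rule sub_T)
    then show ?thesis using that by blast
  qed
  have T_J: "j / a \<in> C \<and> T (j / s1\<^sup>2) (h (j / a) / W)" if "j \<in> module_span A (products od)" for j
    using that
  proof (induction rule: module_span.induct)
    case zero
    then show ?case using T_0 by simp
  next
    case (step m r b)
    have b: "b / a \<in> C" "T (b / s1\<^sup>2) (h (b / a) / W)"
      using step(3) prods(3) T_prod_quot by (auto simp: products_def)
    have r: "r \<in> C" using step(2) in_C by blast
    have split: "(m + r * b) / a = m / a + r * (b / a)" "(m + r * b) / s1\<^sup>2 = m / s1\<^sup>2 + r * (b / s1\<^sup>2)"
      by (simp_all add: add_divide_distrib)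
    have "h ((m + r * b) / a) / W = h (m / a) / W + h r * (h (b / a) / W)"
    proof -
      have "h (m / a + r * (b / a)) = h (m / a) + h r * h (b / a)"
        using step b r h.mult[OF r b(1)] by (simp only: h.h_add h.h_mult)
      then show ?thesis unfolding split by (simp add: add_divide_distrib)
    qed
    then have "T ((m + r * b) / s1\<^sup>2) (h ((m + r * b) / a) / W)"
      unfolding split(2) using T_add[OF conjunct2[OF step(4)] T_mult[OF T_A[OF step(2)] b(2)]] by (simp only:)
    moreover have "(m + r * b) / a \<in> C"
      unfolding split(1) using step(4) b r by (intro h.add h.mult) auto
    ultimately show ?case by blast
  qed
  \<comment> \<open>\<open>a\<close> lies in the ideal and \<open>h (a / a) = 1\<close>, so
    \<open>a / s1\<^sup>2\<close> has the nonzero limit \<open>1 / W\<close>.\<close>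
  have T_a: "T (s1\<^sup>2 / a) W"
  proof -
    have "T (a / s1\<^sup>2) (1 / W)"
      using T_J[of a] a I(1) by (auto simp: A_def)
    then show ?thesis using T_inverse[of "a / s1\<^sup>2" "1 / W"] W0 by simp
  qed
  have T_I: "T (b / a) (h (b / a))" if "b \<in> I" for b
  proof -
    have "T (b / s1\<^sup>2) (h (b / a) / W)" using T_J[of b] that I(1) by (auto simp: A_def)
    from T_mult[OF this T_a] show ?thesis using W0 s1 by simp
  qed
  have T_C: "T b (h b)" if "b \<in> C" for b
  proof -
    have "C \<subseteq> {b \<in> C. T b (h b)}"
    proof (subst (1) C, rule hull_minimal)
      show "even_part ev od \<union> {b / a | b. b \<in> I} \<subseteq> {b \<in> C. T b (h b)}"
        using in_C T_A T_I unfolding A_def by blast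
    qed (rule sub_T)
    then show ?thesis using that by blast
  qed
  \<comment> \<open>Membership in \<open>F n\<close> is so far known eventually for each single
    element. One \<open>n\<close> for all of \<open>C\<close> is obtained from finitely many
    functions: the generators of the even part, the products over \<open>s1\<^sup>2\<close>, and
    \<open>s1\<^sup>2 / a\<close>.\<close>
  have fin_prods: "finite (products od)"
  proof -
    have "products od = (\<lambda>(q, q'). q * q') ` (od \<times> od)" by (auto simp: products_def)
    then show ?thesis using fin by simp
  qed
  have "\<forall>\<^sub>F n in sequentially. b \<in> F n" if "b \<in> ev \<union> products od" for b
    using T_gens[OF that] by (simp add: T_def)
  then have ev1: "\<forall>\<^sub>F n in sequentially. \<forall>b\<in>ev \<union> products od. b \<in> F n"
    using fin fin_prods by (intro eventually_ball_finite) auto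
  have "\<forall>\<^sub>F n in sequentially. b / s1\<^sup>2 \<in> F n" if "b \<in> products od" for b
    using that T_prod_quot by (auto simp: T_def products_def)
  then have ev2: "\<forall>\<^sub>F n in sequentially. \<forall>b\<in>products od. b / s1\<^sup>2 \<in> F n"
    using fin_prods by (intro eventually_ball_finite) auto
  have ev3: "\<forall>\<^sub>F n in sequentially. s1\<^sup>2 / a \<in> F n" using T_a by (simp add: T_def)
  have "\<forall>\<^sub>F n in sequentially. rat_hom C (g n)"
    using ev1 ev2 ev3
  proof eventually_elim
    case (elim n)
    have A_F: "A \<subseteq> F n"
      unfolding A_def even_part_def by (rule g.hull_le) (use elim(1) in blast)
    have J_F: "j / s1\<^sup>2 \<in> F n" if "j \<in> module_span A (products od)" for j
      using that
    proof (induction rule: module_span.induct)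
      case (step m r b)
      have "m / s1\<^sup>2 + r * (b / s1\<^sup>2) \<in> F n"
        using step elim(2) A_F by (intro g.add g.mult) auto
      then show ?case by (simp add: add_divide_distrib)
    qed auto
    have "b / a \<in> F n" if "b \<in> I" for b
    proof -
      have "(b / s1\<^sup>2) * (s1\<^sup>2 / a) \<in> F n"
        using that I(1) J_F elim(3) by (intro g.mult) (auto simp: A_def)
      then show ?thesis using s1 by simp
    qed
    then have "C \<subseteq> F n"
      unfolding C by (intro g.hull_le) (use A_F in \<open>auto simp: A_def\<close>)
    then show ?case
      using h.sub by (intro g.restrict)
  qed
  then show ?thesis using T_C by (auto simp: T_def)
qed

context weierstrass
begin

text \<open>A point of the blow-up gives no values to odd functions. In the chart at infinity the
  value \<open>\<gamma>\<close> of the square of \<open>1 / y\<close> decides: if it is nonzero,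
  \<open>x\<close> has the value \<open>\<beta> / \<gamma>\<close> and the model with
  \<open>s = 1 / y\<close> applies; if it is 0, the coordinate is at the origin, and
  \<open>s = x / y\<close> is used with \<open>1 / x\<close> of value 0.\<close>

lemma ex_model_of_hom:
  fixes h :: "ambient \<Rightarrow> 'k :: field_char_0"
  assumes fac: "factor x y" and c: "chart x y ev od" and od: "od \<subseteq> OD" and "rat_hom C h" and ev: "ev \<subseteq> C"
    and prods: "\<And>q q'. q \<in> OD \<Longrightarrow> q' \<in> OD \<Longrightarrow> q * q' \<in> C" "\<And>q q'. q \<in> OD \<Longrightarrow> q' \<in> OD \<Longrightarrow> q * q' / a \<in> C"
  obtains N D z s w where "chart_model f x y ev od N D z s" "rpoly D w \<noteq> 0" "h (s\<^sup>2) * rpoly D w = rpoly N w"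
    "\<And>u. u \<in> ev \<Longrightarrow> u = z \<and> h u = w"
    "\<And>q. q \<in> od \<Longrightarrow> \<exists>r \<rho>. (r, \<rho>) \<in> {(1, 1), (z, w)} \<and> q = s * r \<and> (\<forall>q'\<in>OD. h (q * q' / a) = \<rho> * h (s * q' / a))"
proof -
  interpret rat_hom C h by fact
  note x = factorD[OF fac]
  from c consider "ev = {x}" "od = {y}" | "ev = {}" "od = {x / y, 1 / y}"
    by (auto simp: chart_def)
  then show ?thesis
  proof cases
    case 1
    have "x \<in> C" using 1 ev by simp
    then have "h (y\<^sup>2) = rpoly f (h x)" unfolding x(1) by (rule h_rat_poly)
    then show ?thesis
      using 1 by (intro that[of f 1 x y "h x"]) (auto simp: chart_model_def)
  next
    case 2
    define s t where "s = x / y" and "t = 1 / y"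
    have st: "s \<in> OD" "t \<in> OD" using 2 od by (auto simp: s_def t_def)
    obtain A B E where f: "f = [:E, B, A, 1:]" by (rule ex_coeffs)
    have y2: "y\<^sup>2 = x ^ 3 + of_rat A * x\<^sup>2 + of_rat B * x + of_rat E"
      unfolding x(1) f by (simp add: map_poly_pCons algebra_simps power2_eq_square power3_eq_cube)
    \<comment> \<open>Equation of the curve in the chart at infinity. All its terms are odd, so it
      is multiplied by an odd function before \<open>h\<close> is applied.\<close>
    have "s ^ 3 + of_rat A * s\<^sup>2 * t + of_rat B * s * t\<^sup>2 + of_rat E * t ^ 3 = y\<^sup>2 / y ^ 3"
      unfolding s_def t_def y2 by (simp add: power_divide add_divide_distrib power2_eq_square power3_eq_cube)
    also have "\<dots> = t" using x(3) by (simp add: t_def power2_eq_square power3_eq_cube)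
    finally have rel: "t = s ^ 3 + of_rat A * s\<^sup>2 * t + of_rat B * s * t\<^sup>2 + of_rat E * t ^ 3" by simp
    define \<alpha> \<beta> \<gamma> where "\<alpha> = h (s * s)" and "\<beta> = h (s * t)" and "\<gamma> = h (t * t)"
    note in_C = prods(1)[OF st(1) st(1)] prods(1)[OF st(1) st(2)] prods(1)[OF st(2) st(2)]
    have \<beta>2: "\<beta>\<^sup>2 = \<alpha> * \<gamma>"
    proof -
      have "\<beta>\<^sup>2 = h ((s * t) * (s * t))" unfolding \<beta>_def h_mult[OF in_C(2,2)] by (simp add: power2_eq_square)
      also have "(s * t) * (s * t) = (s * s) * (t * t)" by simp
      also have "h \<dots> = \<alpha> * \<gamma>" unfolding h_mult[OF in_C(1,3)] \<alpha>_def \<gamma>_def ..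
      finally show ?thesis .
    qed
    show ?thesis
    proof (cases "\<gamma> = 0")
      case False
      define w where "w = \<beta> / \<gamma>"
      have eq: "(t * t) * (t * t) = (s * t) ^ 3 + of_rat A * ((s * t)\<^sup>2 * (t * t))
          + of_rat B * ((s * t) * (t * t)\<^sup>2) + of_rat E * (t * t) ^ 3"
      proof -
        have "(t * t) * (t * t) = t * t ^ 3" by (simp add: power3_eq_cube)
        also have "\<dots> = (s ^ 3 + of_rat A * s\<^sup>2 * t + of_rat B * s * t\<^sup>2 + of_rat E * t ^ 3) * t ^ 3"
          by (rule arg_cong[OF rel])
        also have "\<dots> = (s * t) ^ 3 + of_rat A * ((s * t)\<^sup>2 * (t * t))
            + of_rat B * ((s * t) * (t * t)\<^sup>2) + of_rat E * (t * t) ^ 3"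
          by (simp add: algebra_simps power2_eq_square power3_eq_cube)
        finally show ?thesis .
      qed
      have "\<gamma> * \<gamma> = h ((t * t) * (t * t))" unfolding h_mult[OF in_C(3,3)] \<gamma>_def ..
      also have "\<dots> = \<beta> ^ 3 + of_rat A * (\<beta>\<^sup>2 * \<gamma>) + of_rat B * (\<beta> * \<gamma>\<^sup>2) + of_rat E * \<gamma> ^ 3"
        unfolding eq \<beta>_def \<gamma>_def using in_C by (simp add: h_add h_mult h_power add mult power)
      also have "\<dots> = \<gamma> ^ 3 * rpoly f w"
        unfolding f w_def using False by (simp add: map_poly_pCons field_simps power2_eq_square power3_eq_cube)
      finally have f_w: "\<gamma> * rpoly f w = 1"
        using False by (simp add: power3_eq_cube)
      have ratio: "h (s * q' / a) = w * h (t * q' / a)" if "q' \<in> OD" for q'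
      proof -
        have "\<gamma> * h (s * q' / a) = h ((t * t) * (s * q' / a))"
          unfolding \<gamma>_def using h_mult[OF in_C(3) prods(2)[OF st(1) that]] by simp
        also have "(t * t) * (s * q' / a) = (s * t) * (t * q' / a)" by simp
        also have "h \<dots> = \<beta> * h (t * q' / a)"
          unfolding \<beta>_def by (rule h_mult[OF in_C(2) prods(2)[OF st(2) that]])
        finally show ?thesis using False by (simp add: w_def field_simps)
      qed
      show ?thesis
      proof (rule that[of 1 f x t w])
        show "chart_model f x y ev od 1 f x t" using 2 by (simp add: chart_model_def t_def)
        show "rpoly f w \<noteq> 0" using f_w by auto
        show "h (t\<^sup>2) * rpoly f w = rpoly 1 w"
          using f_w by (simp add: \<gamma>_def power2_eq_square)
        show "u = x \<and> h u = w" if "u \<in> ev" for u using that 2 by simp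
        fix q assume "q \<in> od"
        then have "q = s \<or> q = t" using 2 by (auto simp: s_def t_def)
        then show "\<exists>r \<rho>. (r, \<rho>) \<in> {(1, 1), (x, w)} \<and> q = t * r \<and> (\<forall>q'\<in>OD. h (q * q' / a) = \<rho> * h (t * q' / a))"
        proof
          assume "q = s"
          then show ?thesis using ratio by (intro exI[of _ x] exI[of _ w]) (simp add: s_def t_def)
        next
          assume "q = t"
          then show ?thesis by (intro exI[of _ 1]) simp
        qed
      qed
    next
      case True
      then have "\<beta> = 0" using \<beta>2 by simp
      \<comment> \<open>Multiplication by \<open>s\<close> isolates the square of
        \<open>s * s\<close>: every other term contains \<open>s * t\<close>, whose value
        \<open>\<beta>\<close> is 0.\<close>
      have eq: "s * t = (s * s) * (s * s) + of_rat A * ((s * s) * (s * t)) + of_rat B * ((s * t) * (s * t)) + of_rat E * ((s * t) * (t * t))"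
      proof -
        have "s * t = s * (s ^ 3 + of_rat A * s\<^sup>2 * t + of_rat B * s * t\<^sup>2 + of_rat E * t ^ 3)"
          by (rule arg_cong[OF rel])
        also have "\<dots> = (s * s) * (s * s) + of_rat A * ((s * s) * (s * t)) + of_rat B * ((s * t) * (s * t)) + of_rat E * ((s * t) * (t * t))"
          by (simp add: algebra_simps power2_eq_square power3_eq_cube)
        finally show ?thesis .
      qed
      have "\<beta> = \<alpha> * \<alpha> + of_rat A * (\<alpha> * \<beta>) + of_rat B * (\<beta> * \<beta>) + of_rat E * (\<beta> * \<gamma>)"
        unfolding \<alpha>_def \<beta>_def \<gamma>_def using in_C by (subst eq) (simp add: h_add h_mult add mult)
      then have "\<alpha> = 0" using \<open>\<beta> = 0\<close> by simp
      \<comment> \<open>The equation writes \<open>t * q' / a\<close> as a combination of elements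
        of \<open>C\<close> with coefficients \<open>s * s\<close>, \<open>s * t\<close> and
        \<open>t * t\<close>, all of value 0.\<close>
      have zero: "h (t * q' / a) = 0" if "q' \<in> OD" for q'
      proof -
        note p = prods(2)[OF st(1) that] prods(2)[OF st(2) that]
        have "t * q' / a = (s * s) * (s * q' / a) + of_rat A * ((s * s) * (t * q' / a))
            + of_rat B * ((s * t) * (t * q' / a)) + of_rat E * ((t * t) * (t * q' / a))"
        proof -
          have "t * q' / a = (s ^ 3 + of_rat A * s\<^sup>2 * t + of_rat B * s * t\<^sup>2 + of_rat E * t ^ 3) * q' / a"
            by (rule arg_cong[OF rel])
          also have "\<dots> = (s * s) * (s * q' / a) + of_rat A * ((s * s) * (t * q' / a))
              + of_rat B * ((s * t) * (t * q' / a)) + of_rat E * ((t * t) * (t * q' / a))"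
            by (simp add: algebra_simps power2_eq_square power3_eq_cube add_divide_distrib)
          finally show ?thesis .
        qed
        also have "h \<dots> = 0"
          using in_C p \<open>\<alpha> = 0\<close> \<open>\<beta> = 0\<close> True
          by (simp add: h_add h_mult add mult \<alpha>_def \<beta>_def \<gamma>_def del: times_divide_eq_right times_divide_eq_left)
        finally show ?thesis .
      qed
      show ?thesis
      proof (rule that[of "[:0, 1:]" "reflect_poly f" "inverse x" s 0])
        show "chart_model f x y ev od [:0, 1:] (reflect_poly f) (inverse x) s" using 2 by (simp add: chart_model_def s_def)
        show "rpoly (reflect_poly f) (0 :: 'k) \<noteq> 0" by (simp only: rpoly_reflect_0) simp
        show "h (s\<^sup>2) * rpoly (reflect_poly f) 0 = rpoly [:0, 1:] 0"
          using \<open>\<alpha> = 0\<close> by (simp add: \<alpha>_def power2_eq_square map_poly_pCons)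
        show "u = inverse x \<and> h u = 0" if "u \<in> ev" for u using that 2 by simp
        fix q assume "q \<in> od"
        then have "q = s \<or> q = t" using 2 by (auto simp: s_def t_def)
        then show "\<exists>r \<rho>. (r, \<rho>) \<in> {(1, 1), (inverse x, 0)} \<and> q = s * r \<and> (\<forall>q'\<in>OD. h (q * q' / a) = \<rho> * h (s * q' / a))"
        proof
          assume "q = s"
          then show ?thesis by (intro exI[of _ 1]) simp
        next
          assume "q = t"
          then show ?thesis using zero x(2) by (intro exI[of _ "inverse x"] exI[of _ 0]) (simp add: s_def t_def)
        qed
      qed
    qed
  qed
qed

text \<open>Asymmetric in the factors: \<open>s1\<close> is the odd function whose square generates
  the ideal at the point, so the lemma is applied with the factors in either order. Assumption
  \<open>graph\<close> turns rational data into rational points.\<close>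

lemma ex_rational_approximation:
  fixes h :: "ambient \<Rightarrow> 'k :: {field_char_0, complete_space}"
  assumes pf: "padic_field TYPE('k) p" and tw: "suitable_twists f TYPE('k)"
    and fin: "finite ev" "finite od" and I: "I \<subseteq> module_span (even_part ev od) (products od)" "products od \<subseteq> I"
    and a: "a \<in> I" "a \<noteq> 0"
    and C: "C = rat_subalgebra hull (even_part ev od \<union> {b / a | b. b \<in> I})" and h: "rat_hom C h"
    and model: "local_model f N1 D1" "local_model f N2 D2" "s1\<^sup>2 * rpoly D1 z1 = rpoly N1 z1"
    and w: "rpoly D1 w1 \<noteq> 0" "h (s1\<^sup>2) * rpoly D1 w1 = rpoly N1 w1" "rpoly D2 w2 \<noteq> 0" "h (s2\<^sup>2) * rpoly D2 w2 = rpoly N2 w2"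
    and s1: "s1 \<noteq> 0" "s1 \<in> od" "s2 \<in> od"
    and ev: "\<And>u. u \<in> ev \<Longrightarrow> u = z1 \<and> h u = w1 \<or> u = z2 \<and> h u = w2"
    and od: "\<And>q. q \<in> od \<Longrightarrow> \<exists>s r \<rho>. (s = s1 \<or> s = s2) \<and> (r, \<rho>) \<in> {(1, 1), (z1, w1), (z2, w2)} \<and> q = s * r
        \<and> (\<forall>q'\<in>od. h (q * q' / a) = \<rho> * h (s * q' / a))"
    and W: "h (s1 * s1 / a) \<noteq> 0"
    and graph: "\<And>u v r :: rat. generic_data N1 D1 N2 D2 u v r \<Longrightarrow> \<exists>F (g :: ambient \<Rightarrow> rat). local_hom F g \<and>
      z1 \<in> F \<and> z2 \<in> F \<and> s2 / s1 \<in> F \<and> s1\<^sup>2 \<in> F \<and> g z1 = u \<and> g z2 = v \<and> g (s2 / s1) = r"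
  obtains g :: "nat \<Rightarrow> ambient \<Rightarrow> rat" where
    "\<forall>\<^sub>F n in sequentially. rat_hom C (g n)" "\<And>z. z \<in> C \<Longrightarrow> (\<lambda>n. of_rat (g n z)) \<longlonglongrightarrow> h z"
proof -
  interpret padic_field "TYPE('k)" p by fact
  interpret h: rat_hom C h by fact
  have in_C: "b \<in> C" if "b \<in> even_part ev od" for b
    unfolding C by (rule hull_inc) (use that in blast)
  have prods: "q * q' \<in> C" "q * q' / a \<in> C" if "q \<in> od" "q' \<in> od" for q q'
  proof -
    have "q * q' \<in> I" using that I(2) by (auto simp: products_def)
    then show "q * q' / a \<in> C" unfolding C by (blast intro: hull_inc)
    show "q * q' \<in> C" by (rule in_C[OF even_part_gens(3)[OF that]])
  qed
  interpret A: subalg "even_part ev od" by (rule subalg_even_part)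
  have a_C: "a \<in> C"
    using a(1) I(1) A.module_span_subset[OF even_part_gens(2)[of od ev]] in_C by blast
  define W where "W = h (s1 * s1 / a)"
  define l where "l = h (s1 * s2 / a) / W"
  have W0: "W \<noteq> 0" using W by (simp add: W_def)
  have h_prod: "h (q * q') = h a * h (q * q' / a)" if "q \<in> od" "q' \<in> od" for q q'
    using h.h_mult[OF a_C prods(2)[OF that]] a(2) by simp
  have "h (s2 * s2 / a) * W = h ((s2 * s2 / a) * (s1 * s1 / a))"
    unfolding W_def by (rule h.h_mult[symmetric]) (use prods s1 in auto)
  also have "(s2 * s2 / a) * (s1 * s1 / a) = (s1 * s2 / a) * (s1 * s2 / a)" by simp
  also have "h \<dots> = h (s1 * s2 / a) * h (s1 * s2 / a)"
    by (rule h.h_mult) (use prods s1 in auto)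
  finally have "h (s2 * s2 / a) = l\<^sup>2 * W"
    using W0 by (simp add: l_def field_simps power2_eq_square)
  \<comment> \<open>The Kummer equation holds over the exceptional curves as well: it is derived for
    quotients by \<open>a\<close> and then multiplied by \<open>h a\<close>, which may be 0.\<close>
  then have h_s2: "h (s2\<^sup>2) = l\<^sup>2 * h (s1\<^sup>2)"
    using h_prod[OF s1(2,2)] h_prod[OF s1(3,3)] by (simp add: power2_eq_square W_def)
  have eq: "rpoly N2 w2 * rpoly D1 w1 = l\<^sup>2 * rpoly N1 w1 * rpoly D2 w2"
    unfolding w(2,4)[symmetric] h_s2 by simp
  have twists: "\<exists>c. c \<noteq> 0 \<and> (\<exists>e :: 'k. d = of_rat c * e\<^sup>2) \<and> twist_dense f c" if "d \<noteq> 0" for d :: 'k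
    by (rule suitable_twists_dense[OF valued_field_axioms tw that])
  define P where "P n F g \<longleftrightarrow> (\<exists>u v r :: rat. generic_data N1 D1 N2 D2 u v r \<and>
      dist (of_rat u) w1 < 1 / real (Suc n) \<and> dist (of_rat v) w2 < 1 / real (Suc n) \<and> dist (of_rat r) l < 1 / real (Suc n) \<and>
      local_hom F g \<and> z1 \<in> F \<and> z2 \<in> F \<and> s2 / s1 \<in> F \<and> s1\<^sup>2 \<in> F \<and> g z1 = u \<and> g z2 = v \<and> g (s2 / s1) = r)"
    for n F and g :: "ambient \<Rightarrow> rat"
  have "\<exists>Fg. P n (fst Fg) (snd Fg)" for n
  proof -
    have pos: "1 / real (Suc n) > 0" by simp
    obtain u v r :: rat where uvr: "generic_data N1 D1 N2 D2 u v r" "dist (of_rat u) w1 < 1 / real (Suc n)"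
      "dist (of_rat v) w2 < 1 / real (Suc n)" "dist (of_rat r) l < 1 / real (Suc n)"
      by (rule data_dense[OF deg coprime twists model(1,2) w(1,3) eq pos])
    obtain F and g :: "ambient \<Rightarrow> rat" where "local_hom F g" "z1 \<in> F" "z2 \<in> F" "s2 / s1 \<in> F" "s1\<^sup>2 \<in> F"
      "g z1 = u" "g z2 = v" "g (s2 / s1) = r"
      using graph[OF uvr(1)] by blast
    then have "P n F g" using uvr unfolding P_def by blast
    then show ?thesis by (intro exI[of _ "(F, g)"]) simp
  qed
  then have P: "P n (fst (SOME Fg. P n (fst Fg) (snd Fg))) (snd (SOME Fg. P n (fst Fg) (snd Fg)))" for n
    by (rule someI_ex)
  define F where "F n = fst (SOME Fg. P n (fst Fg) (snd Fg))" for n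
  define g where "g n = snd (SOME Fg. P n (fst Fg) (snd Fg))" for n
  have P: "P n (F n) (g n)" for n
    unfolding F_def g_def by (rule P)
  have F: "local_hom (F n) (g n)" "z1 \<in> F n" "z2 \<in> F n" "s2 / s1 \<in> F n" "s1\<^sup>2 \<in> F n"
    "generic_data N1 D1 N2 D2 (g n z1) (g n z2) (g n (s2 / s1))"
    "dist (of_rat (g n z1)) w1 < 1 / real (Suc n)" "dist (of_rat (g n z2)) w2 < 1 / real (Suc n)"
    "dist (of_rat (g n (s2 / s1))) l < 1 / real (Suc n)" for n
    using P[of n] unfolding P_def by blast+
  \<comment> \<open>\<open>s1\<^sup>2\<close> is not among the approximated coordinates; its values
    are those of N1 / D1 at the values of \<open>z1\<close>.\<close>
  have s1_sq: "(\<lambda>n. of_rat (g n (s1\<^sup>2))) \<longlonglongrightarrow> h (s1\<^sup>2)"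
  proof -
    have val: "of_rat (g n (s1\<^sup>2)) = rpoly N1 (of_rat (g n z1)) / (rpoly D1 (of_rat (g n z1)) :: 'k)" for n
    proof -
      interpret g: local_hom "F n" "g n" by (rule F(1))
      have "g n (s1\<^sup>2 * rpoly D1 z1) = g n (rpoly N1 z1)" by (simp add: model(3))
      then have "g n (s1\<^sup>2) * poly D1 (g n z1) = poly N1 (g n z1)"
        using F(2,5)[of n] by (simp add: g.h_mult g.h_rat_poly g.rat_poly map_poly_idI)
      moreover have "poly D1 (g n z1) \<noteq> 0" using F(6)[of n] by (simp add: generic_data_def map_poly_idI)
      ultimately have "g n (s1\<^sup>2) = poly N1 (g n z1) / poly D1 (g n z1)" by (simp add: field_simps)
      then show ?thesis by (simp add: of_rat_divide)
    qed
    have h_val: "h (s1\<^sup>2) = rpoly N1 w1 / rpoly D1 w1" using w(1,2) by (simp add: field_simps)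
    show ?thesis
      unfolding val h_val by (intro lim_divide lim_poly lim_of_dist_less[OF F(7)] w(1))
  qed
  have "(\<forall>\<^sub>F n in sequentially. rat_hom C (g n)) \<and> (\<forall>z\<in>C. (\<lambda>n. of_rat (g n z)) \<longlonglongrightarrow> h z)"
    by (rule limit_on_blowup_chart[OF fin I a C h s1 ev od W F(1-5) lim_of_dist_less[OF F(7)] lim_of_dist_less[OF F(8)] _ s1_sq])
       (use lim_of_dist_less[OF F(9)] in \<open>simp_all add: l_def W_def\<close>)
  then show ?thesis using that by blast
qed

lemma kummer_point_in_closure:
  fixes h :: "ambient \<Rightarrow> 'k :: {field_char_0, complete_space}"
  assumes pf: "padic_field TYPE('k) p" and tw: "suitable_twists f TYPE('k)"
    and V: "\<And>R. R \<in> V \<Longrightarrow> rat_subalgebra R" and "C \<in> V"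
    and c: "chart gen_x1 y1 ev1 od1" "chart gen_x2 y2 ev2 od2"
    and I_eq: "I = two_torsion_image_ideal (neg_pullback f) (rat_subalgebra hull ((ev1 \<union> ev2) \<union> (od1 \<union> od2)))"
    and a: "a \<in> I" "a \<noteq> 0"
    and C: "C = rat_subalgebra hull (even_part (ev1 \<union> ev2) (od1 \<union> od2) \<union> {b / a | b. b \<in> I})" and h: "rat_hom C h"
  shows "point_of_hom C h \<in> points_topology V closure_of (extend_scalars ` points V)"
proof -
  define ev od where "ev = ev1 \<union> ev2" and "od = od1 \<union> od2"
  define A where "A = even_part ev od"
  interpret padic_field "TYPE('k)" p by fact
  interpret h: rat_hom C h by fact
  interpret A: subalg A unfolding A_def by (rule subalg_even_part)
  have fin: "finite ev" "finite od" using c by (auto simp: ev_def od_def chart_def)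
  have I_le: "I \<subseteq> module_span A (products od)"
    unfolding I_eq A_def ev_def od_def by (rule two_torsion_image_ideal_subset[OF c])
  \<comment> \<open>At a point fixed by -1 an odd function equals its own negative, hence
    vanishes.\<close>
  have prods_I: "products od \<subseteq> I"
  proof
    fix b assume "b \<in> products od"
    then obtain q q' where q: "b = q * q'" "q \<in> od" "q' \<in> od" by (auto simp: products_def)
    define S where "S = rat_subalgebra hull ((ev1 \<union> ev2) \<union> (od1 \<union> od2))"
    have gens: "q \<in> S" "q' \<in> S" using q by (auto simp: S_def od_def intro: hull_inc)
    have "u b = 0" if u: "rat_alg_hom S u" "\<forall>z\<in>S. u (neg_pullback f z) = u z" for u :: "ambient \<Rightarrow> complex"
    proof -
      interpret u: rat_hom S u using u(1) by unfold_locales (simp_all add: S_def)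
      have "neg_pullback f q = - q"
        using q(2) chart_sign(2)[OF factor1 c(1)] chart_sign(2)[OF factor2 c(2)] by (auto simp: od_def)
      then have "u q = - u q"
        using bspec[OF u(2) gens(1)] u.h_uminus[OF gens(1)] by simp
      then have "2 * u q = 0" by (simp add: algebra_simps)
      then have "u q = 0" by simp
      then show ?thesis using q(1) gens by (simp add: u.h_mult)
    qed
    moreover have "b \<in> invariants (neg_pullback f) S"
      unfolding S_def invariants_chart[OF c] using q by (auto simp: od_def intro: even_part_gens(3))
    ultimately show "b \<in> I"
      unfolding I_eq S_def[symmetric] two_torsion_image_ideal_def by blast
  qed
  have in_C: "A \<subseteq> C" "\<And>b. b \<in> I \<Longrightarrow> b / a \<in> C"
    unfolding C ev_def[symmetric] od_def[symmetric] A_def[symmetric] by (auto intro!: hull_inc)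
  have prods: "q * q' \<in> C" "q * q' / a \<in> C" if "q \<in> od" "q' \<in> od" for q q'
  proof -
    have "q * q' \<in> products od" using that by (auto simp: products_def)
    then show "q * q' / a \<in> C" using prods_I in_C(2) by blast
    show "q * q' \<in> C" using in_C(1) even_part_gens(3)[OF that, of ev] by (auto simp: A_def)
  qed
  have ev_C: "ev1 \<subseteq> C" "ev2 \<subseteq> C"
    using in_C(1) even_part_gens(1)[of ev od] by (auto simp: A_def ev_def)
  have od_le: "od1 \<subseteq> od" "od2 \<subseteq> od" by (auto simp: od_def)
  obtain N1 D1 z1 s1 w1 where m1: "chart_model f gen_x1 y1 ev1 od1 N1 D1 z1 s1" "rpoly D1 w1 \<noteq> 0" "h (s1\<^sup>2) * rpoly D1 w1 = rpoly N1 w1"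
    "\<And>u. u \<in> ev1 \<Longrightarrow> u = z1 \<and> h u = w1"
    "\<And>q. q \<in> od1 \<Longrightarrow> \<exists>r \<rho>. (r, \<rho>) \<in> {(1, 1), (z1, w1)} \<and> q = s1 * r \<and> (\<forall>q'\<in>od. h (q * q' / a) = \<rho> * h (s1 * q' / a))"
    by (rule ex_model_of_hom[OF factor1 c(1) od_le(1) h ev_C(1)], erule (1) prods(1), erule (1) prods(2), rule that)
  obtain N2 D2 z2 s2 w2 where m2: "chart_model f gen_x2 y2 ev2 od2 N2 D2 z2 s2" "rpoly D2 w2 \<noteq> 0" "h (s2\<^sup>2) * rpoly D2 w2 = rpoly N2 w2"
    "\<And>u. u \<in> ev2 \<Longrightarrow> u = z2 \<and> h u = w2"
    "\<And>q. q \<in> od2 \<Longrightarrow> \<exists>r \<rho>. (r, \<rho>) \<in> {(1, 1), (z2, w2)} \<and> q = s2 * r \<and> (\<forall>q'\<in>od. h (q * q' / a) = \<rho> * h (s2 * q' / a))"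
    by (rule ex_model_of_hom[OF factor2 c(2) od_le(2) h ev_C(2)], erule (1) prods(1), erule (1) prods(2), rule that)
  note d1 = chart_modelD[OF factor1 m1(1)] and d2 = chart_modelD[OF factor2 m2(1)]
  have s_od: "s1 \<in> od" "s2 \<in> od" using d1(4) d2(4) by (auto simp: od_def)
  have od: "\<exists>s r \<rho>. (s = s1 \<or> s = s2) \<and> (r, \<rho>) \<in> {(1, 1), (z1, w1), (z2, w2)} \<and> q = s * r
        \<and> (\<forall>q'\<in>od. h (q * q' / a) = \<rho> * h (s * q' / a))" if "q \<in> od" for q
  proof -
    from that consider "q \<in> od1" | "q \<in> od2" by (auto simp: od_def)
    then show ?thesis by cases (use m1(5)[of q] m2(5)[of q] in blast)+
  qed
  have ev: "u = z1 \<and> h u = w1 \<or> u = z2 \<and> h u = w2" if "u \<in> ev" for u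
    using that m1(4) m2(4) by (auto simp: ev_def)
  \<comment> \<open>If both vanished, the rank one relation and the generators of the ideal would
    give \<open>b / a\<close> the value 0 for every \<open>b\<close> in the ideal, in particular for
    \<open>b = a\<close>.\<close>
  have "h (s1 * s1 / a) \<noteq> 0 \<or> h (s2 * s2 / a) \<noteq> 0"
  proof (rule ccontr)
    assume "\<not> (h (s1 * s1 / a) \<noteq> 0 \<or> h (s2 * s2 / a) \<noteq> 0)"
    then have zero: "h (s1 * s1 / a) = 0" "h (s2 * s2 / a) = 0" by auto
    have "h (s1 * s2 / a) * h (s1 * s2 / a) = h ((s1 * s2 / a) * (s1 * s2 / a))"
      by (rule h.h_mult[symmetric]) (use prods s_od in auto)
    also have "(s1 * s2 / a) * (s1 * s2 / a) = (s1 * s1 / a) * (s2 * s2 / a)" by simp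
    also have "h \<dots> = h (s1 * s1 / a) * h (s2 * s2 / a)"
      by (rule h.h_mult) (use prods s_od in auto)
    finally have "h (s1 * s2 / a) = 0" using zero by simp
    then have params: "h (s * s' / a) = 0" if "s = s1 \<or> s = s2" "s' = s1 \<or> s' = s2" for s s'
      using that zero by (auto simp: mult.commute)
    have quot: "h (q * q' / a) = 0" if qq': "q \<in> od" "q' \<in> od" for q q'
    proof -
      obtain s \<rho> where s: "s = s1 \<or> s = s2" "\<forall>q'\<in>od. h (q * q' / a) = \<rho> * h (s * q' / a)"
        using od[OF qq'(1)] by blast
      obtain s' \<rho>' where s': "s' = s1 \<or> s' = s2" "\<forall>q\<in>od. h (q' * q / a) = \<rho>' * h (s' * q / a)"
        using od[OF qq'(2)] by blast
      have "h (q * q' / a) = \<rho> * h (q' * s / a)" using s(2) qq'(2) by (simp add: mult.commute)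
      also have "h (q' * s / a) = \<rho>' * h (s' * s / a)" using s'(2) s(1) s_od by blast
      also have "h (s' * s / a) = 0" using params s s' by blast
      finally show ?thesis by simp
    qed
    have "j / a \<in> C \<and> h (j / a) = 0" if "j \<in> module_span A (products od)" for j
      using that
    proof (induction rule: module_span.induct)
      case (step m r b)
      have b: "b / a \<in> C" "h (b / a) = 0"
        using step(3) prods quot by (auto simp: products_def)
      have r: "r \<in> C" using step(2) in_C by blast
      have "(m + r * b) / a = m / a + r * (b / a)" by (simp add: add_divide_distrib)
      then show ?case using step(4) b r h.mult[OF r b(1)] h.add h.h_add[of "m / a" "r * (b / a)"] h.h_mult[OF r b(1)]
        by simp
    qed simp
    then have "h (a / a) = 0" using a(1) I_le by blast
    then show False using a(2) by simp
  qed
  then obtain g :: "nat \<Rightarrow> ambient \<Rightarrow> rat" where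
    g: "\<forall>\<^sub>F n in sequentially. rat_hom C (g n)" "\<And>z. z \<in> C \<Longrightarrow> (\<lambda>n. of_rat (g n z)) \<longlonglongrightarrow> h z"
  proof
    assume W: "h (s1 * s1 / a) \<noteq> 0"
    have graph: "\<exists>F (g :: ambient \<Rightarrow> rat). local_hom F g \<and>
      z1 \<in> F \<and> z2 \<in> F \<and> s2 / s1 \<in> F \<and> s1\<^sup>2 \<in> F \<and> g z1 = u \<and> g z2 = v \<and> g (s2 / s1) = r"
      if "generic_data N1 D1 N2 D2 u v r" for u v r :: rat
      using ex_generic_hom[OF m1(1) m2(1) that] by metis
    show ?thesis
      by (rule ex_rational_approximation[OF pf tw fin I_le[unfolded A_def] prods_I a
           C[folded ev_def od_def] h d1(1) d2(1) d1(2) m1(2,3) m2(2,3) d1(3) s_od ev od W graph that])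
  next
    assume W: "h (s2 * s2 / a) \<noteq> 0"
    have graph: "\<exists>F (g :: ambient \<Rightarrow> rat). local_hom F g \<and>
      z2 \<in> F \<and> z1 \<in> F \<and> s1 / s2 \<in> F \<and> s2\<^sup>2 \<in> F \<and> g z2 = u \<and> g z1 = v \<and> g (s1 / s2) = r"
      if gen: "generic_data N2 D2 N1 D1 u v r" for u v r :: rat
    proof -
      have r: "r \<noteq> 0" using gen by (simp add: generic_data_def)
      \<comment> \<open>Exchanging the factors replaces the ratio by its inverse.\<close>
      have gen': "generic_data N1 D1 N2 D2 v u (inverse r)"
        using gen by (auto simp: generic_data_def field_simps power2_eq_square)
      obtain F and g :: "ambient \<Rightarrow> rat" where F: "local_hom F g" "z1 \<in> F" "z2 \<in> F" "s2 / s1 \<in> F" "s1\<^sup>2 \<in> F"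
        "g z1 = v" "g z2 = u" "g (s2 / s1) = inverse r"
        by (rule ex_generic_hom[OF m1(1) m2(1) gen'])
      interpret g: local_hom F g by (rule F(1))
      have inv: "inverse (s2 / s1) \<in> F" using F(4,8) r by (intro g.inverse_closed) auto
      have "(s2 / s1)\<^sup>2 * s1\<^sup>2 \<in> F" by (rule g.mult[OF g.power[OF F(4)] F(5)])
      then have "s2\<^sup>2 \<in> F" using d1(3) by (simp add: power_divide)
      moreover have "g (s1 / s2) = r" "s1 / s2 \<in> F"
        using g.h_inverse[OF F(4) inv] inv F(8) by simp_all
      ultimately show ?thesis using F by blast
    qed
    have od': "\<exists>s r \<rho>. (s = s2 \<or> s = s1) \<and> (r, \<rho>) \<in> {(1, 1), (z2, w2), (z1, w1)} \<and> q = s * r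
        \<and> (\<forall>q'\<in>od. h (q * q' / a) = \<rho> * h (s * q' / a))" if "q \<in> od" for q
      using od[OF that] by blast
    have ev': "u = z2 \<and> h u = w2 \<or> u = z1 \<and> h u = w1" if "u \<in> ev" for u
      using ev[OF that] by blast
    show ?thesis
      by (rule ex_rational_approximation[OF pf tw fin I_le[unfolded A_def] prods_I a
           C[folded ev_def od_def] h d2(1) d1(1) d2(2) m2(2,3) m1(2,3) d2(3) s_od(2,1) ev' od' W graph that])
  qed
  show ?thesis
    by (rule point_in_closure[OF V \<open>C \<in> V\<close> h g])
qed

lemma kummer_variety_charts:
  assumes "C \<in> kummer_variety (elliptic_square f) (neg_pullback f)"
  obtains ev1 od1 ev2 od2 a I where "chart gen_x1 y1 ev1 od1" "chart gen_x2 y2 ev2 od2"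
    "I = two_torsion_image_ideal (neg_pullback f) (rat_subalgebra hull ((ev1 \<union> ev2) \<union> (od1 \<union> od2)))"
    "a \<in> I" "a \<noteq> 0" "C = rat_subalgebra hull (even_part (ev1 \<union> ev2) (od1 \<union> od2) \<union> {b / a | b. b \<in> I})"
proof -
  obtain R where R: "R \<in> elliptic_square f"
    "C \<in> blowup_charts (invariants (neg_pullback f) R) (two_torsion_image_ideal (neg_pullback f) R)"
    using assms unfolding kummer_variety_def by blast
  obtain ev1 od1 ev2 od2 where c: "chart gen_x1 y1 ev1 od1" "chart gen_x2 y2 ev2 od2"
    "R = rat_subalgebra hull ((ev1 \<union> ev2) \<union> (od1 \<union> od2))"
    using R(1) unfolding elliptic_square_def product_variety_charts by blast
  then show ?thesis
    using R(2) that[OF c(1,2) refl] unfolding blowup_charts_def c(3) invariants_chart[OF c(1,2)] by blast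
qed

end

theorem theorem3p1:
  fixes p :: nat and f :: "rat poly"
  assumes "Factorial_Ring.prime p"
    and "padic_completion p TYPE('k :: {field_char_0, complete_space})"
    and "weierstrass_cubic f"
    and "suitable_twists f TYPE('k)"
  shows "rational_points_dense (kummer_variety (elliptic_square f) (neg_pullback f)) TYPE('k)"
proof -
  interpret weierstrass f by unfold_locales fact
  define V where "V = kummer_variety (elliptic_square f) (neg_pullback f)"
  have V: "rat_subalgebra R" if "R \<in> V" for R
    using that unfolding V_def kummer_variety_def blowup_charts_def by auto
  have "P \<in> points_topology V closure_of (extend_scalars ` points V)" if P: "P \<in> points V" for P :: "(ambient \<times> 'k) set"
  proof -
    obtain C h where C: "P = point_of_hom C h" "C \<in> V" "rat_alg_hom C h"
      using P unfolding points_def by blast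
    have h: "rat_hom C h" using C(3) V[OF C(2)] by unfold_locales
    show ?thesis
      unfolding C(1)
      by (rule kummer_variety_charts[OF C(2)[unfolded V_def]])
         (rule kummer_point_in_closure[OF padic_fieldI[OF assms(1,2)] assms(4) V C(2) _ _ _ _ _ _ h])
  qed
  moreover have "points_topology V closure_of (extend_scalars ` points V) \<subseteq> (points V :: (ambient \<times> 'k) set set)"
    using closure_of_subset_topspace[of "points_topology V"] topspace_points_topology[of V] V by metis
  ultimately show ?thesis
    unfolding rational_points_dense_def V_def[symmetric] by blast
qed

end
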